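(* Let $\bar v\in\mathbb C^{n(n-1)/2}$ be a $1$-singular vector with $\bar v_{ki}=\bar v_{kj}$ and all other differences $\bar v_{rs}-\bar v_{ru}$ ($1\le s<u\le r\le n-1$, $(r,s,u)\ne(k,i,j)$) non-integer. Then the operators $$E_{rs}(T(\bar v+z))=\mathcal D^{\bar v}\big((x-y)E_{rs}T(v+z)\big),\qquad E_{rs}(\mathcal D T(\bar v+w))=\mathcal D^{\bar v}\big(E_{rs}T(v+w)\big)$$ ($1\le r,s\le n$; $z,w\in\mathbb Z^{n(n-1)/2}$, $\tau(w)\neq w$) make $V(T(\bar v))$ into a $\mathfrak{gl}(n)$-module.
   Context: Ground field $\mathbb C$; $E_{rs}$ are the elementary matrices in $\mathfrak{gl}(n)$. Fix $n$, integers $1\le i<j\le k\le n-1$ and $a_1,\dots,a_n\in\mathbb C$. A vector $v=(v_{rs})_{1\le s\le r\le n-1}\in\mathbb C^{n(n-1)/2}$ is extended by $v_{ns}=a_s$; vectors $z\in\mathbb Z^{n(n-1)/2}$ are extended by $z_{ns}=0$. $\delta^{rs}$ is the vector with $(r,s)$ entry $1$ and all others $0$. $v$ is generic if $v_{rs}-v_{ru}\notin\mathbb Z$ for all $1\le s<u\le r\le n-1$; it is $1$-singular if exactly one such difference is an integer. $\tau$ interchanges the $(k,i)$ and $(k,j)$ entries of a vector. Put $x=v_{ki}$, $y=v_{kj}$. Generic modules: for generic $v$, $V(T(v))$ is the $\mathfrak{gl}(n)$-module with basis the tableaux (symbols) $T(w)$, $w\in v+\mathbb Z^{n(n-1)/2}$,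 and action $$E_{p,p+1}T(w)=-\sum_{q=1}^{p}\frac{\prod_{u=1}^{p+1}(w_{pq}-w_{p+1,u})}{\prod_{u\ne q}(w_{pq}-w_{pu})}T(w+\delta^{pq}),\quad E_{p+1,p}T(w)=\sum_{q=1}^{p}\frac{\prod_{u=1}^{p-1}(w_{pq}-w_{p-1,u})}{\prod_{u\ne q}(w_{pq}-w_{pu})}T(w-\delta^{pq}),$$ $$E_{pp}T(w)=\Big(\sum_{q=1}^{p}(w_{pq}+q-1)-\sum_{q=1}^{p-1}(w_{p-1,q}+q-1)\Big)T(w)$$ (this determines all $E_{rs}$). For each $r,s$ and $z\in\mathbb Z^{n(n-1)/2}$, $E_{rs}T(v+z)$ is regarded as a finite combination of the $T(v+z')$ whose coefficients are rational functions of the variables $v_{pq}$ ($1\le q\le p\le n-1$). The coefficients of $(x-y)E_{rs}T(v+z)$ are regular at $\bar v$, and so are those of $E_{rs}T(v+w)$ if $\tau(w)\ne w$. The space $V(T(\bar v))$ is the vector space spanned by symbols $T(\bar v+z)$ and $\mathcal DT(\bar v+z)$ (derivative tableaux), $z\in\mathbb Z^{n(n-1)/2}$, subject only to the relations $T(\bar v+z)=T(\bar v+\tau(z))$ and $\mathcal DT(\bar v+z)=-\mathcal DT(\bar v+\tau(z))$. For a rational function $f$ of $v$ regular at $\bar v$ put $\mathcal D^{\bar v}(f)=\frac12\big(\frac{\partial f}{\partial x}-\frac{\partial f}{\partial y}\big)(\bar v)$, and extend linearly by $\mathcal D^{\bar v}(fT(v+z))=\mathcal D^{\bar v}(f)\,T(\bar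 v+z)+f(\bar v)\,\mathcal DT(\bar v+z)$. *)

theory Defs
  imports
    "HOL-Analysis.Derivative"
    "HOL-Library.Poly_Mapping"
    "Jordan_Normal_Form.Matrix"
begin

section \<open>Index vectors\<close>

text \<open>
  Vectors with entries indexed by pairs (r, s), 1 \<le> s \<le> r \<le> n - 1, are functions of r and s.
  The lattice vectors vanish outside that range; this includes the convention that their n-th row
  is 0. For complex vectors v the values outside the range are never looked at, and
  \<open>tableau n a v z\<close> is v + z, extended by the fixed top row a.
\<close>

type_synonym cvec = "nat \<Rightarrow> nat \<Rightarrow> complex"
type_synonym zvec = "nat \<Rightarrow> nat \<Rightarrow> int"

definition zlattice :: "nat \<Rightarrow> zvec set" where
  "zlattice n = {z. \<forall>r s. \<not> (1 \<le> s \<and> s \<le> r \<and> r \<le> n - 1) \<longrightarrow> z r s = 0}"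

definition tableau :: "nat \<Rightarrow> (nat \<Rightarrow> complex) \<Rightarrow> cvec \<Rightarrow> zvec \<Rightarrow> cvec" where
  "tableau n a v z r s = (if r = n then a s else v r s) + of_int (z r s)"

definition set_entry :: "(nat \<Rightarrow> nat \<Rightarrow> 'a) \<Rightarrow> nat \<Rightarrow> nat \<Rightarrow> 'a \<Rightarrow> nat \<Rightarrow> nat \<Rightarrow> 'a" where
  "set_entry v r s x = v(r := (v r)(s := x))"

text \<open>\<open>shift z p q c\<close> is \<open>z + c \<delta>\<^sup>p\<^sup>q\<close>.\<close>

definition shift :: "zvec \<Rightarrow> nat \<Rightarrow> nat \<Rightarrow> int \<Rightarrow> zvec" where
  "shift z p q c = set_entry z p q (z p q + c)"

definition tau :: "nat \<Rightarrow> nat \<Rightarrow> nat \<Rightarrow> (nat \<Rightarrow> nat \<Rightarrow> 'a) \<Rightarrow> nat \<Rightarrow> nat \<Rightarrow> 'a" where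
  "tau k i j z = set_entry (set_entry z k i (z k j)) k j (z k i)"

definition generic :: "nat \<Rightarrow> cvec \<Rightarrow> bool" where
  "generic n v \<longleftrightarrow>
     (\<forall>r s u. 1 \<le> s \<and> s < u \<and> u \<le> r \<and> r \<le> n - 1 \<longrightarrow> v r s - v r u \<notin> \<int>)"

definition one_singular :: "nat \<Rightarrow> cvec \<Rightarrow> bool" where
  "one_singular n v \<longleftrightarrow>
     (\<exists>!(r, s, u). 1 \<le> s \<and> s < u \<and> u \<le> r \<and> r \<le> n - 1 \<and> v r s - v r u \<in> \<int>)"


section \<open>Free complex vector spaces\<close>

definition pm_scale :: "complex \<Rightarrow> ('b \<Rightarrow>\<^sub>0 complex) \<Rightarrow> ('b \<Rightarrow>\<^sub>0 complex)" where
  "pm_scale c f = Poly_Mapping.map ((*) c) f"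

lemma lookup_pm_scale [simp]: "Poly_Mapping.lookup (pm_scale c f) x = c * Poly_Mapping.lookup f x"
  by (simp add: pm_scale_def Poly_Mapping.map.rep_eq when_def)

global_interpretation pm: vector_space "pm_scale :: complex \<Rightarrow> ('b \<Rightarrow>\<^sub>0 complex) \<Rightarrow> _"
  defines pm_span = pm.span
  by unfold_locales (auto intro!: poly_mapping_eqI simp: lookup_add algebra_simps)

text \<open>Linear extension of a map b given on the basis.\<close>

definition lin_ext ::
  "(complex \<Rightarrow> 'v \<Rightarrow> 'v::comm_monoid_add) \<Rightarrow> ('b \<Rightarrow> 'v) \<Rightarrow> ('b \<Rightarrow>\<^sub>0 complex) \<Rightarrow> 'v" where
  "lin_ext sc b f = (\<Sum>x\<in>Poly_Mapping.keys f. sc (Poly_Mapping.lookup f x) (b x))"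


section \<open>Modules over gl(n)\<close>

text \<open>The rows and columns of matrices are counted from 0 in the library, from 1 in \<open>E\<^sub>r\<^sub>s\<close>.\<close>

definition elem_mat :: "nat \<Rightarrow> nat \<Rightarrow> nat \<Rightarrow> complex mat" where
  "elem_mat n r s = mat n n (\<lambda>(p, q). if p + 1 = r \<and> q + 1 = s then 1 else 0)"

definition gl_module ::
  "nat \<Rightarrow> (complex \<Rightarrow> 'v \<Rightarrow> 'v::ab_group_add) \<Rightarrow> (complex mat \<Rightarrow> 'v \<Rightarrow> 'v) \<Rightarrow> bool" where
  "gl_module n sc \<rho> \<longleftrightarrow>
     vector_space sc \<and>
     (\<forall>A\<in>carrier_mat n n. Vector_Spaces.linear sc sc (\<rho> A)) \<and>
     (\<forall>A\<in>carrier_mat n n. \<forall>B\<in>carrier_mat n n. \<forall>x. \<rho> (A + B) x = \<rho> A x + \<rho> B x) \<and>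
     (\<forall>c. \<forall>A\<in>carrier_mat n n. \<forall>x. \<rho> (c \<cdot>\<^sub>m A) x = sc c (\<rho> A x)) \<and>
     (\<forall>A\<in>carrier_mat n n. \<forall>B\<in>carrier_mat n n. \<forall>x.
        \<rho> (A * B - B * A) x = \<rho> A (\<rho> B x) - \<rho> B (\<rho> A x))"


section \<open>The generic Gelfand-Tsetlin modules\<close>

text \<open>
  The space with basis T(v + z) is represented by the finitely supported functions of z.
  \<open>gt_up\<close>, \<open>gt_down\<close> and \<open>gt_diag\<close> give \<open>E\<^sub>p\<^sub>,\<^sub>p\<^sub>+\<^sub>1 T(v + z)\<close>, \<open>E\<^sub>p\<^sub>+\<^sub>1\<^sub>,\<^sub>p T(v + z)\<close>
  and \<open>E\<^sub>p\<^sub>p T(v + z)\<close>.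
\<close>

definition gt_up :: "nat \<Rightarrow> (nat \<Rightarrow> complex) \<Rightarrow> cvec \<Rightarrow> nat \<Rightarrow> zvec \<Rightarrow> (zvec \<Rightarrow>\<^sub>0 complex)" where
  "gt_up n a v p z = (let w = tableau n a v z in
     (\<Sum>q=1..p. Poly_Mapping.single (shift z p q 1)
        (- ((\<Prod>u=1..p+1. w p q - w (p+1) u) / (\<Prod>u\<in>{1..p}-{q}. w p q - w p u)))))"

definition gt_down :: "nat \<Rightarrow> (nat \<Rightarrow> complex) \<Rightarrow> cvec \<Rightarrow> nat \<Rightarrow> zvec \<Rightarrow> (zvec \<Rightarrow>\<^sub>0 complex)" where
  "gt_down n a v p z = (let w = tableau n a v z in
     (\<Sum>q=1..p. Poly_Mapping.single (shift z p q (-1))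
        ((\<Prod>u=1..p-1. w p q - w (p-1) u) / (\<Prod>u\<in>{1..p}-{q}. w p q - w p u))))"

definition gt_diag :: "nat \<Rightarrow> (nat \<Rightarrow> complex) \<Rightarrow> cvec \<Rightarrow> nat \<Rightarrow> zvec \<Rightarrow> (zvec \<Rightarrow>\<^sub>0 complex)" where
  "gt_diag n a v p z = (let w = tableau n a v z in
     Poly_Mapping.single z
       ((\<Sum>q=1..p. w p q + of_nat q - 1) - (\<Sum>q=1..p-1. w (p-1) q + of_nat q - 1)))"

definition commutator :: "('v \<Rightarrow> 'v) \<Rightarrow> ('v \<Rightarrow> 'v) \<Rightarrow> 'v \<Rightarrow> 'v::ab_group_add" where
  "commutator A B x = A (B x) - B (A x)"

text \<open>
  The remaining \<open>E\<^sub>r\<^sub>s\<close> are determined by \<open>E\<^sub>r\<^sub>s = [E\<^sub>r\<^sub>,\<^sub>s\<^sub>-\<^sub>1, E\<^sub>s\<^sub>-\<^sub>1\<^sub>,\<^sub>s]\<close> for r < s - 1 and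
  \<open>E\<^sub>r\<^sub>s = [E\<^sub>r\<^sub>,\<^sub>s\<^sub>+\<^sub>1, E\<^sub>s\<^sub>+\<^sub>1\<^sub>,\<^sub>s]\<close> for r > s + 1, which hold in gl(n).
\<close>

function gt_E :: "nat \<Rightarrow> (nat \<Rightarrow> complex) \<Rightarrow> cvec \<Rightarrow> nat \<Rightarrow> nat \<Rightarrow>
    (zvec \<Rightarrow>\<^sub>0 complex) \<Rightarrow> (zvec \<Rightarrow>\<^sub>0 complex)" where
  "gt_E n a v r s =
     (if r = s then lin_ext pm_scale (gt_diag n a v r)
      else if s = r + 1 then lin_ext pm_scale (gt_up n a v r)
      else if r = s + 1 then lin_ext pm_scale (gt_down n a v s)
      else if r < s then commutator (gt_E n a v r (s-1)) (gt_E n a v (s-1) s)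
      else commutator (gt_E n a v r (s+1)) (gt_E n a v (s+1) s))"
  by pat_completeness auto
termination
  by (relation "Wellfounded.measure (\<lambda>(n, a, v, r, s). (r - s) + (s - r))") auto

declare gt_E.simps [simp del]

text \<open>\<open>gt_coeff n a r s z z'\<close> is the coefficient of T(v + z') in \<open>E\<^sub>r\<^sub>s T(v + z)\<close>, as a function of v.\<close>

definition gt_coeff ::
  "nat \<Rightarrow> (nat \<Rightarrow> complex) \<Rightarrow> nat \<Rightarrow> nat \<Rightarrow> zvec \<Rightarrow> zvec \<Rightarrow> cvec \<Rightarrow> complex" where
  "gt_coeff n a r s z z' v = Poly_Mapping.lookup (gt_E n a v r s (Poly_Mapping.single z 1)) z'"


section \<open>Rational functions and the operator D\<close>

inductive_set poly_funs :: "nat \<Rightarrow> (cvec \<Rightarrow> complex) set" for n where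
  const: "(\<lambda>_. c) \<in> poly_funs n"
| var: "1 \<le> q \<Longrightarrow> q \<le> p \<Longrightarrow> p \<le> n - 1 \<Longrightarrow> (\<lambda>v. v p q) \<in> poly_funs n"
| add: "f \<in> poly_funs n \<Longrightarrow> g \<in> poly_funs n \<Longrightarrow> (\<lambda>v. f v + g v) \<in> poly_funs n"
| mult: "f \<in> poly_funs n \<Longrightarrow> g \<in> poly_funs n \<Longrightarrow> (\<lambda>v. f v * g v) \<in> poly_funs n"

text \<open>
  The coefficients above are rational functions of v without poles at generic v. As the generic
  vectors are dense, a rational function of this kind is identified with its values at generic
  vectors; the values that the total division of HOL assigns elsewhere are irrelevant.
  \<open>regular_form n v0 f\<close> is a quotient P / Q of polynomials with \<open>Q v0 \<noteq> 0\<close> that represents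
  the rational function f. For f regular at v0 it exists, and near v0 it does not depend on the
  choice of P and Q.
\<close>

definition regular_form :: "nat \<Rightarrow> cvec \<Rightarrow> (cvec \<Rightarrow> complex) \<Rightarrow> cvec \<Rightarrow> complex" where
  "regular_form n v0 f = (SOME g. \<exists>P\<in>poly_funs n. \<exists>Q\<in>poly_funs n.
     Q v0 \<noteq> 0 \<and> (\<forall>v. generic n v \<longrightarrow> f v * Q v = P v) \<and> g = (\<lambda>v. P v / Q v))"

definition rat_value :: "nat \<Rightarrow> cvec \<Rightarrow> (cvec \<Rightarrow> complex) \<Rightarrow> complex" where
  "rat_value n v0 f = regular_form n v0 f v0"

definition rat_partial ::
  "nat \<Rightarrow> cvec \<Rightarrow> nat \<Rightarrow> nat \<Rightarrow> (cvec \<Rightarrow> complex) \<Rightarrow> complex" where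
  "rat_partial n v0 r s f = deriv (\<lambda>t. regular_form n v0 f (set_entry v0 r s t)) (v0 r s)"

definition D_rat ::
  "nat \<Rightarrow> nat \<Rightarrow> nat \<Rightarrow> nat \<Rightarrow> cvec \<Rightarrow> (cvec \<Rightarrow> complex) \<Rightarrow> complex" where
  "D_rat n k i j v0 f = 1/2 * (rat_partial n v0 k i f - rat_partial n v0 k j f)"

text \<open>
  \<open>D_comb\<close> is the linear extension of D to finite combinations, over z, of the T(v + z) with
  rational coefficients c z; the sum ranges over those z for which c z is nonzero as a rational function.
\<close>

definition D_comb ::
  "nat \<Rightarrow> nat \<Rightarrow> nat \<Rightarrow> nat \<Rightarrow> cvec \<Rightarrow> (complex \<Rightarrow> 'v \<Rightarrow> 'v) \<Rightarrow> (zvec \<Rightarrow> 'v) \<Rightarrow> (zvec \<Rightarrow> 'v) \<Rightarrow>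
   (zvec \<Rightarrow> cvec \<Rightarrow> complex) \<Rightarrow> 'v::ab_group_add" where
  "D_comb n k i j v0 sc T DT c =
     (\<Sum>z\<in>{z. \<exists>v. generic n v \<and> c z v \<noteq> 0}.
        sc (D_rat n k i j v0 (c z)) (T z) + sc (rat_value n v0 (c z)) (DT z))"


section \<open>The space of tableaux and derivative tableaux\<close>

datatype symb = Tab zvec | DTab zvec

definition symbols :: "nat \<Rightarrow> symb set" where
  "symbols n = Tab ` zlattice n \<union> DTab ` zlattice n"

definition relators :: "nat \<Rightarrow> nat \<Rightarrow> nat \<Rightarrow> nat \<Rightarrow> (symb \<Rightarrow>\<^sub>0 complex) set" where
  "relators n k i j =
     {Poly_Mapping.single (Tab z) 1 - Poly_Mapping.single (Tab (tau k i j z)) 1 | z. z \<in> zlattice n} \<union>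
     {Poly_Mapping.single (DTab z) 1 + Poly_Mapping.single (DTab (tau k i j z)) 1 | z. z \<in> zlattice n}"

text \<open>
  The vector space \<open>'v\<close> is spanned by T z and DT z, standing for \<open>T(v0 + z)\<close> and \<open>DT(v0 + z)\<close>
  with z in the lattice, and is presented by the relators: the canonical map from the free vector
  space on the symbols onto \<open>'v\<close> is surjective, with kernel the span of the relators.
\<close>

definition tableau_space ::
  "nat \<Rightarrow> nat \<Rightarrow> nat \<Rightarrow> nat \<Rightarrow> (complex \<Rightarrow> 'v \<Rightarrow> 'v::ab_group_add) \<Rightarrow> (zvec \<Rightarrow> 'v) \<Rightarrow> (zvec \<Rightarrow> 'v) \<Rightarrow> bool"
where
  "tableau_space n k i j sc T DT \<longleftrightarrow>
     vector_space sc \<and>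
     lin_ext sc (case_symb T DT) ` {f. Poly_Mapping.keys f \<subseteq> symbols n} = UNIV \<and>
     (\<forall>f. Poly_Mapping.keys f \<subseteq> symbols n \<longrightarrow>
        (lin_ext sc (case_symb T DT) f = 0 \<longleftrightarrow> f \<in> pm_span (relators n k i j)))"

end

theory Submission
  imports Defs "HOL-Complex_Analysis.Laurent_Convergence"
begin

text \<open>
  Consider the line $v_t = \bar v + \frac t2(\delta^{ki} - \delta^{kj})$. On it $x - y = t$, the
  derivation \<open>D\<close> is $d/dt$ at \<open>t = 0\<close>, and the transposition \<open>\<tau>\<close> becomes \<open>t \<mapsto> -t\<close>. For small
  \<open>t \<noteq> 0\<close> the vector \<open>v\<^sub>t\<close> is generic, so the classical formulas define a gl(n)-module there, and
  the coefficients of \<open>E\<^sub>r\<^sub>s T(v\<^sub>t + z)\<close> expand into Laurent series in \<open>t\<close>. Let \<open>ev\<close> be the linear map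
  that sends \<open>f T(v\<^sub>t + z)\<close> to \<open>[t\<^sup>0]f \<cdot> T(z) + [t\<^sup>-\<^sup>1]f \<cdot> DT(z)\<close>. Then the two prescribed formulas say
  \<open>E\<^sub>r\<^sub>s T(z) = ev (E\<^sub>r\<^sub>s T(v\<^sub>t + z))\<close> and \<open>E\<^sub>r\<^sub>s DT(w) = ev (t\<^sup>-\<^sup>1 E\<^sub>r\<^sub>s T(v\<^sub>t + w))\<close>.

  The heart of the proof is \<open>rho_ev\<close>: \<open>ev\<close> intertwines the action on Laurent series with the prescribed
  operators, on the space of all combinations $\sum_z f_z T(v_t + z)$ that are invariant under \<open>\<tau>\<close> and
  have at most simple poles. A summand with \<open>\<tau> z \<noteq> z\<close> is no problem, since the coefficients of
  \<open>E\<^sub>r\<^sub>s T(v\<^sub>t + z)\<close> are then regular: only \<open>[t\<^sup>-\<^sup>1]f\<close> and \<open>[t\<^sup>0]f\<close> reach the coefficients that \<open>ev\<close> reads.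
  If \<open>\<tau> z = z\<close>, these coefficients may have a simple pole, but invariance makes \<open>f\<close> even, so that
  \<open>f = [t\<^sup>0]f + O(t\<^sup>2)\<close> and the error does not survive \<open>ev\<close>. The invariant space is stable under the
  action (\<open>invariant_act\<close>) and \<open>ev\<close> maps it onto the whole space of tableaux (\<open>T_eq_ev\<close>, \<open>DT_eq_ev\<close>),
  so the relations of gl(n) are inherited from the generic modules.

  This leaves three facts about the generic modules and their coefficients.

  \<^item> The classical formulas satisfy all relations of gl(n) (\<open>gt_E_relations\<close>). The relations between the
    \<open>E\<^sub>p\<^sub>,\<^sub>p\<^sub>+\<^sub>1\<close>, \<open>E\<^sub>p\<^sub>+\<^sub>1\<^sub>,\<^sub>p\<close> and \<open>E\<^sub>p\<^sub>p\<close> are checked directly: the Serre relations hold because a double sum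
    over two columns is antisymmetric (\<open>hop_serre1\<close>, \<open>hop_serre2\<close>), and \<open>[E\<^sub>p\<^sub>,\<^sub>p\<^sub>+\<^sub>1, E\<^sub>p\<^sub>+\<^sub>1\<^sub>,\<^sub>p]\<close> is computed by a
    Lagrange interpolation sum (\<open>lagrange_sum_weight\<close>). All other brackets follow formally (\<open>gl_relations\<close>).

  \<^item> The coefficients of \<open>E\<^sub>r\<^sub>s T(v + z)\<close> have at most a simple pole at $\bar v$, and none if \<open>\<tau> z \<noteq> z\<close>
    (\<open>regular_gt_coeff\<close>): in the iterated commutator that expresses \<open>E\<^sub>r\<^sub>s\<close>, every product contains at most one generator that moves row \<open>k\<close>.

  \<^item> The coefficients are equivariant under \<open>\<tau>\<close> (\<open>gt_coeff_tau\<close>), as the formulas are symmetric in the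
    entries of each row.
\<close>

section \<open>The brackets of gl(n) from those of its generators\<close>

definition br :: "'a::ring \<Rightarrow> 'a \<Rightarrow> 'a" where
  "br x y = x * y - y * x"

lemma br_simps [simp]:
  "br 0 x = 0" "br x 0 = 0" "br x x = 0"
  "br (- x) y = - br x y" "br x (- y) = - br x y"
  "br (x + y) z = br x z + br y z" "br z (x + y) = br z x + br z y"
  "br (x - y) z = br x z - br y z" "br z (x - y) = br z x - br z y"
  by (simp_all add: br_def algebra_simps)

lemma br_skew: "br y x = - br x y"
  by (simp add: br_def)

lemma jacobi_right: "br x (br y z) = br (br x y) z + br y (br x z)"
  by (simp add: br_def algebra_simps)

lemma jacobi_left: "br (br x y) z = br (br x z) y + br x (br y z)"
  by (simp add: br_def algebra_simps)

lemma br_br_eq_0: "br x z = 0 \<Longrightarrow> br y z = 0 \<Longrightarrow> br (br x y) z = 0"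
  by (simp add: jacobi_left[of x y z])

text \<open>
  A family of ring elements indexed like the elementary matrices, in which the entries away from the
  diagonals are iterated commutators and the entries next to the diagonal satisfy the Chevalley-Serre
  relations of gl(n). Torsion has to be excluded because one vanishing below comes from an element that
  equals its own negative.
\<close>

locale gl_generators =
  fixes n :: nat and E :: "nat \<Rightarrow> nat \<Rightarrow> 'a::ring"
  assumes no_2_torsion: "\<And>x::'a. x + x = 0 \<Longrightarrow> x = 0"
    and up: "\<And>r s. 1 \<le> r \<Longrightarrow> r + 1 < s \<Longrightarrow> s \<le> n \<Longrightarrow> E r s = br (E r (s-1)) (E (s-1) s)"
    and down: "\<And>r s. 1 \<le> s \<Longrightarrow> s + 1 < r \<Longrightarrow> r \<le> n \<Longrightarrow> E r s = br (E r (s+1)) (E (s+1) s)"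
    and hh: "\<And>p q. 1 \<le> p \<Longrightarrow> p \<le> n \<Longrightarrow> 1 \<le> q \<Longrightarrow> q \<le> n \<Longrightarrow> br (E p p) (E q q) = 0"
    and he: "\<And>p q. 1 \<le> p \<Longrightarrow> p < n \<Longrightarrow> 1 \<le> q \<Longrightarrow> q \<le> n \<Longrightarrow> br (E q q) (E p (p+1)) =
        (if q = p then E p (p+1) else 0) - (if q = p + 1 then E p (p+1) else 0)"
    and hf: "\<And>p q. 1 \<le> p \<Longrightarrow> p < n \<Longrightarrow> 1 \<le> q \<Longrightarrow> q \<le> n \<Longrightarrow> br (E q q) (E (p+1) p) =
        (if q = p + 1 then E (p+1) p else 0) - (if q = p then E (p+1) p else 0)"
    and ef: "\<And>p q. 1 \<le> p \<Longrightarrow> p < n \<Longrightarrow> 1 \<le> q \<Longrightarrow> q < n \<Longrightarrow> br (E p (p+1)) (E (q+1) q) =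
        (if p = q then E p p - E (p+1) (p+1) else 0)"
    and ee_far: "\<And>p q. 1 \<le> p \<Longrightarrow> p + 1 < q \<Longrightarrow> q < n \<Longrightarrow> br (E p (p+1)) (E q (q+1)) = 0"
    and ff_far: "\<And>p q. 1 \<le> p \<Longrightarrow> p + 1 < q \<Longrightarrow> q < n \<Longrightarrow> br (E (p+1) p) (E (q+1) q) = 0"
    and serre_e1: "\<And>p. 1 \<le> p \<Longrightarrow> p + 1 < n \<Longrightarrow> br (E p (p+1)) (br (E p (p+1)) (E (p+1) (p+2))) = 0"
    and serre_e2: "\<And>p. 1 \<le> p \<Longrightarrow> p + 1 < n \<Longrightarrow> br (E (p+1) (p+2)) (br (E (p+1) (p+2)) (E p (p+1))) = 0"
    and serre_f1: "\<And>p. 1 \<le> p \<Longrightarrow> p + 1 < n \<Longrightarrow> br (E (p+1) p) (br (E (p+1) p) (E (p+2) (p+1))) = 0"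
    and serre_f2: "\<And>p. 1 \<le> p \<Longrightarrow> p + 1 < n \<Longrightarrow> br (E (p+2) (p+1)) (br (E (p+2) (p+1)) (E (p+1) p)) = 0"
begin

lemma up_Suc: "1 \<le> r \<Longrightarrow> r < s \<Longrightarrow> s < n \<Longrightarrow> E r (Suc s) = br (E r s) (E s (Suc s))"
  using up[of r "Suc s"] by simp

lemma ee_far_either: "1 \<le> p \<Longrightarrow> p < n \<Longrightarrow> 1 \<le> q \<Longrightarrow> q < n \<Longrightarrow> p + 1 < q \<or> q + 1 < p \<Longrightarrow>
    br (E p (Suc p)) (E q (Suc q)) = 0"
  using ee_far[of p q] ee_far[of q p] br_skew[of "E p (p+1)" "E q (q+1)"] by auto

lemma bracket_upper_far:
  assumes "1 \<le> r" "1 \<le> p" "p < n" "r < s" "s \<le> n" "p > s \<or> p + 1 < r"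
  shows "br (E r s) (E p (Suc p)) = 0"
  using Suc_leI[OF assms(4)] assms(5,6)
proof (induction s rule: dec_induct)
  case base
  then show ?case using assms ee_far_either[of r p] by auto
next
  case (step s)
  have "br (E s (Suc s)) (E p (Suc p)) = 0"
    using assms step ee_far_either[of s p] by auto
  then show ?case
    using assms step by (auto simp: up_Suc intro: br_br_eq_0)
qed

text \<open>
  The commutator \<open>E r s = br (E r (s-1)) (E (s-1) s)\<close> may be split at any intermediate index, since
  \<open>E r m\<close> commutes with the later generators. The split is what brings the Serre relations, which
  concern neighbouring indices, to bear on long commutators.
\<close>

lemma upper_split:
  assumes "1 \<le> r" "r < m" "m < s" "s \<le> n"
  shows "E r s = br (E r m) (E m s)"
proof -
  have "Suc m \<le> s" using assms by simp
  then show ?thesis using assms(4)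
  proof (induction s rule: dec_induct)
    case base
    then show ?case using assms up_Suc[of r m] by simp
  next
    case (step s)
    have 0: "br (E r m) (E s (Suc s)) = 0"
      using assms step by (intro bracket_upper_far) auto
    have "E r (Suc s) = br (br (E r m) (E m s)) (E s (Suc s))"
      using assms step by (subst up_Suc) auto
    also have "\<dots> = br (E r m) (br (E m s) (E s (Suc s)))"
      by (subst jacobi_left) (simp add: 0)
    also have "br (E m s) (E s (Suc s)) = E m (Suc s)"
      using assms step by (subst up_Suc) auto
    finally show ?case .
  qed
qed

text \<open>
  With \<open>a, b, c\<close> three consecutive generators and \<open>x = [a,b]\<close>, \<open>y = [b,c]\<close>, the element \<open>[x,c] = [a,y]\<close>
  has bracket \<open>[x,y]\<close> with \<open>b\<close> when written in the first way, and \<open>-[x,y]\<close> when written in the second.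
\<close>

lemma serre_middle:
  assumes "1 \<le> p" "p + 2 < n"
  shows "br (E p (p+3)) (E (p+1) (p+2)) = 0"
proof -
  define a b c where "a = E p (p+1)" and "b = E (p+1) (p+2)" and "c = E (p+2) (p+3)"
  define x y where "x = br a b" and "y = br b c"
  have "br b (br b a) = 0" using serre_e2[of p] assms by (simp add: a_def b_def)
  hence bx: "br b x = 0" by (simp add: x_def br_skew[of a b])
  have "br b (br b c) = 0" using serre_e1[of "p+1"] assms by (simp add: b_def c_def numeral_3_eq_3)
  hence b_y: "br b y = 0" by (simp add: y_def)
  have ac: "br a c = 0" using ee_far[of p "p+2"] assms by (simp add: a_def c_def numeral_3_eq_3)
  have 1: "br x c = br a y" by (simp add: x_def y_def jacobi_right[of a b c] ac)
  have 2: "br b (br x c) = br x y"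
    by (subst jacobi_right) (simp add: bx y_def)
  have 3: "br b (br a y) = - br x y"
    by (subst jacobi_right) (simp add: b_y x_def br_skew[of a b])
  have "br x y = - br x y" by (rule trans[OF 2[unfolded 1, symmetric] 3])
  hence "br x y = 0" unfolding eq_neg_iff_add_eq_0 by (rule no_2_torsion)
  moreover have "E p (p+3) = br x c"
    using assms up_Suc[of p "p+2"] up_Suc[of p "p+1"]
    by (simp add: x_def a_def b_def c_def numeral_3_eq_3)
  ultimately show ?thesis using 2 br_skew[of b "br x c"] by (simp add: b_def)
qed

text \<open>
  A generator strictly inside the range of \<open>E r s\<close> commutes with it by \<open>serre_middle\<close>, one at an end by
  a Serre relation; only the two generators that extend the range give a nonzero bracket.
\<close>

lemma bracket_upper_e:
  assumes "1 \<le> r" "r < s" "s \<le> n" "1 \<le> p" "p < n"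
  shows "br (E r s) (E p (Suc p)) =
    (if s = p then E r (Suc p) else 0) - (if Suc p = r then E p s else 0)"
proof -
  consider "s = p" | "Suc p = r" | "p > s \<or> p + 1 < r" | "r = p" "s = p + 1" | "r = p" "s = p + 2"
    | "r = p" "s > p + 2" | "p = s - 1" "s = r + 2" | "p = s - 1" "s > r + 2" | "r < p" "p < s - 1"
  proof -
    have "s = p \<or> Suc p = r \<or> (p > s \<or> p + 1 < r) \<or> r = p \<and> p < s \<or> r < p \<and> p < s"
      by linarith
    moreover have "s = p + 1 \<or> s = p + 2 \<or> s > p + 2" if "p < s" using that by linarith
    moreover have "p = s - 1 \<and> s = r + 2 \<or> p = s - 1 \<and> s > r + 2 \<or> p < s - 1" if "r < p" "p < s"
      using that by linarith
    ultimately show ?thesis using that by blast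
  qed
  then show ?thesis
  proof cases
    case 1
    then show ?thesis using assms up_Suc[of r s] by simp
  next
    case 2
    then show ?thesis
      using assms upper_split[of p r s] br_skew[of "E r s" "E p r"] by simp
  next
    case 3
    then show ?thesis using assms bracket_upper_far[of r p s] by auto
  next
    case 4
    then show ?thesis by simp
  next
    case 5
    then show ?thesis using assms serre_e1[of p] up_Suc[of p "p+1"]
        br_skew[of "E p (p+2)" "E p (p+1)"] by simp
  next
    case 6
    have "br (E p (p+2)) (E p (Suc p)) = 0"
      using assms 6 serre_e1[of p] up_Suc[of p "p+1"]
        br_skew[of "E p (p+2)" "E p (p+1)"] by simp
    moreover have "br (E (p+2) s) (E p (Suc p)) = 0"
      using assms 6 by (intro bracket_upper_far) auto
    ultimately show ?thesis using 6 assms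
      by (simp add: upper_split[of p "p+2" s] br_br_eq_0)
  next
    case 7
    then show ?thesis using assms serre_e2[of r] up_Suc[of r "r+1"]
        br_skew[of "E r (r+2)" "E (r+1) (r+2)"] br_skew[of "E (r+1) (r+2)" "E r (r+1)"] by simp
  next
    case 8
    define q where "q = s - 2"
    have q: "s = q + 2" "p = q + 1" "r < q" using 8 by (auto simp: q_def)
    have "br (E q (q+2)) (E p (Suc p)) = 0"
      using assms q serre_e2[of q] up_Suc[of q "q+1"] br_skew[of "E q (q+2)" "E (q+1) (q+2)"]
          br_skew[of "E (q+1) (q+2)" "E q (q+1)"] by simp
    moreover have "br (E r q) (E p (Suc p)) = 0"
      using assms q by (intro bracket_upper_far) auto
    ultimately show ?thesis using q assms
      by (simp add: upper_split[of r q "Suc (Suc q)"] br_br_eq_0)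
  next
    case 9
    define q where "q = p - 1"
    have q: "p = q + 1" "1 \<le> q" "r \<le> q" "q + 3 \<le> s" using 9 assms by (auto simp: q_def)
    have m: "br (E q (q+3)) (E p (Suc p)) = 0"
      using serre_middle[of q] q assms by simp
    have m2: "br (E q s) (E p (Suc p)) = 0"
    proof (cases "s = q + 3")
      case False
      have "br (E (q+3) s) (E p (Suc p)) = 0"
        using assms q False by (intro bracket_upper_far) auto
      moreover have "E q s = br (E q (q+3)) (E (q+3) s)"
        using assms q False by (intro upper_split) auto
      ultimately show ?thesis using m by (simp add: br_br_eq_0)
    qed (use m in simp)
    show ?thesis
    proof (cases "r = q")
      case False
      have "br (E r q) (E p (Suc p)) = 0"
        using assms q False by (intro bracket_upper_far) auto
      moreover have "E r s = br (E r q) (E q s)"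
        using assms q False by (intro upper_split) auto
      ultimately show ?thesis using m2 q 9 by (simp add: br_br_eq_0)
    qed (use m2 q 9 in simp)
  qed
qed

lemma bracket_upper_h:
  assumes "1 \<le> r" "r < s" "s \<le> n" "1 \<le> p" "p \<le> n"
  shows "br (E r s) (E p p) = (if s = p then E r p else 0) - (if p = r then E p s else 0)"
proof -
  have e: "br (E q (Suc q)) (E p p) = (if p = Suc q then E q (Suc q) else 0) - (if p = q then E q (Suc q) else 0)"
    if "1 \<le> q" "q < n" for q
    using he[of q p] br_skew[of "E q (Suc q)" "E p p"] that assms by auto
  show ?thesis using Suc_leI[OF assms(2)] assms(3)
  proof (induction s rule: dec_induct)
    case base
    then show ?case using assms e[of r] by auto
  next
    case (step s)
    show ?case
      using assms step e[of s] up_Suc[of r s] jacobi_left[of "E r s" "E s (Suc s)" "E p p"]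
      by auto
  qed
qed

lemma bracket_upper_f:
  assumes "1 \<le> r" "r < s" "s \<le> n" "1 \<le> p" "p < n"
  shows "br (E r s) (E (Suc p) p) =
    (if s = Suc p then E r p else 0) - (if p = r then E (Suc p) s else 0)"
  using Suc_leI[OF assms(2)] assms(3)
proof (induction s rule: dec_induct)
  case base
  then show ?case using assms ef[of r p] by auto
next
  case (step s)
  have efs: "br (E s (Suc s)) (E (Suc p) p) = (if s = p then E p p - E (Suc p) (Suc p) else 0)"
    using ef[of s p] step assms by simp
  have "br (E r (Suc s)) (E (Suc p) p) =
      br (br (E r s) (E (Suc p) p)) (E s (Suc s)) + br (E r s) (br (E s (Suc s)) (E (Suc p) p))"
    unfolding up_Suc[OF assms(1) Suc_le_lessD[OF step(1)] Suc_le_lessD[OF step.prems]]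
    by (rule jacobi_left)
  also have "\<dots> = (if s = p then E r p else 0) - (if p = r then E (Suc p) (Suc s) else 0)"
  proof -
    consider "s = p" | "s = Suc p" "r = p" | "s = Suc p" "r < p" | "r = p" "s > Suc p" |
      "s \<noteq> p" "s \<noteq> Suc p" "p \<noteq> r" using step by linarith
    then show ?thesis
    proof cases
      case 1
      then show ?thesis using step assms efs by (simp add: bracket_upper_h)
    next
      case 2
      then show ?thesis using step assms he[of s s] he[of s p] efs
        by simp
    next
      case 3
      then show ?thesis using step assms efs by (simp add: bracket_upper_e)
    next
      case 4
      then show ?thesis using step assms efs by (simp add: bracket_upper_e)
    next
      case 5
      then show ?thesis using step assms efs by simp
    qed
  qed
  finally show ?case by simp
qed

end

text \<open>
  Reversing the order of the indices exchanges upper and lower triangular elements, which spares a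
  second computation for the lower ones.
\<close>

lemma (in gl_generators) gl_generators_reverse:
  "gl_generators n (\<lambda>r s. E (n + 1 - r) (n + 1 - s))"
proof unfold_locales
  note S = Suc_diff_Suc Suc_diff_le
  fix p q :: nat
  show "x + x = 0 \<Longrightarrow> x = 0" for x :: 'a by (rule no_2_torsion)
  show "E (n + 1 - p) (n + 1 - q) = br (E (n + 1 - p) (n + 1 - (q-1))) (E (n + 1 - (q-1)) (n + 1 - q))"
    if "1 \<le> p" "p + 1 < q" "q \<le> n"
    using that down[of "n + 1 - q" "n + 1 - p"] by (simp add: S)
  show "E (n + 1 - p) (n + 1 - q) = br (E (n + 1 - p) (n + 1 - (q+1))) (E (n + 1 - (q+1)) (n + 1 - q))"
    if "1 \<le> q" "q + 1 < p" "p \<le> n"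
    using that up[of "n + 1 - p" "n + 1 - q"] by simp
  show "br (E (n + 1 - p) (n + 1 - p)) (E (n + 1 - q) (n + 1 - q)) = 0"
    if "1 \<le> p" "p \<le> n" "1 \<le> q" "q \<le> n"
    using that hh[of "n + 1 - p" "n + 1 - q"] by auto
  define p' q' where "p' = n - p" and "q' = n - q"
  have *: "p < n \<Longrightarrow> n + 1 - p = p' + 1 \<and> n + 1 - (p + 1) = p' \<and> 1 \<le> p'"
    "q < n \<Longrightarrow> n + 1 - q = q' + 1 \<and> n + 1 - (q + 1) = q' \<and> 1 \<le> q'"
    "q \<le> n \<Longrightarrow> n + 1 - q = q' + 1"
    "1 \<le> p \<Longrightarrow> p < n \<Longrightarrow> p' < n" "1 \<le> q \<Longrightarrow> q \<le> n \<Longrightarrow> q' < n"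
    by (auto simp: p'_def q'_def)
  have eq: "q = p \<longleftrightarrow> p' = q'" "q = p + 1 \<longleftrightarrow> p' = q' + 1" if "p < n" "q \<le> n"
    using that by (auto simp: p'_def q'_def)
  show "br (E (n + 1 - q) (n + 1 - q)) (E (n + 1 - p) (n + 1 - (p + 1))) =
        (if q = p then E (n + 1 - p) (n + 1 - (p + 1)) else 0)
        - (if q = p + 1 then E (n + 1 - p) (n + 1 - (p + 1)) else 0)"
    if "1 \<le> p" "p < n" "1 \<le> q" "q \<le> n"
    using that * eq hf[of p' "q' + 1"] by auto
  show "br (E (n + 1 - q) (n + 1 - q)) (E (n + 1 - (p + 1)) (n + 1 - p)) =
        (if q = p + 1 then E (n + 1 - (p + 1)) (n + 1 - p) else 0)
        - (if q = p then E (n + 1 - (p + 1)) (n + 1 - p) else 0)"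
    if "1 \<le> p" "p < n" "1 \<le> q" "q \<le> n"
    using that * eq he[of p' "q' + 1"] by auto
  show "br (E (n + 1 - p) (n + 1 - (p + 1))) (E (n + 1 - (q + 1)) (n + 1 - q)) =
        (if p = q then E (n + 1 - p) (n + 1 - p) - E (n + 1 - (p + 1)) (n + 1 - (p + 1)) else 0)"
    if "1 \<le> p" "p < n" "1 \<le> q" "q < n"
  proof -
    have 1: "n + 1 - p = p' + 1" "n + 1 - (p + 1) = p'" "n + 1 - q = q' + 1" "n + 1 - (q + 1) = q'"
      using * that by auto
    have 2: "p = q \<longleftrightarrow> q' = p'" using that by (auto simp: p'_def q'_def)
    have 3: "br (E q' (q' + 1)) (E (p' + 1) p') = (if q' = p' then E q' q' - E (q' + 1) (q' + 1) else 0)"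
      by (rule ef) (use * that in auto)
    show ?thesis unfolding 1 2 br_skew[of "E (p' + 1) p'"] 3 by auto
  qed
  show "br (E (n + 1 - p) (n + 1 - (p + 1))) (E (n + 1 - q) (n + 1 - (q + 1))) = 0"
    if "1 \<le> p" "p + 1 < q" "q < n"
  proof -
    have 1: "n + 1 - p = p' + 1" "n + 1 - (p + 1) = p'" "n + 1 - q = q' + 1" "n + 1 - (q + 1) = q'"
      using * that by auto
    have "br (E (q' + 1) q') (E (p' + 1) p') = 0"
      by (rule ff_far) (use that in \<open>auto simp: p'_def q'_def\<close>)
    then show ?thesis unfolding 1 br_skew[of "E (p' + 1) p'"] by simp
  qed
  show "br (E (n + 1 - (p + 1)) (n + 1 - p)) (E (n + 1 - (q + 1)) (n + 1 - q)) = 0"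
    if "1 \<le> p" "p + 1 < q" "q < n"
  proof -
    have 1: "n + 1 - p = p' + 1" "n + 1 - (p + 1) = p'" "n + 1 - q = q' + 1" "n + 1 - (q + 1) = q'"
      using * that by auto
    have "br (E q' (q' + 1)) (E p' (p' + 1)) = 0"
      by (rule ee_far) (use that in \<open>auto simp: p'_def q'_def\<close>)
    then show ?thesis unfolding 1 br_skew[of "E p' (p' + 1)"] by simp
  qed
next
  fix p :: nat assume "1 \<le> p" "p + 1 < n"
  define m where "m = n - p - 1"
  have m: "n + 1 - p = m + 2" "n + 1 - (p + 1) = m + 1" "n + 1 - (p + 2) = m" "1 \<le> m" "m + 1 < n"
    using \<open>1 \<le> p\<close> \<open>p + 1 < n\<close> by (auto simp: m_def)
  show "br (E (n + 1 - p) (n + 1 - (p + 1))) (br (E (n + 1 - p) (n + 1 - (p + 1)))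
      (E (n + 1 - (p + 1)) (n + 1 - (p + 2)))) = 0"
    unfolding m by (rule serre_f2) (use m in auto)
  show "br (E (n + 1 - (p + 1)) (n + 1 - (p + 2))) (br (E (n + 1 - (p + 1)) (n + 1 - (p + 2)))
      (E (n + 1 - p) (n + 1 - (p + 1)))) = 0"
    unfolding m by (rule serre_f1) (use m in auto)
  show "br (E (n + 1 - (p + 1)) (n + 1 - p)) (br (E (n + 1 - (p + 1)) (n + 1 - p))
      (E (n + 1 - (p + 2)) (n + 1 - (p + 1)))) = 0"
    unfolding m by (rule serre_e2) (use m in auto)
  show "br (E (n + 1 - (p + 2)) (n + 1 - (p + 1))) (br (E (n + 1 - (p + 2)) (n + 1 - (p + 1)))
      (E (n + 1 - (p + 1)) (n + 1 - p))) = 0"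
    unfolding m by (rule serre_e1) (use m in auto)
qed

context gl_generators
begin

lemma bracket_lower:
  assumes "s < r" "1 \<le> s" "r \<le> n"
  shows "1 \<le> p \<Longrightarrow> p < n \<Longrightarrow> br (E r s) (E p (Suc p)) = (if s = p then E r (Suc p) else 0) - (if Suc p = r then E p s else 0)"
    and "1 \<le> p \<Longrightarrow> p < n \<Longrightarrow> br (E r s) (E (Suc p) p) = (if s = Suc p then E r p else 0) - (if p = r then E (Suc p) s else 0)"
    and "1 \<le> p \<Longrightarrow> p \<le> n \<Longrightarrow> br (E r s) (E p p) = (if s = p then E r p else 0) - (if p = r then E p s else 0)"
proof -
  interpret rev: gl_generators n "\<lambda>r s. E (n + 1 - r) (n + 1 - s)" by (rule gl_generators_reverse)
  have refl: "n + 1 - (n + 1 - x) = x" if "x \<le> n" for x using that by simp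
  have refl': "n + 1 - Suc (n - x) = x" "n + 1 - (n - x) = Suc x" if "x < n" for x using that by simp_all
  have rs: "1 \<le> n + 1 - r" "n + 1 - r < n + 1 - s" "n + 1 - s \<le> n" "r \<le> n" "s \<le> n"
    using assms by auto
  show "br (E r s) (E p (Suc p)) = (if s = p then E r (Suc p) else 0) - (if Suc p = r then E p s else 0)"
    if "1 \<le> p" "p < n"
  proof -
    have p: "1 \<le> n - p" "n - p < n" using that by auto
    have eq: "n + 1 - s = Suc (n - p) \<longleftrightarrow> s = p" "n - p = n + 1 - r \<longleftrightarrow> Suc p = r"
      using that assms by auto
    show ?thesis
      using rev.bracket_upper_f[OF rs(1-3) p] unfolding eq refl[OF rs(4)] refl[OF rs(5)] refl'[OF that(2)] .
  qed
  show "br (E r s) (E (Suc p) p) = (if s = Suc p then E r p else 0) - (if p = r then E (Suc p) s else 0)"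
    if "1 \<le> p" "p < n"
  proof -
    have p: "1 \<le> n - p" "n - p < n" using that by auto
    have eq: "n + 1 - s = n - p \<longleftrightarrow> s = Suc p" "Suc (n - p) = n + 1 - r \<longleftrightarrow> p = r"
      using that assms by auto
    show ?thesis
      using rev.bracket_upper_e[OF rs(1-3) p] unfolding eq refl[OF rs(4)] refl[OF rs(5)] refl'[OF that(2)] .
  qed
  show "br (E r s) (E p p) = (if s = p then E r p else 0) - (if p = r then E p s else 0)"
    if "1 \<le> p" "p \<le> n"
  proof -
    have p: "1 \<le> n + 1 - p" "n + 1 - p \<le> n" using that by auto
    have eq: "n + 1 - s = n + 1 - p \<longleftrightarrow> s = p" "n + 1 - p = n + 1 - r \<longleftrightarrow> p = r"
      using that assms by auto
    show ?thesis
      using rev.bracket_upper_h[OF rs(1-3) p] unfolding eq refl[OF rs(4)] refl[OF rs(5)] refl[OF that(2)] .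
  qed
qed

lemma bracket_generator:
  assumes rs: "1 \<le> r" "r \<le> n" "1 \<le> s" "s \<le> n" and tu: "1 \<le> t" "t \<le> n" "1 \<le> u" "u \<le> n"
    and "t \<le> u + 1" "u \<le> t + 1"
  shows "br (E r s) (E t u) = (if s = t then E r u else 0) - (if u = r then E t s else 0)"
proof -
  consider "u = Suc t" "t < n" | "t = Suc u" "u < n" | "t = u" using assms by linarith
  then show ?thesis
  proof cases
    case 1
    consider "r < s" | "s < r" | "r = s" by linarith
    then show ?thesis
      by cases (use 1 assms bracket_upper_e[of r s t] bracket_lower(1)[of s r t] he[of t r] in auto)
  next
    case 2
    consider "r < s" | "s < r" | "r = s" by linarith
    then show ?thesis
      by cases (use 2 assms bracket_upper_f[of r s u] bracket_lower(2)[of s r u] hf[of u r] in auto)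
  next
    case 3
    consider "r < s" | "s < r" | "r = s" by linarith
    then show ?thesis
      by cases (use 3 assms bracket_upper_h[of r s u] bracket_lower(3)[of s r u] hh[of u r] hh[of r u] in auto)
  qed
qed

text \<open>
  Induction on the distance of \<open>t\<close> and \<open>u\<close>: by the Jacobi identity the elements whose brackets with all
  \<open>E r s\<close> are the expected ones are closed under commutators.
\<close>

theorem gl_relations:
  assumes "1 \<le> r" "r \<le> n" "1 \<le> s" "s \<le> n" and "1 \<le> t" "t \<le> n" "1 \<le> u" "u \<le> n"
  shows "br (E r s) (E t u) = (if s = t then E r u else 0) - (if u = r then E t s else 0)"
  using assms
proof (induction "(t - u) + (u - t)" arbitrary: r s t u rule: less_induct)
  case less
  have step: "br (E r s) (E t u) = (if s = t then E r u else 0) - (if u = r then E t s else 0)"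
    if m: "1 \<le> m" "m \<le> n" "m \<noteq> t" "m \<noteq> u" "t \<noteq> u" and Em: "E t u = br (E t m) (E m u)"
      and lt: "(t - m) + (m - t) < (t - u) + (u - t)" "(m - u) + (u - m) < (t - u) + (u - t)"
    for m
  proof -
    have 1: "br (E x y) (E t' m') = (if y = t' then E x m' else 0) - (if m' = x then E t' y else 0)"
      if "t' = t" "m' = m" "1 \<le> x" "x \<le> n" "1 \<le> y" "y \<le> n" for x y t' m'
      using less.hyps[OF lt(1)] less.prems m that by simp
    have 2: "br (E x y) (E m' u') = (if y = m' then E x u' else 0) - (if u' = x then E m' y else 0)"
      if "m' = m" "u' = u" "1 \<le> x" "x \<le> n" "1 \<le> y" "y \<le> n" for x y m' u'
      using less.hyps[OF lt(2)] less.prems m that by simp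
    have 3: "br (E t' m') (E x y) = (if m' = x then E t' y else 0) - (if y = t' then E x m' else 0)"
      if "t' = t" "m' = m" "1 \<le> x" "x \<le> n" "1 \<le> y" "y \<le> n" for x y t' m'
      using 1[OF that] br_skew[of "E t' m'" "E x y"] by simp
    show ?thesis
      unfolding Em jacobi_right[of "E r s" "E t m"]
      using less.prems m by (auto simp: 1 2 3)
  qed
  show ?case
  proof (cases "t \<le> u + 1 \<and> u \<le> t + 1")
    case True
    then show ?thesis using bracket_generator less.prems by auto
  next
    case False
    then consider "t + 1 < u" | "u + 1 < t" by linarith
    then show ?thesis
    proof cases
      case 1
      show ?thesis
        by (rule step[of "u - 1"]) (use 1 less.prems up[of t u] in auto)
    next
      case 2
      show ?thesis
        by (rule step[of "u + 1"]) (use 2 less.prems down[of u t] in auto)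
    qed
  qed
qed

end

section \<open>Weighted shift operators\<close>

definition bump :: "cvec \<Rightarrow> nat \<Rightarrow> nat \<Rightarrow> complex \<Rightarrow> cvec" where
  "bump w p q c r s = w r s + (if r = p \<and> s = q then c else 0)"

lemma bump_other [simp]: "r \<noteq> p \<or> s \<noteq> q \<Longrightarrow> bump w p q c r s = w r s"
  and bump_same [simp]: "bump w p q c p q = w p q + c"
  by (auto simp: bump_def)

lemma tableau_shift [simp]: "tableau n a v (shift z p q e) = bump (tableau n a v z) p q (of_int e)"
  by (auto simp: fun_eq_iff tableau_def shift_def set_entry_def bump_def)

lemma shift_commute: "shift (shift z p q d) p' q' e = shift (shift z p' q' e) p q d"
  by (auto simp: fun_eq_iff shift_def set_entry_def)

lemma shift_shift_cancel: "d + e = 0 \<Longrightarrow> shift (shift z p q d) p q e = z"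
  by (auto simp: fun_eq_iff shift_def set_entry_def)

text \<open>
  The quotient of products in the formulas for \<open>E\<^sub>p\<^sub>,\<^sub>p\<^sub>+\<^sub>1\<close> (for \<open>c = p + 1\<close>) and for \<open>E\<^sub>p\<^sub>+\<^sub>1\<^sub>,\<^sub>p\<close>
  (for \<open>c = p - 1\<close>). The factors with index in \<open>S\<close> are left out of the numerator, so that the
  dependence on single entries of row \<open>c\<close> can be made explicit.
\<close>

definition hop_coeff :: "nat \<Rightarrow> nat \<Rightarrow> nat set \<Rightarrow> nat \<Rightarrow> cvec \<Rightarrow> complex" where
  "hop_coeff p c S q w = (\<Prod>u\<in>{1..c}-S. w p q - w c u) / (\<Prod>u\<in>{1..p}-{q}. w p q - w p u)"

text \<open>
  The generators acting on functions on the lattice instead of combinations of tableaux, that is, their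
  transposes: \<open>e = 1\<close> gives \<open>E\<^sub>p\<^sub>,\<^sub>p\<^sub>+\<^sub>1\<close> and \<open>e = -1\<close> gives \<open>E\<^sub>p\<^sub>+\<^sub>1\<^sub>,\<^sub>p\<close>. This turns identities between
  operators into identities between finite sums, and treats raising and lowering operators together.
\<close>

definition hop :: "nat \<Rightarrow> (nat \<Rightarrow> complex) \<Rightarrow> cvec \<Rightarrow> nat \<Rightarrow> nat \<Rightarrow> int \<Rightarrow> (zvec \<Rightarrow> complex) \<Rightarrow> zvec \<Rightarrow> complex" where
  "hop n a v p c e f z =
     (\<Sum>q=1..p. - of_int e * hop_coeff p c {} q (tableau n a v z) * f (shift z p q e))"

definition weight :: "nat \<Rightarrow> cvec \<Rightarrow> complex" where
  "weight p w = (\<Sum>q=1..p. w p q + of_nat q - 1) - (\<Sum>q=1..p-1. w (p-1) q + of_nat q - 1)"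

lemma hop_coeff_remove:
  assumes "u \<in> {1..c}" "u \<notin> S"
  shows "hop_coeff p c S q w = (w p q - w c u) * hop_coeff p c (insert u S) q w"
proof -
  have "(\<Prod>u\<in>{1..c}-S. w p q - w c u) = (w p q - w c u) * (\<Prod>u\<in>{1..c}-S-{u}. w p q - w c u)"
    by (rule prod.remove) (use assms in auto)
  also have "{1..c} - S - {u} = {1..c} - insert u S" by auto
  finally show ?thesis by (simp add: hop_coeff_def)
qed

lemma hop_coeff_bump_other:
  assumes "p' \<noteq> p" "p' \<noteq> c \<or> u \<in> S"
  shows "hop_coeff p c S q (bump w p' u d) = hop_coeff p c S q w"
proof -
  have "(\<Prod>u'\<in>{1..c}-S. bump w p' u d p q - bump w p' u d c u') = (\<Prod>u'\<in>{1..c}-S. w p q - w c u')"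
    by (rule prod.cong) (use assms in \<open>auto simp: bump_def\<close>)
  moreover have "(\<Prod>u'\<in>{1..p}-{q}. bump w p' u d p q - bump w p' u d p u') = (\<Prod>u'\<in>{1..p}-{q}. w p q - w p u')"
    by (rule prod.cong) (use assms in \<open>auto simp: bump_def\<close>)
  ultimately show ?thesis by (simp add: hop_coeff_def)
qed

text \<open>
  A shift in row \<open>p\<close> by \<open>d\<close> changes a single factor of the denominator.
\<close>

lemma hop_coeff_bump_row:
  assumes "c \<noteq> p" "u \<in> {1..p}" "u \<noteq> q" "w p q \<noteq> w p u" "w p q \<noteq> w p u + d"
  shows "hop_coeff p c S q (bump w p u d) = hop_coeff p c S q w * ((w p q - w p u) / (w p q - w p u - d))"
proof -
  have num: "(\<Prod>u'\<in>{1..c}-S. bump w p u d p q - bump w p u d c u') = (\<Prod>u'\<in>{1..c}-S. w p q - w c u')"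
    by (rule prod.cong) (use assms in auto)
  define R where "R = (\<Prod>u'\<in>{1..p}-{q}-{u}. w p q - w p u')"
  have "(\<Prod>u'\<in>{1..p}-{q}. w p q - w p u') = (w p q - w p u) * R"
    unfolding R_def by (rule prod.remove) (use assms in auto)
  moreover have "(\<Prod>u'\<in>{1..p}-{q}. bump w p u d p q - bump w p u d p u') = (w p q - w p u - d) * R"
  proof -
    have "(\<Prod>u'\<in>{1..p}-{q}. bump w p u d p q - bump w p u d p u') =
        (bump w p u d p q - bump w p u d p u) * (\<Prod>u'\<in>{1..p}-{q}-{u}. bump w p u d p q - bump w p u d p u')"
      by (rule prod.remove) (use assms in auto)
    also have "(\<Prod>u'\<in>{1..p}-{q}-{u}. bump w p u d p q - bump w p u d p u') = R"
      unfolding R_def by (rule prod.cong) (use assms in auto)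
    also have "bump w p u d p q - bump w p u d p u = w p q - w p u - d" using assms by auto
    finally show ?thesis .
  qed
  ultimately show ?thesis using assms by (simp add: hop_coeff_def num)
qed

lemma sum_antisym_0:
  fixes G :: "'b \<Rightarrow> 'b \<Rightarrow> complex"
  assumes "\<And>x y. x \<in> S \<Longrightarrow> y \<in> S \<Longrightarrow> G x y = - G y x"
  shows "(\<Sum>x\<in>S. \<Sum>y\<in>S. G x y) = 0"
proof -
  have "(\<Sum>x\<in>S. \<Sum>y\<in>S. G x y) = (\<Sum>x\<in>S. \<Sum>y\<in>S. - G y x)"
    by (intro sum.cong refl assms)
  also have "\<dots> = - (\<Sum>x\<in>S. \<Sum>y\<in>S. G y x)" by (simp add: sum_negf)
  also have "(\<Sum>x\<in>S. \<Sum>y\<in>S. G y x) = (\<Sum>x\<in>S. \<Sum>y\<in>S. G x y)" by (rule sum.swap)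
  finally show ?thesis by simp
qed

lemma sum_swap3:
  "(\<Sum>x\<in>A. \<Sum>y\<in>B. \<Sum>z\<in>C. g x y z) = (\<Sum>z\<in>C. \<Sum>x\<in>A. \<Sum>y\<in>B. g x y z)"
proof -
  have "(\<Sum>x\<in>A. \<Sum>y\<in>B. \<Sum>z\<in>C. g x y z) = (\<Sum>x\<in>A. \<Sum>z\<in>C. \<Sum>y\<in>B. g x y z)"
    by (intro sum.cong refl sum.swap)
  also have "\<dots> = (\<Sum>z\<in>C. \<Sum>x\<in>A. \<Sum>y\<in>B. g x y z)" by (rule sum.swap)
  finally show ?thesis .
qed

section \<open>Lagrange interpolation sums\<close>

text \<open>
  The sum of \<open>g(t)/W'(t)\<close> over the nodes \<open>t \<in> S\<close>, where \<open>W\<close> is the monic polynomial with simple roots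
  \<open>S\<close> and \<open>g\<close> the monic polynomial with roots \<open>B\<close>; equivalently, the divided difference of \<open>g\<close> at \<open>S\<close>.
\<close>

definition lagrange_sum :: "complex set \<Rightarrow> complex multiset \<Rightarrow> complex" where
  "lagrange_sum S B = (\<Sum>t\<in>S. (\<Prod>b\<in>#B. t - b) / (\<Prod>s\<in>S-{t}. t - s))"

text \<open>
  Write the factor \<open>t - b\<close> as \<open>(t - s) + (s - b)\<close>; the first part removes the node \<open>s\<close>.
\<close>

lemma lagrange_sum_step:
  assumes "finite S" "s \<in> S"
  shows "lagrange_sum S (add_mset b B) = lagrange_sum (S - {s}) B + (s - b) * lagrange_sum S B"
proof -
  let ?N = "\<lambda>t. \<Prod>b\<in>#B. t - b" and ?D = "\<lambda>t. \<Prod>s\<in>S-{t}. t - s"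
  have "(\<Sum>t\<in>S. (t - b) * ?N t / ?D t) = (\<Sum>t\<in>S. (t - s) * ?N t / ?D t + (s - b) * (?N t / ?D t))"
    by (rule sum.cong) (simp_all add: field_simps add_divide_distrib[symmetric] diff_divide_distrib[symmetric])
  also have "\<dots> = (\<Sum>t\<in>S. (t - s) * ?N t / ?D t) + (s - b) * lagrange_sum S B"
    by (simp add: sum.distrib lagrange_sum_def sum_distrib_left)
  also have "(\<Sum>t\<in>S. (t - s) * ?N t / ?D t) = (\<Sum>t\<in>S-{s}. (t - s) * ?N t / ?D t)"
    using assms by (subst sum.remove[of S s]) auto
  also have "\<dots> = lagrange_sum (S - {s}) B"
    unfolding lagrange_sum_def
  proof (rule sum.cong, simp)
    fix t assume t: "t \<in> S - {s}"
    have "?D t = (t - s) * (\<Prod>s\<in>S-{t}-{s}. t - s)"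
      by (rule prod.remove) (use t assms in auto)
    also have "S - {t} - {s} = S - {s} - {t}" by auto
    finally show "(t - s) * ?N t / ?D t = ?N t / (\<Prod>s\<in>S-{s}-{t}. t - s)"
      using t by simp
  qed
  finally show ?thesis by (simp add: lagrange_sum_def)
qed

text \<open>
  Comparing \<open>lagrange_sum_step\<close> for two nodes \<open>s\<close> and \<open>s'\<close> (with \<open>b = s\<close>) expresses the sum by two sums
  with one node less, as for divided differences; this settles the case of low degree. The case of
  degree \<open>card S\<close> then follows by splitting off one root.
\<close>

lemma lagrange_sum_values:
  assumes "finite S" "S \<noteq> {}"
  shows "(size B < card S \<longrightarrow> lagrange_sum S B = (if Suc (size B) = card S then 1 else 0)) \<and>
    (size B = card S \<longrightarrow> lagrange_sum S B = \<Sum>S - \<Sum>\<^sub># B)"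
  using assms
proof (induction "card S" arbitrary: S B rule: less_induct)
  case less
  {
    fix B :: "complex multiset" assume B: "size B < card S"
    have "lagrange_sum S B = (if Suc (size B) = card S then 1 else 0)"
    proof (cases "card S = 1")
      case True
      then obtain s where "S = {s}" by (auto simp: card_1_singleton_iff)
      then show ?thesis using B by (simp add: lagrange_sum_def)
    next
      case False
      then obtain s s' where s: "s \<in> S" "s' \<in> S" "s \<noteq> s'"
        using less.prems by (metis is_singletonI' is_singleton_altdef)
      have fin: "finite (S - {x})" "S - {x} \<noteq> {}" "card (S - {x}) = card S - 1" "card (S - {x}) < card S" if "x \<in> S" for x
        using less.prems that s card_Diff1_less[of S x] by auto
      have "lagrange_sum (S - {s}) B + (s - s) * lagrange_sum S B = lagrange_sum (S - {s'}) B + (s' - s) * lagrange_sum S B"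
        using lagrange_sum_step[of S s s B] lagrange_sum_step[of S s' s B] s less.prems by simp
      hence eq: "lagrange_sum (S - {s}) B - lagrange_sum (S - {s'}) B = (s' - s) * lagrange_sum S B"
        by (simp add: algebra_simps)
      show ?thesis
      proof (cases "Suc (size B) = card S")
        case True
        have "lagrange_sum (S - {x}) B = \<Sum>S - x - \<Sum>\<^sub># B" if "x \<in> S" for x
          using less.hyps[of "S - {x}" B] fin[OF that] True less.prems that by (simp add: sum_diff1)
        hence "(s' - s) * lagrange_sum S B = s' - s" using eq s by simp
        thus ?thesis using s True by simp
      next
        case False
        have "lagrange_sum (S - {x}) B = (if Suc (size B) = card S - 1 then 1 else 0)" if "x \<in> S" for x
          using less.hyps[of "S - {x}" B] fin[OF that] False B by simp
        hence "(s' - s) * lagrange_sum S B = 0" using eq s by simp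
        thus ?thesis using s False by simp
      qed
    qed
  } note lt = this
  {
    fix B :: "complex multiset" assume B: "size B = card S"
    then obtain b B' where B': "B = add_mset b B'"
      using less.prems by (metis card_0_eq size_eq_0_iff_empty multiset_cases)
    obtain s where s: "s \<in> S" using less.prems by blast
    have 1: "lagrange_sum S B' = 1" using lt[of B'] B B' by simp
    have "lagrange_sum S B = \<Sum>S - \<Sum>\<^sub># B"
    proof (cases "card S = 1")
      case True
      then obtain x where x: "S = {x}" by (auto simp: card_1_singleton_iff)
      have "B' = {#}" using B True unfolding B' by simp
      then show ?thesis unfolding B' x by (simp add: lagrange_sum_def)
    next
      case False
      have "card S \<noteq> 0" using less.prems by simp
      hence "card (S - {s}) \<noteq> 0" using s False by simp
      hence "S - {s} \<noteq> {}" by (metis card.empty)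
      moreover have "size B' = card (S - {s})" using B s unfolding B' by simp
      ultimately have 2: "lagrange_sum (S - {s}) B' = \<Sum>S - s - \<Sum>\<^sub># B'"
        using less.hyps[of "S - {s}" B'] less.prems s card_Diff1_less[of S s] by (simp add: sum_diff1)
      show ?thesis unfolding B' using lagrange_sum_step[of S s b B'] s less.prems 1 2 by simp
    qed
  } note eq = this
  show ?case by (intro conjI impI lt eq)
qed

section \<open>Relations between the shift operators\<close>

locale gt_generic =
  fixes n :: nat and a :: "nat \<Rightarrow> complex" and v :: cvec
  assumes generic: "generic n v"
begin

abbreviation W where "W \<equiv> tableau n a v"
abbreviation H where "H \<equiv> hop n a v"

lemma row_difference_nonint:
  assumes "1 \<le> p" "p < n" "q \<in> {1..p}" "u \<in> {1..p}" "q \<noteq> u"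
  shows "W z p q - W z p u \<notin> \<int>"
proof -
  have *: "W z p q - W z p u = (v p q - v p u) + of_int (z p q - z p u)"
    using assms by (simp add: tableau_def)
  have "v p q - v p u \<notin> \<int>"
  proof (cases "q < u")
    case True
    then show ?thesis using generic assms by (auto simp: generic_def)
  next
    case False
    hence "v p u - v p q \<notin> \<int>" using generic assms by (auto simp: generic_def)
    thus ?thesis using Ints_minus[of "v p q - v p u"] by auto
  qed
  thus ?thesis unfolding *
    by (metis Ints_diff Ints_of_int add_diff_cancel_right')
qed

lemma row_entries_distinct:
  assumes "1 \<le> p" "p < n" "q \<in> {1..p}" "u \<in> {1..p}" "q \<noteq> u"
  shows "W z p q \<noteq> W z p u" "W z p q \<noteq> W z p u + of_int e" "W z p q - W z p u - of_int e \<noteq> 0"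
    "W z p q - W z p u \<noteq> 0"
proof -
  show 2: "W z p q \<noteq> W z p u + of_int e" for e
  proof
    assume "W z p q = W z p u + of_int e"
    hence "W z p q - W z p u = of_int e" by simp
    thus False using row_difference_nonint[OF assms, of z] by (metis Ints_of_int)
  qed
  show "W z p q \<noteq> W z p u" "W z p q - W z p u - of_int e \<noteq> 0" "W z p q - W z p u \<noteq> 0"
    using 2[of 0] 2[of e] by (auto simp: algebra_simps)
qed

lemma hop_hop_commute:
  assumes coeff: "\<And>q q'. q \<in> {1..p} \<Longrightarrow> q' \<in> {1..p'} \<Longrightarrow>
      hop_coeff p c {} q (W z) * hop_coeff p' c' {} q' (bump (W z) p q (of_int e)) =
      hop_coeff p' c' {} q' (W z) * hop_coeff p c {} q (bump (W z) p' q' (of_int e'))"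
  shows "H p c e (H p' c' e' f) z = H p' c' e' (H p c e f) z"
proof -
  have "H p c e (H p' c' e' f) z = (\<Sum>q=1..p. \<Sum>q'=1..p'. of_int (e * e') *
     (hop_coeff p c {} q (W z) * hop_coeff p' c' {} q' (bump (W z) p q (of_int e))) *
     f (shift (shift z p q e) p' q' e'))"
    by (simp add: hop_def sum_distrib_left mult_ac sum_negf)
  also have "\<dots> = (\<Sum>q=1..p. \<Sum>q'=1..p'. of_int (e * e') *
     (hop_coeff p' c' {} q' (W z) * hop_coeff p c {} q (bump (W z) p' q' (of_int e'))) *
     f (shift (shift z p q e) p' q' e'))"
    by (intro sum.cong refl) (simp only: coeff)
  also have "\<dots> = (\<Sum>q'=1..p'. \<Sum>q=1..p. of_int (e * e') *
     (hop_coeff p' c' {} q' (W z) * hop_coeff p c {} q (bump (W z) p' q' (of_int e'))) *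
     f (shift (shift z p q e) p' q' e'))"
    by (rule sum.swap)
  also have "\<dots> = H p' c' e' (H p c e f) z"
    by (simp add: hop_def sum_distrib_left mult_ac sum_negf shift_commute[of z p _ e])
  finally show ?thesis .
qed

lemma hop_commute_far:
  assumes "p \<noteq> p'" "p' \<noteq> c" "p \<noteq> c'"
  shows "H p c e (H p' c' e' f) z = H p' c' e' (H p c e f) z"
  by (rule hop_hop_commute) (use assms in \<open>simp add: hop_coeff_bump_other\<close>)

text \<open>
  If each operator moves the row on which the numerator of the other depends, the coefficients of the
  two orders contain \<open>(x - y)(y - x - e)\<close> and \<open>(y - x)(x - y + e)\<close>, which agree.
\<close>

lemma hop_commute_mutual:
  assumes "p \<noteq> p'"
  shows "H p p' e (H p' p (- e) f) z = H p' p (- e) (H p p' e f) z"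
proof (rule hop_hop_commute)
  fix q q' assume q: "q \<in> {1..p}" "q' \<in> {1..p'}"
  have *: "\<And>w. hop_coeff p p' {} q w = (w p q - w p' q') * hop_coeff p p' {q'} q w"
    "\<And>w. hop_coeff p' p {} q' w = (w p' q' - w p q) * hop_coeff p' p {q} q' w"
    using hop_coeff_remove[of q' p' "{}" p q] hop_coeff_remove[of q p "{}" p' q'] q by auto
  show "hop_coeff p p' {} q (W z) * hop_coeff p' p {} q' (bump (W z) p q (of_int e)) =
      hop_coeff p' p {} q' (W z) * hop_coeff p p' {} q (bump (W z) p' q' (of_int (- e)))"
    unfolding * using assms by (simp add: hop_coeff_bump_other algebra_simps)
qed

text \<open>
  Row \<open>c\<close>, which \<open>B\<close> moves, occurs in the numerators of \<open>A\<close>. For a fixed column \<open>q'\<close> of row \<open>c\<close> and two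
  columns \<open>q1\<close>, \<open>q2\<close> of row \<open>p\<close>, the three orders of the shifts differ only in the two factors that
  contain the entry \<open>(c, q')\<close>, and their combination is a multiple of \<open>w p q1 - w p q2 + e\<close>. This cancels the
  denominator that makes the remaining factor asymmetric, and the result is antisymmetric in \<open>q1\<close>, \<open>q2\<close>
  (and vanishes for \<open>q1 = q2\<close>).
\<close>

lemma hop_serre1:
  assumes p: "1 \<le> p" "p < n" and ne: "c \<noteq> p" "c' \<noteq> p" and e: "e = 1 \<or> e = -1"
  defines "A \<equiv> H p c e" and "B \<equiv> H c c' e"
  shows "A (A (B f)) z - 2 * A (B (A f)) z + B (A (A f)) z = 0"
proof -
  define \<epsilon> :: complex where "\<epsilon> = of_int e"
  have \<epsilon>2: "\<epsilon> * \<epsilon> = 1" using e by (auto simp: \<epsilon>_def)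
  define w where "w = W z"
  define F where "F q' q1 q2 = f (shift (shift (shift z p q1 e) p q2 e) c q' e)" for q' q1 q2
  \<comment> \<open>\<open>K\<close> is the part of the coefficient that is common to the three orders; \<open>X\<close> and \<open>Y\<close> are the factors
      of the first and second shift of row \<open>p\<close> that contain the entry of row \<open>c\<close>.\<close>
  define K where "K q' q1 q2 = (- \<epsilon>) ^ 3 * hop_coeff c c' {} q' w *
    (hop_coeff p c {q'} q1 w * hop_coeff p c {q'} q2 (bump w p q1 \<epsilon>))" for q' q1 q2
  define X where "X q' q = w p q - w c q'" for q' q
  define Y where "Y q' q1 q = w p q + (if q = q1 then \<epsilon> else 0) - w c q'" for q' q1 q
  have coeff: "hop_coeff p c {} q w = (w p q - w c q') * hop_coeff p c {q'} q w" if "q' \<in> {1..c}" for q' q w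
    using hop_coeff_remove[of q' c "{}" p q w] that by simp
  have b: "bump w p q1 \<epsilon> p q2 = w p q2 + (if q2 = q1 then \<epsilon> else 0)" for q1 q2
    by (simp add: bump_def)
  note defs = K_def X_def Y_def F_def w_def[symmetric] \<epsilon>_def[symmetric] power3_eq_cube tableau_shift
  have AAB: "A (A (B f)) z =
      (\<Sum>q'=1..c. \<Sum>q1=1..p. \<Sum>q2=1..p. K q' q1 q2 * (X q' q1 * Y q' q1 q2) * F q' q1 q2)"
  proof -
    have "A (A (B f)) z =
        (\<Sum>q1=1..p. \<Sum>q2=1..p. \<Sum>q'=1..c. K q' q1 q2 * (X q' q1 * Y q' q1 q2) * F q' q1 q2)"
      unfolding A_def B_def hop_def sum_distrib_left
    proof (intro sum.cong refl)
      fix q1 q2 q' assume q: "q1 \<in> {1..p}" "q2 \<in> {1..p}" "q' \<in> {1..c}"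
      show "- of_int e * hop_coeff p c {} q1 (W z) *
           (- of_int e * hop_coeff p c {} q2 (W (shift z p q1 e)) *
            (- of_int e * hop_coeff c c' {} q' (W (shift (shift z p q1 e) p q2 e)) *
             f (shift (shift (shift z p q1 e) p q2 e) c q' e))) =
           K q' q1 q2 * (X q' q1 * Y q' q1 q2) * F q' q1 q2"
        using ne unfolding defs coeff[OF q(3)] by (simp add: hop_coeff_bump_other b)
    qed
    then show ?thesis by (rule trans) (rule sum_swap3)
  qed
  have ABA: "A (B (A f)) z =
      (\<Sum>q'=1..c. \<Sum>q1=1..p. \<Sum>q2=1..p. K q' q1 q2 * (X q' q1 * (Y q' q1 q2 - \<epsilon>)) * F q' q1 q2)"
  proof -
    have "A (B (A f)) z =
        (\<Sum>q1=1..p. \<Sum>q'=1..c. \<Sum>q2=1..p. K q' q1 q2 * (X q' q1 * (Y q' q1 q2 - \<epsilon>)) * F q' q1 q2)"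
      unfolding A_def B_def hop_def sum_distrib_left
    proof (intro sum.cong refl)
      fix q1 q2 q' assume q: "q1 \<in> {1..p}" "q2 \<in> {1..p}" "q' \<in> {1..c}"
      show "- of_int e * hop_coeff p c {} q1 (W z) *
           (- of_int e * hop_coeff c c' {} q' (W (shift z p q1 e)) *
            (- of_int e * hop_coeff p c {} q2 (W (shift (shift z p q1 e) c q' e)) *
             f (shift (shift (shift z p q1 e) c q' e) p q2 e))) =
           K q' q1 q2 * (X q' q1 * (Y q' q1 q2 - \<epsilon>)) * F q' q1 q2"
        using ne unfolding defs coeff[OF q(3)]
        by (simp add: hop_coeff_bump_other b shift_commute[of _ c q' e p q2 e] algebra_simps)
    qed
    then show ?thesis by (rule trans) (rule sum.swap)
  qed
  have BAA: "B (A (A f)) z =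
      (\<Sum>q'=1..c. \<Sum>q1=1..p. \<Sum>q2=1..p. K q' q1 q2 * ((X q' q1 - \<epsilon>) * (Y q' q1 q2 - \<epsilon>)) * F q' q1 q2)"
    unfolding A_def B_def hop_def sum_distrib_left
  proof (intro sum.cong refl)
    fix q1 q2 q' assume q: "q1 \<in> {1..p}" "q2 \<in> {1..p}" "q' \<in> {1..c}"
    have s: "shift (shift (shift z c q' e) p q1 e) p q2 e = shift (shift (shift z p q1 e) p q2 e) c q' e"
      by (simp add: shift_commute[of _ c q' e])
    have bb: "hop_coeff p c {q'} q2 (bump (bump w c q' \<epsilon>) p q1 \<epsilon>) = hop_coeff p c {q'} q2 (bump w p q1 \<epsilon>)"
    proof -
      have "bump (bump w c q' \<epsilon>) p q1 \<epsilon> = bump (bump w p q1 \<epsilon>) c q' \<epsilon>"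
        by (auto simp: bump_def fun_eq_iff)
      thus ?thesis using ne by (simp add: hop_coeff_bump_other)
    qed
    have b2: "bump (bump w c q' \<epsilon>) p q1 \<epsilon> p q2 = w p q2 + (if q2 = q1 then \<epsilon> else 0)"
      "bump (bump w c q' \<epsilon>) p q1 \<epsilon> c q' = w c q' + \<epsilon>"
      using ne by (auto simp: bump_def)
    show "- of_int e * hop_coeff c c' {} q' (W z) *
         (- of_int e * hop_coeff p c {} q1 (W (shift z c q' e)) *
          (- of_int e * hop_coeff p c {} q2 (W (shift (shift z c q' e) p q1 e)) *
           f (shift (shift (shift z c q' e) p q1 e) p q2 e))) =
         K q' q1 q2 * ((X q' q1 - \<epsilon>) * (Y q' q1 q2 - \<epsilon>)) * F q' q1 q2"
      using ne unfolding defs coeff[OF q(3)] s bb b2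
      by (simp add: hop_coeff_bump_other diff_diff_eq)
  qed
  have "A (A (B f)) z - 2 * A (B (A f)) z + B (A (A f)) z =
      (\<Sum>q'=1..c. \<Sum>q1=1..p. \<Sum>q2=1..p. K q' q1 q2 * (\<epsilon> * (X q' q1 - Y q' q1 q2) + 1) * F q' q1 q2)"
    unfolding AAB ABA BAA sum_distrib_left sum_subtractf[symmetric] sum.distrib[symmetric]
  proof (intro sum.cong refl)
    fix q' q1 q2
    have *: "K * x * F - 2 * (K * y * F) + K * t * F = K * (x - 2 * y + t) * F" for K x y t F :: complex
      by (simp add: algebra_simps)
    have "X q' q1 * Y q' q1 q2 - 2 * (X q' q1 * (Y q' q1 q2 - \<epsilon>)) + (X q' q1 - \<epsilon>) * (Y q' q1 q2 - \<epsilon>) =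
        \<epsilon> * (X q' q1 - Y q' q1 q2) + \<epsilon> * \<epsilon>" by (simp add: algebra_simps)
    thus "K q' q1 q2 * (X q' q1 * Y q' q1 q2) * F q' q1 q2 -
         2 * (K q' q1 q2 * (X q' q1 * (Y q' q1 q2 - \<epsilon>)) * F q' q1 q2) +
         K q' q1 q2 * ((X q' q1 - \<epsilon>) * (Y q' q1 q2 - \<epsilon>)) * F q' q1 q2 =
         K q' q1 q2 * (\<epsilon> * (X q' q1 - Y q' q1 q2) + 1) * F q' q1 q2"
      unfolding \<epsilon>2 * by simp
  qed
  also have "\<dots> = 0"
  proof (rule sum.neutral, rule ballI, rule sum_antisym_0)
    fix q' q1 q2 assume q: "q' \<in> {1..c}" "q1 \<in> {1..p}" "q2 \<in> {1..p}"
    show "K q' q1 q2 * (\<epsilon> * (X q' q1 - Y q' q1 q2) + 1) * F q' q1 q2 =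
        - (K q' q2 q1 * (\<epsilon> * (X q' q2 - Y q' q2 q1) + 1) * F q' q2 q1)"
    proof (cases "q1 = q2")
      case True
      hence "\<epsilon> * (X q' q1 - Y q' q1 q2) + 1 = 0" using \<epsilon>2 by (simp add: X_def Y_def algebra_simps)
      thus ?thesis using True by simp
    next
      case False
      have F: "F q' q1 q2 = F q' q2 q1" by (simp add: F_def shift_commute[of z p q1])
      define d where "d = w p q2 - w p q1"
      have K: "K q' q q'' * (\<epsilon> * (w p q - w p q'') + 1) =
          - \<epsilon> * (w p q'' - w p q) * ((- \<epsilon>) ^ 3 * hop_coeff c c' {} q' w * (hop_coeff p c {q'} q w * hop_coeff p c {q'} q'' w))"
        if qq: "q \<in> {1..p}" "q'' \<in> {1..p}" "q \<noteq> q''" for q q''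
      proof -
        have nz: "w p q'' - w p q - \<epsilon> \<noteq> 0" "w p q'' \<noteq> w p q" "w p q'' \<noteq> w p q + \<epsilon>"
          unfolding w_def \<epsilon>_def using row_entries_distinct[OF p qq(2,1)] qq(3) by auto
        have "hop_coeff p c {q'} q'' (bump w p q \<epsilon>) =
            hop_coeff p c {q'} q'' w * ((w p q'' - w p q) / (w p q'' - w p q - \<epsilon>))"
          by (rule hop_coeff_bump_row) (use ne qq nz in auto)
        \<comment> \<open>\<open>\<epsilon>\<^sup>2 = 1\<close> turns the combination of the three orders into the denominator of the second shift\<close>
        moreover have "\<epsilon> * (w p q - w p q'') + 1 = - \<epsilon> * (w p q'' - w p q - \<epsilon>)"
          using \<epsilon>2 by (simp add: algebra_simps)
        ultimately show ?thesis using nz by (simp add: K_def)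
      qed
      have XY: "X q' q1 - Y q' q1 q2 = w p q1 - w p q2" "X q' q2 - Y q' q2 q1 = w p q2 - w p q1"
        using False by (auto simp: X_def Y_def)
      show ?thesis unfolding XY K[OF q(2,3) False] K[OF q(3,2) False[symmetric]] F
        by (simp add: algebra_simps)
    qed
  qed
  finally show ?thesis .
qed

text \<open>
  The counterpart with two shifts of row \<open>c\<close>, under which the coefficients of \<open>A\<close> change and those of
  \<open>B\<close> are unaffected by \<open>A\<close>. For one column the second difference of a linear function vanishes; for
  two columns the second difference cancels a denominator and leaves an antisymmetric expression.
\<close>

lemma hop_serre2:
  assumes c: "1 \<le> c" "c < n" and ne: "c \<noteq> p" "c' \<noteq> p" "c' \<noteq> c" and e: "e = 1 \<or> e = -1"
  defines "A \<equiv> H p c e" and "B \<equiv> H c c' e"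
  shows "B (B (A f)) z - 2 * B (A (B f)) z + A (B (B f)) z = 0"
proof -
  define \<epsilon> :: complex where "\<epsilon> = of_int e"
  have \<epsilon>2: "\<epsilon> * \<epsilon> = 1" using e by (auto simp: \<epsilon>_def)
  define w where "w = W z"
  define F where "F q q1 q2 = f (shift (shift (shift z c q1 e) c q2 e) p q e)" for q q1 q2
  define K where "K q1 q2 = (- \<epsilon>) ^ 3 * (hop_coeff c c' {} q1 w * hop_coeff c c' {} q2 (bump w c q1 \<epsilon>))" for q1 q2
  define L0 where "L0 q = hop_coeff p c {} q w" for q
  define L1 where "L1 q q1 = hop_coeff p c {} q (bump w c q1 \<epsilon>)" for q q1
  define L2 where "L2 q q1 q2 = hop_coeff p c {} q (bump (bump w c q1 \<epsilon>) c q2 \<epsilon>)" for q q1 q2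
  note defs = K_def L0_def L1_def L2_def F_def w_def[symmetric] \<epsilon>_def[symmetric] power3_eq_cube tableau_shift
  have BBA: "B (B (A f)) z = (\<Sum>q=1..p. \<Sum>q1=1..c. \<Sum>q2=1..c. K q1 q2 * L2 q q1 q2 * F q q1 q2)"
  proof -
    have "B (B (A f)) z = (\<Sum>q1=1..c. \<Sum>q2=1..c. \<Sum>q=1..p. K q1 q2 * L2 q q1 q2 * F q q1 q2)"
      unfolding A_def B_def hop_def sum_distrib_left
    proof (intro sum.cong refl)
      fix q1 q2 q
      show "- of_int e * hop_coeff c c' {} q1 (W z) *
           (- of_int e * hop_coeff c c' {} q2 (W (shift z c q1 e)) *
            (- of_int e * hop_coeff p c {} q (W (shift (shift z c q1 e) c q2 e)) *
             f (shift (shift (shift z c q1 e) c q2 e) p q e))) =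
           K q1 q2 * L2 q q1 q2 * F q q1 q2"
        unfolding defs by simp
    qed
    then show ?thesis by (rule trans) (rule sum_swap3)
  qed
  have BAB: "B (A (B f)) z = (\<Sum>q=1..p. \<Sum>q1=1..c. \<Sum>q2=1..c. K q1 q2 * L1 q q1 * F q q1 q2)"
  proof -
    have "B (A (B f)) z = (\<Sum>q1=1..c. \<Sum>q=1..p. \<Sum>q2=1..c. K q1 q2 * L1 q q1 * F q q1 q2)"
      unfolding A_def B_def hop_def sum_distrib_left
    proof (intro sum.cong refl)
      fix q1 q2 q
      show "- of_int e * hop_coeff c c' {} q1 (W z) *
           (- of_int e * hop_coeff p c {} q (W (shift z c q1 e)) *
            (- of_int e * hop_coeff c c' {} q2 (W (shift (shift z c q1 e) p q e)) *
             f (shift (shift (shift z c q1 e) p q e) c q2 e))) =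
           K q1 q2 * L1 q q1 * F q q1 q2"
        using ne unfolding defs by (simp add: hop_coeff_bump_other shift_commute[of _ p q e c q2 e])
    qed
    then show ?thesis by (rule trans) (rule sum.swap)
  qed
  have ABB: "A (B (B f)) z = (\<Sum>q=1..p. \<Sum>q1=1..c. \<Sum>q2=1..c. K q1 q2 * L0 q * F q q1 q2)"
    unfolding A_def B_def hop_def sum_distrib_left
  proof (intro sum.cong refl)
    fix q1 q2 q
    have s: "shift (shift (shift z p q e) c q1 e) c q2 e = shift (shift (shift z c q1 e) c q2 e) p q e"
      by (simp add: shift_commute[of _ p q e])
    have "bump (bump w p q \<epsilon>) c q1 \<epsilon> = bump (bump w c q1 \<epsilon>) p q \<epsilon>"
      by (auto simp: bump_def fun_eq_iff)
    hence bb: "hop_coeff c c' {} q2 (bump (bump w p q \<epsilon>) c q1 \<epsilon>) = hop_coeff c c' {} q2 (bump w c q1 \<epsilon>)"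
      using ne by (simp add: hop_coeff_bump_other)
    show "- of_int e * hop_coeff p c {} q (W z) *
         (- of_int e * hop_coeff c c' {} q1 (W (shift z p q e)) *
          (- of_int e * hop_coeff c c' {} q2 (W (shift (shift z p q e) c q1 e)) *
           f (shift (shift (shift z p q e) c q1 e) c q2 e))) =
         K q1 q2 * L0 q * F q q1 q2"
      using ne unfolding defs s bb by (simp add: hop_coeff_bump_other)
  qed
  have "B (B (A f)) z - 2 * B (A (B f)) z + A (B (B f)) z =
      (\<Sum>q=1..p. \<Sum>q1=1..c. \<Sum>q2=1..c. K q1 q2 * (L2 q q1 q2 - 2 * L1 q q1 + L0 q) * F q q1 q2)"
    unfolding BBA BAB ABB sum_distrib_left sum_subtractf[symmetric] sum.distrib[symmetric]
    by (intro sum.cong refl) (simp add: algebra_simps)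
  also have "\<dots> = 0"
  proof (rule sum.neutral, rule ballI, rule sum_antisym_0)
    fix q q1 q2 assume q: "q \<in> {1..p}" "q1 \<in> {1..c}" "q2 \<in> {1..c}"
    show "K q1 q2 * (L2 q q1 q2 - 2 * L1 q q1 + L0 q) * F q q1 q2 =
        - (K q2 q1 * (L2 q q2 q1 - 2 * L1 q q2 + L0 q) * F q q2 q1)"
    proof (cases "q1 = q2")
      case True
      have 1: "hop_coeff p c {} q w = (w p q - w c q1) * hop_coeff p c {q1} q w" for w
        using hop_coeff_remove[of q1 c "{}" p q w] q by simp
      have "L2 q q1 q2 - 2 * L1 q q1 + L0 q = 0"
        unfolding L0_def L1_def L2_def 1 using True ne by (simp add: hop_coeff_bump_other algebra_simps)
      thus ?thesis using True by simp
    next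
      case False
      have F: "F q q1 q2 = F q q2 q1" by (simp add: F_def shift_commute[of z c q1])
      define R where "R = hop_coeff p c {q1, q2} q w"
      have L: "L2 q x y - 2 * L1 q x + L0 q = - \<epsilon> * (w c y - w c x - \<epsilon>) * R"
        if xy: "{x, y} = {q1, q2}" "x \<in> {1..c}" "y \<in> {1..c}" "x \<noteq> y" for x y
      proof -
        have 1: "hop_coeff p c {} q w = (w p q - w c x) * (w p q - w c y) * hop_coeff p c {q1, q2} q w" for w
          using hop_coeff_remove[of x c "{}" p q w] hop_coeff_remove[of y c "{x}" p q w] xy
          by (simp add: insert_commute)
        have xyin: "x \<in> {q1, q2}" "y \<in> {q1, q2}" using xy by auto
        have 2: "L0 q = (w p q - w c x) * (w p q - w c y) * R"
          "L1 q x = (w p q - w c x - \<epsilon>) * (w p q - w c y) * R"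
          "L2 q x y = (w p q - w c x - \<epsilon>) * (w p q - w c y - \<epsilon>) * R"
          unfolding L0_def L1_def L2_def 1 R_def using ne xy(2-) xyin
          by (simp_all add: hop_coeff_bump_other diff_diff_eq)
        have "L2 q x y - 2 * L1 q x + L0 q = (\<epsilon> * (w c x - w c y) + \<epsilon> * \<epsilon>) * R"
          unfolding 2 by (simp add: algebra_simps)
        also have "\<epsilon> * (w c x - w c y) + \<epsilon> * \<epsilon> = - \<epsilon> * (w c y - w c x - \<epsilon>)" by (simp add: algebra_simps)
        finally show ?thesis .
      qed
      have K: "K x y * (- \<epsilon> * (w c y - w c x - \<epsilon>) * R) =
          (w c y - w c x) * ((- \<epsilon>) ^ 4 * R * (hop_coeff c c' {} x w * hop_coeff c c' {} y w))"
        if qq: "x \<in> {1..c}" "y \<in> {1..c}" "x \<noteq> y" for x y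
      proof -
        have nz: "w c y - w c x - \<epsilon> \<noteq> 0" "w c y \<noteq> w c x" "w c y \<noteq> w c x + \<epsilon>"
          unfolding w_def \<epsilon>_def using row_entries_distinct[OF c qq(2,1)] qq(3) by auto
        have "hop_coeff c c' {} y (bump w c x \<epsilon>) =
            hop_coeff c c' {} y w * ((w c y - w c x) / (w c y - w c x - \<epsilon>))"
          by (rule hop_coeff_bump_row) (use ne qq nz in auto)
        then show ?thesis using nz by (simp add: K_def power4_eq_xxxx power3_eq_cube)
      qed
      have L': "L2 q q1 q2 - 2 * L1 q q1 + L0 q = - \<epsilon> * (w c q2 - w c q1 - \<epsilon>) * R"
        "L2 q q2 q1 - 2 * L1 q q2 + L0 q = - \<epsilon> * (w c q1 - w c q2 - \<epsilon>) * R"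
        using L[of q1 q2] L[of q2 q1] q False by auto
      show ?thesis unfolding L' K[OF q(2,3) False] K[OF q(3,2) False[symmetric]] F
        by (simp add: algebra_simps)
    qed
  qed
  finally show ?thesis .
qed

end

section \<open>Linear extension and duality\<close>

lemma lin_ext_superset:
  assumes "vector_space sc" "finite S" "Poly_Mapping.keys f \<subseteq> S"
  shows "lin_ext sc b f = (\<Sum>x\<in>S. sc (Poly_Mapping.lookup f x) (b x))"
proof -
  interpret vector_space sc by fact
  show ?thesis unfolding lin_ext_def
    by (rule sum.mono_neutral_left) (use assms in \<open>auto simp: in_keys_iff\<close>)
qed

lemma lin_ext_add:
  assumes "vector_space sc"
  shows "lin_ext sc b (f + g) = lin_ext sc b f + lin_ext sc b g"
proof -
  interpret vector_space sc by fact
  let ?S = "Poly_Mapping.keys f \<union> Poly_Mapping.keys g"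
  have "finite ?S" by simp
  note * = lin_ext_superset[OF assms this]
  have "lin_ext sc b (f + g) = (\<Sum>x\<in>?S. sc (Poly_Mapping.lookup (f + g) x) (b x))"
    using keys_add[of f g] by (intro *)
  also have "\<dots> = lin_ext sc b f + lin_ext sc b g"
    by (subst (1 2) *) (auto simp: lookup_add scale_left_distrib sum.distrib)
  finally show ?thesis .
qed

lemma lin_ext_scale:
  assumes "vector_space sc"
  shows "lin_ext sc b (pm_scale c f) = sc c (lin_ext sc b f)"
proof -
  interpret vector_space sc by fact
  have "lin_ext sc b (pm_scale c f) = (\<Sum>x\<in>Poly_Mapping.keys f. sc (Poly_Mapping.lookup (pm_scale c f) x) (b x))"
    by (rule lin_ext_superset[OF assms]) (auto simp: in_keys_iff)
  also have "\<dots> = sc c (lin_ext sc b f)"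
    by (simp add: lin_ext_def scale_sum_right)
  finally show ?thesis .
qed

lemma lin_ext_zero [simp]: "lin_ext sc b 0 = 0"
  by (simp add: lin_ext_def)

lemma lin_ext_diff:
  assumes "vector_space sc"
  shows "lin_ext sc b (f - g) = lin_ext sc b f - lin_ext sc b g"
  using lin_ext_add[OF assms, of b "f - g" g] by simp

lemma lin_ext_single:
  assumes "vector_space sc"
  shows "lin_ext sc b (Poly_Mapping.single x c) = sc c (b x)"
proof -
  interpret vector_space sc by fact
  show ?thesis by (cases "c = 0") (auto simp: lin_ext_def)
qed

lemma lin_ext_sum:
  assumes "vector_space sc"
  shows "lin_ext sc b (\<Sum>i\<in>I. f i) = (\<Sum>i\<in>I. lin_ext sc b (f i))"
  by (induction I rule: infinite_finite_induct) (simp_all add: lin_ext_add[OF assms])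

lemma vector_space_times: "vector_space ((*) :: complex \<Rightarrow> complex \<Rightarrow> complex)"
  by unfold_locales (simp_all add: algebra_simps)

abbreviation lin_pm :: "('b \<Rightarrow> ('c \<Rightarrow>\<^sub>0 complex)) \<Rightarrow> ('b \<Rightarrow>\<^sub>0 complex) \<Rightarrow> ('c \<Rightarrow>\<^sub>0 complex)" where
  "lin_pm \<equiv> lin_ext pm_scale"

text \<open>
  Evaluation of the linear functional with values \<open>f\<close> on the basis. Operators on combinations are
  compared through it with their transposes on functions; the order of compositions is reversed.
\<close>

definition pairing :: "('b \<Rightarrow> complex) \<Rightarrow> ('b \<Rightarrow>\<^sub>0 complex) \<Rightarrow> complex" where
  "pairing = lin_ext (*)"

lemmas pairing_diff = lin_ext_diff[OF vector_space_times, folded pairing_def]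
  and pairing_scale = lin_ext_scale[OF vector_space_times, folded pairing_def]
  and pairing_sum = lin_ext_sum[OF vector_space_times, folded pairing_def]
  and pairing_single = lin_ext_single[OF vector_space_times, folded pairing_def]

lemma pairing_zero [simp]: "pairing f 0 = 0"
  by (simp add: pairing_def)

lemma pairing_lin_pm: "pairing f (lin_pm b x) = pairing (\<lambda>z. pairing f (b z)) x"
proof -
  have "pairing f (lin_pm b x) = (\<Sum>z\<in>Poly_Mapping.keys x. Poly_Mapping.lookup x z * pairing f (b z))"
    unfolding lin_ext_def pairing_sum by (simp add: pairing_scale)
  also have "\<dots> = pairing (\<lambda>z. pairing f (b z)) x"
    by (simp add: pairing_def lin_ext_def)
  finally show ?thesis .
qed

lemma pairing_eqI:
  fixes x y :: "'b \<Rightarrow>\<^sub>0 complex"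
  assumes "\<And>f. pairing f x = pairing f y"
  shows "x = y"
proof (rule poly_mapping_eqI)
  fix z :: 'b
  have "pairing (\<lambda>z'. if z' = z then 1 else 0) w = Poly_Mapping.lookup w z" for w :: "'b \<Rightarrow>\<^sub>0 complex"
    by (simp add: pairing_def lin_ext_def if_distrib in_keys_iff cong: if_cong)
  thus "Poly_Mapping.lookup x z = Poly_Mapping.lookup y z"
    using assms by metis
qed

lemma pairing_fun_diff: "pairing (\<lambda>z. f z - g z) x = pairing f x - pairing g x"
  and pairing_fun_add: "pairing (\<lambda>z. f z + g z) x = pairing f x + pairing g x"
  and pairing_fun_scale: "pairing (\<lambda>z. c * f z) x = c * pairing f x"
  and pairing_fun_zero: "pairing (\<lambda>z. 0) x = 0"
  by (simp_all add: pairing_def lin_ext_def algebra_simps sum.distrib sum_subtractf sum_distrib_left)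

lemma pairing_gt_up: "pairing f (gt_up n a v p z) = hop n a v p (p + 1) 1 f z"
  by (simp add: gt_up_def Let_def pairing_sum pairing_single hop_def hop_coeff_def)

lemma pairing_gt_down: "pairing f (gt_down n a v p z) = hop n a v p (p - 1) (-1) f z"
  by (simp add: gt_down_def Let_def pairing_sum pairing_single hop_def hop_coeff_def)

lemma pairing_gt_diag: "pairing f (gt_diag n a v p z) = weight p (tableau n a v z) * f z"
  by (simp add: gt_diag_def Let_def pairing_single weight_def)

section \<open>The ring of additive endomorphisms\<close>

typedef (overloaded) 'a endo = "{f :: 'a::ab_group_add \<Rightarrow> 'a. \<forall>x y. f (x + y) = f x + f y}"
  by (rule exI[of _ "\<lambda>_. 0"]) simp

setup_lifting type_definition_endo

instantiation endo :: (ab_group_add) ring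
begin

lift_definition zero_endo :: "'a endo" is "\<lambda>_. 0" by simp
lift_definition plus_endo :: "'a endo \<Rightarrow> 'a endo \<Rightarrow> 'a endo" is "\<lambda>f g x. f x + g x" by (simp add: algebra_simps)
lift_definition minus_endo :: "'a endo \<Rightarrow> 'a endo \<Rightarrow> 'a endo" is "\<lambda>f g x. f x - g x" by (simp add: algebra_simps)
lift_definition uminus_endo :: "'a endo \<Rightarrow> 'a endo" is "\<lambda>f x. - f x" by simp
lift_definition times_endo :: "'a endo \<Rightarrow> 'a endo \<Rightarrow> 'a endo" is "\<lambda>f g x. f (g x)" by simp

instance
  by standard (transfer; simp add: fun_eq_iff algebra_simps)+

end

lemma br_endo: "Rep_endo (br f g) = commutator (Rep_endo f) (Rep_endo g)"
  by (simp add: br_def commutator_def fun_eq_iff minus_endo.rep_eq times_endo.rep_eq)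

section \<open>The generic modules\<close>

lemma gt_E_linear:
  "gt_E n a v r s (x + y) = gt_E n a v r s x + gt_E n a v r s y \<and>
   gt_E n a v r s (pm_scale c x) = pm_scale c (gt_E n a v r s x)"
proof (induction n a v r s arbitrary: x y rule: gt_E.induct)
  case (1 n a v r s)
  have comm: "commutator A B (x + y) = commutator A B x + commutator A B y \<and>
      commutator A B (pm_scale c x) = pm_scale c (commutator A B x)"
    if "\<And>x y. A (x + y) = A x + A y \<and> A (pm_scale c x) = pm_scale c (A x)"
      and "\<And>x y. B (x + y) = B x + B y \<and> B (pm_scale c x) = pm_scale c (B x)"
    for A B :: "(zvec \<Rightarrow>\<^sub>0 complex) \<Rightarrow> (zvec \<Rightarrow>\<^sub>0 complex)" and x y
    using that by (simp add: commutator_def pm.scale_right_diff_distrib)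
  show ?case
  proof (cases "r = s \<or> s = r + 1 \<or> r = s + 1")
    case True
    then show ?thesis
      by (subst (1 2 3 4 5) gt_E.simps)
        (auto simp: lin_ext_add[OF pm.vector_space_axioms] lin_ext_scale[OF pm.vector_space_axioms])
  next
    case False
    then have ne: "r \<noteq> s" "s \<noteq> r + 1" "r \<noteq> s + 1" by auto
    show ?thesis
    proof (cases "r < s")
      case True
      have "gt_E n a v r s = commutator (gt_E n a v r (s-1)) (gt_E n a v (s-1) s)"
        by (subst gt_E.simps) (use ne True in simp)
      thus ?thesis using comm[OF 1(1,2)[OF ne True]] by simp
    next
      case False
      have "gt_E n a v r s = commutator (gt_E n a v r (s+1)) (gt_E n a v (s+1) s)"
        by (subst gt_E.simps) (use ne False in simp)
      thus ?thesis using comm[OF 1(3,4)[OF ne False]] by simp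
    qed
  qed
qed

lemmas gt_E_additive = conjunct1[OF gt_E_linear]
  and gt_E_scale = conjunct2[OF gt_E_linear]

context gt_generic
begin

text \<open>
  The diagonal part of \<open>[E\<^sub>p\<^sub>,\<^sub>p\<^sub>+\<^sub>1, E\<^sub>p\<^sub>+\<^sub>1\<^sub>,\<^sub>p]\<close>. Let \<open>x\<close>, \<open>y\<close>, \<open>z\<close> be the entries of rows \<open>p\<close>, \<open>p + 1\<close> and
  \<open>p - 1\<close>. Both kinds of terms are values of \<open>G(t)/W'(t)\<close> with \<open>G\<close> the monic polynomial with roots \<open>y\<close>
  and \<open>z - 1\<close>, and \<open>W\<close> the one with roots \<open>x\<close> and \<open>x - 1\<close>: the terms with a plus sign are those at the
  nodes \<open>x\<close>, the others those at the nodes \<open>x - 1\<close>. Both polynomials have degree \<open>2p\<close>, so the sum is the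
  difference of the sums of roots.
\<close>

lemma lagrange_sum_weight:
  fixes z :: zvec
  assumes p: "1 \<le> p" "p < n"
  defines "w \<equiv> W z"
  shows "(\<Sum>q=1..p. hop_coeff p (p+1) {} q w * hop_coeff p (p-1) {} q (bump w p q 1)
      - hop_coeff p (p-1) {} q w * hop_coeff p (p+1) {} q (bump w p q (-1))) = weight p w - weight (p+1) w"
proof -
  define X where "X = w p ` {1..p}"
  define Y where "Y = (\<lambda>q. w p q - 1) ` {1..p}"
  define B where "B = image_mset (w (p+1)) (mset_set {1..p+1}) + image_mset (\<lambda>u. w (p-1) u - 1) (mset_set {1..p-1})"
  define G where "G t = (\<Prod>b\<in>#B. t - b)" for t
  have inj1: "inj_on (w p) {1..p}"
  proof (rule inj_onI)
    fix x y assume "x \<in> {1..p}" "y \<in> {1..p}" "w p x = w p y"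
    thus "x = y" using row_entries_distinct(1)[OF p, of x y z] unfolding w_def by blast
  qed
  have inj2: "inj_on (\<lambda>q. w p q - 1) {1..p}"
  proof (rule inj_onI)
    fix x y assume "x \<in> {1..p}" "y \<in> {1..p}" "w p x - 1 = w p y - 1"
    thus "x = y" using inj_onD[OF inj1, of x y] by simp
  qed
  note inj = inj1 inj2
  have ne1: "w p q \<noteq> w p u + 1" if "q \<in> {1..p}" "u \<in> {1..p}" for q u
  proof (cases "q = u")
    case False
    show ?thesis using row_entries_distinct(2)[OF p that False, of z 1] by (simp add: w_def)
  qed simp
  have disj: "X \<inter> Y = {}"
  proof -
    have "w p q \<noteq> w p u - 1" if "q \<in> {1..p}" "u \<in> {1..p}" for q u
      using ne1[OF that(2,1)] by (auto simp: algebra_simps)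
    thus ?thesis unfolding X_def Y_def by auto
  qed
  have pne: "p - Suc 0 \<noteq> p" using p by simp
  have fin: "finite X" "finite Y" by (auto simp: X_def Y_def)
  have G: "G t = (\<Prod>u=1..p+1. t - w (p+1) u) * (\<Prod>u=1..p-1. t + 1 - w (p-1) u)" for t
    unfolding G_def B_def by (simp add: image_mset.compositionality o_def prod_unfold_prod_mset algebra_simps)
  \<comment> \<open>the denominators at the entry \<open>(p,q)\<close>: unshifted, raised by 1 and lowered by 1\<close>
  define P1 where "P1 q = (\<Prod>u\<in>{1..p}-{q}. w p q - w p u)" for q
  define P2 where "P2 q = (\<Prod>u\<in>{1..p}-{q}. w p q + 1 - w p u)" for q
  define P3 where "P3 q = (\<Prod>u\<in>{1..p}-{q}. w p q - 1 - w p u)" for q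
  have up: "hop_coeff p (p+1) {} q w * hop_coeff p (p-1) {} q (bump w p q 1) = G (w p q) / (P1 q * P2 q)"
    if "q \<in> {1..p}" for q
  proof -
    have "(\<Prod>u\<in>{1..p}-{q}. bump w p q 1 p q - bump w p q 1 p u) = P2 q"
      unfolding P2_def by (rule prod.cong) auto
    moreover have "(\<Prod>u\<in>{1..p-1}-{}. bump w p q 1 p q - bump w p q 1 (p-1) u) = (\<Prod>u=1..p-1. w p q + 1 - w (p-1) u)"
      by (rule prod.cong) (use pne in \<open>auto simp: bump_def\<close>)
    ultimately show ?thesis unfolding hop_coeff_def G P1_def by simp
  qed
  have down: "hop_coeff p (p-1) {} q w * hop_coeff p (p+1) {} q (bump w p q (-1)) = G (w p q - 1) / (P1 q * P3 q)"
    if "q \<in> {1..p}" for q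
  proof -
    have "(\<Prod>u\<in>{1..p}-{q}. bump w p q (-1) p q - bump w p q (-1) p u) = P3 q"
      unfolding P3_def by (rule prod.cong) auto
    moreover have "(\<Prod>u\<in>{1..p+1}-{}. bump w p q (-1) p q - bump w p q (-1) (p+1) u) = (\<Prod>u=1..p+1. w p q - 1 - w (p+1) u)"
      by (rule prod.cong) (use p in auto)
    ultimately show ?thesis unfolding hop_coeff_def G P1_def by (simp add: mult.commute)
  qed
  have diff: "X - {w p q} = w p ` ({1..p} - {q})" "Y - {w p q - 1} = (\<lambda>q. w p q - 1) ` ({1..p} - {q})"
    if q: "q \<in> {1..p}" for q
    unfolding X_def Y_def
    using inj_on_image_set_diff[OF inj(1), of "{1..p}" "{q}"] inj_on_image_set_diff[OF inj(2), of "{1..p}" "{q}"] q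
    by simp_all
  have DX: "(\<Prod>s\<in>X \<union> Y - {w p q}. w p q - s) = P1 q * P2 q" if q: "q \<in> {1..p}" for q
  proof -
    have "w p q \<in> X" using q by (simp add: X_def)
    hence "X \<union> Y - {w p q} = (X - {w p q}) \<union> Y" using disj by blast
    hence "(\<Prod>s\<in>X \<union> Y - {w p q}. w p q - s) = (\<Prod>s\<in>X - {w p q}. w p q - s) * (\<Prod>s\<in>Y. w p q - s)"
      using disj fin by (simp add: prod.union_disjoint Diff_Int_distrib2)
    also have "(\<Prod>s\<in>X - {w p q}. w p q - s) = P1 q"
      unfolding P1_def diff(1)[OF q]
      by (subst prod.reindex[OF inj_on_subset[OF inj(1)]]) auto
    also have "(\<Prod>s\<in>Y. w p q - s) = (\<Prod>u=1..p. w p q + 1 - w p u)"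
      unfolding Y_def by (subst prod.reindex[OF inj(2)]) (simp add: algebra_simps)
    also have "\<dots> = P2 q" unfolding P2_def by (subst prod.remove[of _ q]) (use q in auto)
    finally show ?thesis .
  qed
  have DY: "(\<Prod>s\<in>X \<union> Y - {w p q - 1}. w p q - 1 - s) = - (P1 q * P3 q)" if q: "q \<in> {1..p}" for q
  proof -
    have "w p q - 1 \<in> Y" unfolding Y_def using q by (rule imageI)
    hence "X \<union> Y - {w p q - 1} = X \<union> (Y - {w p q - 1})" using disj by blast
    moreover have "X \<inter> (Y - {w p q - 1}) = {}" using disj by blast
    ultimately have "(\<Prod>s\<in>X \<union> Y - {w p q - 1}. w p q - 1 - s) =
        (\<Prod>s\<in>X. w p q - 1 - s) * (\<Prod>s\<in>Y - {w p q - 1}. w p q - 1 - s)"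
      using fin by (simp add: prod.union_disjoint)
    also have "(\<Prod>s\<in>Y - {w p q - 1}. w p q - 1 - s) = P1 q"
      unfolding P1_def diff(2)[OF q]
      by (subst prod.reindex[OF inj_on_subset[OF inj(2)]]) auto
    also have "(\<Prod>s\<in>X. w p q - 1 - s) = (\<Prod>u=1..p. w p q - 1 - w p u)"
      unfolding X_def by (subst prod.reindex[OF inj(1)]) simp
    also have "\<dots> = - P3 q" unfolding P3_def by (subst prod.remove[of _ q]) (use q in auto)
    finally show ?thesis by simp
  qed
  have SX: "(\<Sum>t\<in>X. g t) = (\<Sum>q=1..p. g (w p q))" and SY: "(\<Sum>t\<in>Y. g t) = (\<Sum>q=1..p. g (w p q - 1))"
    for g :: "complex \<Rightarrow> complex"
    unfolding X_def Y_def by (subst sum.reindex[OF inj(1)] sum.reindex[OF inj(2)]; simp)+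
  have "lagrange_sum (X \<union> Y) B = (\<Sum>t\<in>X. G t / (\<Prod>s\<in>X \<union> Y - {t}. t - s)) + (\<Sum>t\<in>Y. G t / (\<Prod>s\<in>X \<union> Y - {t}. t - s))"
    unfolding lagrange_sum_def G_def by (rule sum.union_disjoint) (use fin disj in auto)
  also have "(\<Sum>t\<in>X. G t / (\<Prod>s\<in>X \<union> Y - {t}. t - s)) = (\<Sum>q=1..p. G (w p q) / (P1 q * P2 q))"
    unfolding SX by (intro sum.cong refl, subst DX) auto
  also have "(\<Sum>t\<in>Y. G t / (\<Prod>s\<in>X \<union> Y - {t}. t - s)) = (\<Sum>q=1..p. - (G (w p q - 1) / (P1 q * P3 q)))"
    unfolding SY by (intro sum.cong refl, subst DY) auto
  also have "(\<Sum>q=1..p. G (w p q) / (P1 q * P2 q)) + (\<Sum>q=1..p. - (G (w p q - 1) / (P1 q * P3 q))) =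
    (\<Sum>q=1..p. hop_coeff p (p+1) {} q w * hop_coeff p (p-1) {} q (bump w p q 1)
      - hop_coeff p (p-1) {} q w * hop_coeff p (p+1) {} q (bump w p q (-1)))"
    unfolding sum.distrib[symmetric] by (intro sum.cong refl, subst up, assumption, subst down) auto
  finally have "(\<Sum>q=1..p. hop_coeff p (p+1) {} q w * hop_coeff p (p-1) {} q (bump w p q 1)
      - hop_coeff p (p-1) {} q w * hop_coeff p (p+1) {} q (bump w p q (-1))) = lagrange_sum (X \<union> Y) B" by simp
  also have "\<dots> = \<Sum>(X \<union> Y) - \<Sum>\<^sub># B"
  proof -
    have "card X = p" "card Y = p"
      unfolding X_def Y_def card_image[OF inj(1)] card_image[OF inj(2)] by simp_all
    hence "card (X \<union> Y) = p + p" using card_Un_disjoint[OF fin disj] by simp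
    moreover have "size B = p + p" using p by (simp add: B_def)
    moreover have "X \<union> Y \<noteq> {}" using p by (auto simp: X_def)
    ultimately show ?thesis using lagrange_sum_values[of "X \<union> Y" B] fin by simp
  qed
  also have "\<Sum>(X \<union> Y) = \<Sum>X + \<Sum>Y" by (rule sum.union_disjoint) (use fin disj in auto)
  also have "\<Sum>X = (\<Sum>q=1..p. w p q)" by (rule SX)
  also have "\<Sum>Y = (\<Sum>q=1..p. w p q - 1)" by (rule SY)
  also have "\<Sum>\<^sub># B = (\<Sum>u=1..p+1. w (p+1) u) + (\<Sum>u=1..p-1. w (p-1) u - 1)"
    unfolding B_def by (simp add: sum_unfold_sum_mset)
  also have "(\<Sum>q=1..p. w p q) + (\<Sum>q=1..p. w p q - 1) - ((\<Sum>u=1..p+1. w (p+1) u) + (\<Sum>u=1..p-1. w (p-1) u - 1)) =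
     weight p w - weight (p+1) w"
  proof -
    have g: "(\<Sum>q=1..m. of_nat q - (1::complex)) = of_nat m * (of_nat m - 1) / 2" for m
      by (induction m) (auto simp: field_simps)
    have e: "(\<Sum>q=1..m. w r q + of_nat q - 1) = (\<Sum>q=1..m. w r q) + of_nat m * (of_nat m - 1) / 2" for m r
      unfolding g[symmetric] sum.distrib[symmetric] by (simp add: algebra_simps)
    obtain m where m: "p = Suc m" using p by (cases p) auto
    show ?thesis unfolding weight_def e by (simp add: m sum_subtractf field_simps)
  qed
  finally show ?thesis .
qed

text \<open>
  For different columns the two orders of a raising and a lowering shift have equal coefficients, because
  \<open>(x - x')/(x - x' - 1)\<close> does not change when \<open>x\<close> and \<open>x'\<close> are exchanged and 1 is replaced by -1.
\<close>

lemma hop_ef: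
  assumes p: "1 \<le> p" "p < n"
  shows "H p (p-1) (-1) (H p (p+1) 1 f) z - H p (p+1) 1 (H p (p-1) (-1) f) z =
    (weight p (W z) - weight (p+1) (W z)) * f z"
proof -
  define w where "w = W z"
  define u where "u q w = hop_coeff p (p+1) {} q w" for q w
  define d where "d q w = hop_coeff p (p-1) {} q w" for q w
  define F where "F q q' = f (shift (shift z p q (-1)) p q' 1)" for q q'
  have "H p (p-1) (-1) (H p (p+1) 1 f) z = (\<Sum>q=1..p. \<Sum>q'=1..p. - (d q w * u q' (bump w p q (-1)) * F q q'))"
    by (simp add: hop_def w_def u_def d_def F_def sum_distrib_left mult.assoc)
  moreover have "H p (p+1) 1 (H p (p-1) (-1) f) z = (\<Sum>q=1..p. \<Sum>q'=1..p. - (u q' w * d q (bump w p q' 1) * F q q'))"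
    by (subst sum.swap) (simp add: hop_def w_def u_def d_def F_def sum_distrib_left mult.assoc
        shift_commute[of z p _ 1] sum_negf)
  ultimately have "H p (p-1) (-1) (H p (p+1) 1 f) z - H p (p+1) 1 (H p (p-1) (-1) f) z =
      (\<Sum>q=1..p. \<Sum>q'=1..p. (u q' w * d q (bump w p q' 1) - d q w * u q' (bump w p q (-1))) * F q q')"
    by (simp add: sum_subtractf[symmetric] algebra_simps)
  also have "\<dots> = (\<Sum>q=1..p. \<Sum>q'=1..p. if q' = q then
      (u q w * d q (bump w p q 1) - d q w * u q (bump w p q (-1))) * f z else 0)"
  proof (intro sum.cong refl)
    fix q q' assume q: "q \<in> {1..p}" "q' \<in> {1..p}"
    show "(u q' w * d q (bump w p q' 1) - d q w * u q' (bump w p q (-1))) * F q q' =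
      (if q' = q then (u q w * d q (bump w p q 1) - d q w * u q (bump w p q (-1))) * f z else 0)"
    proof (cases "q' = q")
      case True
      then show ?thesis by (simp add: F_def shift_shift_cancel)
    next
      case False
      have nz: "w p q - w p q' \<noteq> 0" "w p q - w p q' - 1 \<noteq> 0" "w p q \<noteq> w p q' + 1" "w p q \<noteq> w p q'"
         "w p q' \<noteq> w p q + - 1"
        using row_entries_distinct(1,4)[OF p q False[symmetric], of z] row_entries_distinct(2,3)[OF p q False[symmetric], of z 1]
          row_entries_distinct(2)[OF p q(2,1) False, of z "-1"]
        unfolding w_def by auto
      have 1: "d q (bump w p q' 1) = d q w * ((w p q - w p q') / (w p q - w p q' - 1))"
        unfolding d_def by (rule hop_coeff_bump_row) (use p q False nz in auto)
      have 2: "u q' (bump w p q (-1)) = u q' w * ((w p q' - w p q) / (w p q' - w p q - (-1)))"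
        unfolding u_def by (rule hop_coeff_bump_row) (use p q False nz in auto)
      have "(w p q' - w p q) / (w p q' - w p q - (-1)) = (w p q - w p q') / (w p q - w p q' - 1)"
      proof -
        have "w p q' - w p q - (-1) = - (w p q - w p q' - 1)" "w p q' - w p q = - (w p q - w p q')" by simp_all
        thus ?thesis by (metis minus_divide_divide)
      qed
      thus ?thesis using False unfolding 1 2 by simp
    qed
  qed
  also have "\<dots> = (\<Sum>q=1..p. (u q w * d q (bump w p q 1) - d q w * u q (bump w p q (-1)))) * f z"
    by (simp add: sum_distrib_right)
  also have "\<dots> = (weight p w - weight (p+1) w) * f z"
    unfolding u_def d_def w_def lagrange_sum_weight[OF p] ..
  finally show ?thesis unfolding w_def .
qed

lemma weight_bump:
  assumes "1 \<le> q" "q \<le> p"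
  shows "weight r (bump w p q c) = weight r w + (if r = p then c else 0) - (if r = p + 1 then c else 0)"
proof -
  have s: "(\<Sum>u=1..m. bump w p q c m u + of_nat u - 1) = (\<Sum>u=1..m. w m u + of_nat u - 1) + (if m = p then c else 0)" for m
  proof (cases "m = p")
    case True
    have "(\<Sum>u=1..m. bump w p q c m u + of_nat u - 1) = (\<Sum>u=1..m. (w m u + of_nat u - 1) + (if u = q then c else 0))"
      by (rule sum.cong) (use True in \<open>auto simp: bump_def\<close>)
    also have "\<dots> = (\<Sum>u=1..m. w m u + of_nat u - 1) + c"
      using True assms by (subst sum.distrib) simp
    finally show ?thesis using True by simp
  qed simp
  have "r = p + 1 \<longleftrightarrow> r - 1 = p" if "r \<noteq> 0" using that by auto
  moreover have "p \<noteq> 0" using assms by auto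
  ultimately show ?thesis unfolding weight_def s by (cases "r = 0") auto
qed

lemma hop_weight:
  "H p c e (\<lambda>z. weight r (W z) * f z) z - weight r (W z) * H p c e f z =
    of_int e * ((if r = p then H p c e f z else 0) - (if r = p + 1 then H p c e f z else 0))"
proof -
  let ?k = "of_int e * ((if r = p then 1 else 0) - (if r = p + 1 then 1 else 0)) :: complex"
  have "H p c e (\<lambda>z. weight r (W z) * f z) z = (weight r (W z) + ?k) * H p c e f z"
    unfolding hop_def sum_distrib_left
    by (rule sum.cong) (auto simp: weight_bump algebra_simps)
  thus ?thesis by (cases "r = p"; cases "r = p + 1") (simp_all add: algebra_simps)
qed

end

lemma gt_E_diag: "gt_E n a v p p = lin_pm (gt_diag n a v p)"
  and gt_E_up: "gt_E n a v p (p + 1) = lin_pm (gt_up n a v p)"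
  and gt_E_down: "gt_E n a v (p + 1) p = lin_pm (gt_down n a v p)"
  by (subst gt_E.simps; simp)+

lemma gt_E_upper: "r + 1 < s \<Longrightarrow> gt_E n a v r s = commutator (gt_E n a v r (s-1)) (gt_E n a v (s-1) s)"
  by (subst gt_E.simps) simp

lemma gt_E_lower: "s + 1 < r \<Longrightarrow> gt_E n a v r s = commutator (gt_E n a v r (s+1)) (gt_E n a v (s+1) s)"
  by (subst gt_E.simps) simp

lemma pairing_gt_E_diag: "pairing f (gt_E n a v p p x) = pairing (\<lambda>z. weight p (tableau n a v z) * f z) x"
  and pairing_gt_E_up: "pairing f (gt_E n a v p (p + 1) x) = pairing (hop n a v p (p + 1) 1 f) x"
  and pairing_gt_E_down: "pairing f (gt_E n a v (p + 1) p x) = pairing (hop n a v p (p - 1) (-1) f) x"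
  unfolding gt_E_diag gt_E_up gt_E_down pairing_lin_pm pairing_gt_diag pairing_gt_up pairing_gt_down
  by (rule refl)+

lemma pairing_cong: "(\<And>z. f z = g z) \<Longrightarrow> pairing f x = pairing g x"
  unfolding pairing_def lin_ext_def by simp

lemma endo_eqI: "(\<And>x. Rep_endo f x = Rep_endo g x) \<Longrightarrow> f = g"
  by (rule iffD1[OF Rep_endo_inject]) (rule ext)

lemma br_endo_eqI:
  fixes f g h :: "('b \<Rightarrow>\<^sub>0 complex) endo"
  assumes "\<And>\<phi> x. pairing \<phi> (Rep_endo f (Rep_endo g x)) - pairing \<phi> (Rep_endo g (Rep_endo f x)) = pairing \<phi> (Rep_endo h x)"
  shows "br f g = h"
  by (rule endo_eqI, rule pairing_eqI) (simp add: br_endo commutator_def pairing_diff assms)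

text \<open>
  The expression \<open>ffg - 2fgf + gff\<close> for the double bracket is palindromic, hence not affected by the
  reversal of the order under transposition.
\<close>

lemma br_br_endo_eq_0:
  fixes f g :: "('b \<Rightarrow>\<^sub>0 complex) endo"
  assumes f: "\<And>\<phi> x. pairing \<phi> (Rep_endo f x) = pairing (F \<phi>) x"
    and g: "\<And>\<phi> x. pairing \<phi> (Rep_endo g x) = pairing (G \<phi>) x"
    and serre: "\<And>\<phi> z. F (F (G \<phi>)) z - 2 * F (G (F \<phi>)) z + G (F (F \<phi>)) z = 0"
  shows "br f (br f g) = 0"
proof (rule endo_eqI, rule pairing_eqI)
  fix x \<phi>
  have diff: "Rep_endo f (y - z) = Rep_endo f y - Rep_endo f z" for y z
  proof -
    have "\<forall>x y. Rep_endo f (x + y) = Rep_endo f x + Rep_endo f y" using Rep_endo[of f] by simp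
    hence "Rep_endo f (y - z + z) = Rep_endo f (y - z) + Rep_endo f z" by blast
    thus ?thesis by simp
  qed
  have *: "a - b - (b - c) = a - 2 * b + c" for a b c :: complex by simp
  have "pairing \<phi> (Rep_endo (br f (br f g)) x) =
      pairing (G (F (F \<phi>))) x - 2 * pairing (F (G (F \<phi>))) x + pairing (F (F (G \<phi>))) x"
    unfolding br_endo commutator_def diff pairing_diff f g * ..
  also have "\<dots> = pairing (\<lambda>z. F (F (G \<phi>)) z - 2 * F (G (F \<phi>)) z + G (F (F \<phi>)) z) x"
    unfolding pairing_fun_add pairing_fun_diff pairing_fun_scale by simp
  finally show "pairing \<phi> (Rep_endo (br f (br f g)) x) = pairing \<phi> (Rep_endo 0 x)"
    unfolding serre pairing_fun_zero zero_endo.rep_eq pairing_zero .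
qed

context gt_generic
begin

definition gl_op :: "nat \<Rightarrow> nat \<Rightarrow> (zvec \<Rightarrow>\<^sub>0 complex) endo" where
  "gl_op r s = Abs_endo (gt_E n a v r s)"

lemma Rep_gl_op: "Rep_endo (gl_op r s) = gt_E n a v r s"
  unfolding gl_op_def by (rule Abs_endo_inverse) (simp add: gt_E_additive)

lemmas pairing_gl_op = pairing_gt_E_diag pairing_gt_E_up pairing_gt_E_down

text \<open>
  Each relation is the transpose of an identity between shift operators.
\<close>

lemma gl_op_gl_generators: "gl_generators n gl_op"
proof
  fix x :: "(zvec \<Rightarrow>\<^sub>0 complex) endo" assume "x + x = 0"
  hence "Rep_endo x y + Rep_endo x y = 0" for y
    by (metis plus_endo.rep_eq zero_endo.rep_eq)
  hence "Poly_Mapping.lookup (Rep_endo x y + Rep_endo x y) k = 0" for y k by simp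
  hence "Poly_Mapping.lookup (Rep_endo x y) k = 0" for y k by (simp add: lookup_add)
  hence "Rep_endo x y = 0" for y by (simp add: poly_mapping_eqI)
  thus "x = 0" by (intro endo_eqI) (simp add: zero_endo.rep_eq)
next
  fix r s :: nat
  show "r + 1 < s \<Longrightarrow> gl_op r s = br (gl_op r (s - 1)) (gl_op (s - 1) s)"
    by (rule endo_eqI) (simp add: br_endo Rep_gl_op gt_E_upper)
  show "s + 1 < r \<Longrightarrow> gl_op r s = br (gl_op r (s + 1)) (gl_op (s + 1) s)"
    by (rule endo_eqI) (simp add: br_endo Rep_gl_op gt_E_lower)
next
  fix p q :: nat
  show "br (gl_op p p) (gl_op q q) = 0"
    by (rule br_endo_eqI) (simp add: Rep_gl_op pairing_gl_op zero_endo.rep_eq mult.left_commute)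
  have comm_up: "br (gl_op q q) (gl_op p (p + 1)) = (if q = p then gl_op p (p + 1) else 0) - (if q = p + 1 then gl_op p (p + 1) else 0)"
  proof (rule br_endo_eqI)
    fix \<phi> x
    have "pairing \<phi> (gt_E n a v q q (gt_E n a v p (p + 1) x)) - pairing \<phi> (gt_E n a v p (p + 1) (gt_E n a v q q x)) =
        pairing (\<lambda>z. H p (p + 1) 1 (\<lambda>z. weight q (W z) * \<phi> z) z - weight q (W z) * H p (p + 1) 1 \<phi> z) x"
      by (simp only: pairing_gl_op pairing_fun_diff)
    also have "\<dots> = pairing (\<lambda>z. (if q = p then H p (p+1) 1 \<phi> z else 0) - (if q = p + 1 then H p (p+1) 1 \<phi> z else 0)) x"
      by (intro pairing_cong) (simp add: hop_weight)
    also have "\<dots> = pairing \<phi> ((if q = p then gt_E n a v p (p + 1) x else 0) - (if q = p + 1 then gt_E n a v p (p + 1) x else 0))"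
      unfolding pairing_fun_diff pairing_diff by (auto simp: pairing_fun_zero pairing_gl_op simp del: add_Suc_right One_nat_def)
    finally show "pairing \<phi> (Rep_endo (gl_op q q) (Rep_endo (gl_op p (p + 1)) x)) -
           pairing \<phi> (Rep_endo (gl_op p (p + 1)) (Rep_endo (gl_op q q) x)) =
           pairing \<phi> (Rep_endo ((if q = p then gl_op p (p + 1) else 0) - (if q = p + 1 then gl_op p (p + 1) else 0)) x)"
      by (auto simp: Rep_gl_op minus_endo.rep_eq zero_endo.rep_eq)
  qed
  thus "br (gl_op q q) (gl_op p (p + 1)) = (if q = p then gl_op p (p + 1) else 0) - (if q = p + 1 then gl_op p (p + 1) else 0)" .
  show "br (gl_op q q) (gl_op (p + 1) p) = (if q = p + 1 then gl_op (p + 1) p else 0) - (if q = p then gl_op (p + 1) p else 0)"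
  proof (rule br_endo_eqI)
    fix \<phi> x
    have "pairing \<phi> (gt_E n a v q q (gt_E n a v (p + 1) p x)) - pairing \<phi> (gt_E n a v (p + 1) p (gt_E n a v q q x)) =
        pairing (\<lambda>z. H p (p - 1) (-1) (\<lambda>z. weight q (W z) * \<phi> z) z - weight q (W z) * H p (p - 1) (-1) \<phi> z) x"
      by (simp only: pairing_gl_op pairing_fun_diff)
    also have "\<dots> = pairing (\<lambda>z. (if q = p + 1 then H p (p-1) (-1) \<phi> z else 0) - (if q = p then H p (p-1) (-1) \<phi> z else 0)) x"
      by (intro pairing_cong) (simp add: hop_weight)
    also have "\<dots> = pairing \<phi> ((if q = p + 1 then gt_E n a v (p + 1) p x else 0) - (if q = p then gt_E n a v (p + 1) p x else 0))"
      unfolding pairing_fun_diff pairing_diff by (auto simp: pairing_fun_zero pairing_gl_op simp del: add_Suc_right One_nat_def)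
    finally show "pairing \<phi> (Rep_endo (gl_op q q) (Rep_endo (gl_op (p + 1) p) x)) -
           pairing \<phi> (Rep_endo (gl_op (p + 1) p) (Rep_endo (gl_op q q) x)) =
           pairing \<phi> (Rep_endo ((if q = p + 1 then gl_op (p + 1) p else 0) - (if q = p then gl_op (p + 1) p else 0)) x)"
      by (auto simp: Rep_gl_op minus_endo.rep_eq zero_endo.rep_eq)
  qed
  show "br (gl_op p (p + 1)) (gl_op (q + 1) q) = (if p = q then gl_op p p - gl_op (p + 1) (p + 1) else 0)"
    if pq: "1 \<le> p" "p < n" "1 \<le> q" "q < n"
  proof (rule br_endo_eqI)
    fix \<phi> x
    have "pairing \<phi> (gt_E n a v p (p + 1) (gt_E n a v (q + 1) q x)) - pairing \<phi> (gt_E n a v (q + 1) q (gt_E n a v p (p + 1) x)) =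
        pairing (\<lambda>z. H q (q - 1) (-1) (H p (p + 1) 1 \<phi>) z - H p (p + 1) 1 (H q (q - 1) (-1) \<phi>) z) x"
      by (simp only: pairing_gl_op pairing_fun_diff)
    also have "\<dots> = pairing (\<lambda>z. if p = q then (weight p (W z) - weight (p + 1) (W z)) * \<phi> z else 0) x"
    proof (rule pairing_cong)
      fix z
      consider "p = q" | "q = p + 1" | "p \<noteq> q" "q \<noteq> p + 1" by blast
      then show "H q (q - 1) (-1) (H p (p + 1) 1 \<phi>) z - H p (p + 1) 1 (H q (q - 1) (-1) \<phi>) z =
          (if p = q then (weight p (W z) - weight (p + 1) (W z)) * \<phi> z else 0)"
      proof cases
        case 1
        then show ?thesis using hop_ef[OF pq(1,2), of \<phi> z] by simp
      next
        case 2
        then show ?thesis using hop_commute_mutual[of p "p + 1" 1 \<phi> z] by simp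
      next
        case 3
        then have "H p (p + 1) 1 (H q (q - 1) (-1) \<phi>) z = H q (q - 1) (-1) (H p (p + 1) 1 \<phi>) z"
          using pq by (intro hop_commute_far) auto
        then show ?thesis using 3 by simp
      qed
    qed
    also have "\<dots> = pairing \<phi> (if p = q then gt_E n a v p p x - gt_E n a v (p + 1) (p + 1) x else 0)"
      unfolding left_diff_distrib
      by (cases "p = q") (simp_all only: pairing_diff pairing_gl_op pairing_fun_zero pairing_fun_diff refl if_True if_False pairing_zero)
    finally show "pairing \<phi> (Rep_endo (gl_op p (p + 1)) (Rep_endo (gl_op (q + 1) q) x)) -
           pairing \<phi> (Rep_endo (gl_op (q + 1) q) (Rep_endo (gl_op p (p + 1)) x)) =
           pairing \<phi> (Rep_endo (if p = q then gl_op p p - gl_op (p + 1) (p + 1) else 0) x)"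
      by (auto simp: Rep_gl_op minus_endo.rep_eq zero_endo.rep_eq)
  qed
  show "br (gl_op p (p + 1)) (gl_op q (q + 1)) = 0" if "1 \<le> p" "p + 1 < q" "q < n"
  proof (rule br_endo_eqI)
    fix \<phi> x
    have "H q (q + 1) 1 (H p (p + 1) 1 \<phi>) z = H p (p + 1) 1 (H q (q + 1) 1 \<phi>) z" for z
      using that by (intro hop_commute_far) auto
    hence "pairing (H q (q + 1) 1 (H p (p + 1) 1 \<phi>)) x = pairing (H p (p + 1) 1 (H q (q + 1) 1 \<phi>)) x"
      by (rule pairing_cong)
    thus "pairing \<phi> (Rep_endo (gl_op p (p + 1)) (Rep_endo (gl_op q (q + 1)) x)) -
           pairing \<phi> (Rep_endo (gl_op q (q + 1)) (Rep_endo (gl_op p (p + 1)) x)) = pairing \<phi> (Rep_endo 0 x)"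
      by (simp only: Rep_gl_op pairing_gl_op zero_endo.rep_eq pairing_zero) simp
  qed
  show "br (gl_op (p + 1) p) (gl_op (q + 1) q) = 0" if "1 \<le> p" "p + 1 < q" "q < n"
  proof (rule br_endo_eqI)
    fix \<phi> x
    have "H q (q - 1) (-1) (H p (p - 1) (-1) \<phi>) z = H p (p - 1) (-1) (H q (q - 1) (-1) \<phi>) z" for z
      using that by (intro hop_commute_far) auto
    hence "pairing (H q (q - 1) (-1) (H p (p - 1) (-1) \<phi>)) x = pairing (H p (p - 1) (-1) (H q (q - 1) (-1) \<phi>)) x"
      by (rule pairing_cong)
    thus "pairing \<phi> (Rep_endo (gl_op (p + 1) p) (Rep_endo (gl_op (q + 1) q) x)) -
           pairing \<phi> (Rep_endo (gl_op (q + 1) q) (Rep_endo (gl_op (p + 1) p) x)) = pairing \<phi> (Rep_endo 0 x)"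
      by (simp only: Rep_gl_op pairing_gl_op zero_endo.rep_eq pairing_zero) simp
  qed
next
  fix p :: nat assume p: "1 \<le> p" "p + 1 < n"
  have p2: "p + 2 = (p + 1) + 1" by simp
  show "br (gl_op p (p + 1)) (br (gl_op p (p + 1)) (gl_op (p + 1) (p + 2))) = 0"
    unfolding p2
    by (rule br_br_endo_eq_0[where F = "H p (p+1) 1" and G = "H (p+1) (p+1+1) 1"], unfold Rep_gl_op pairing_gl_op)
      (use hop_serre1[of p "p+1" "p+1+1" 1] p in simp_all)
  show "br (gl_op (p + 1) (p + 2)) (br (gl_op (p + 1) (p + 2)) (gl_op p (p + 1))) = 0"
    unfolding p2
    by (rule br_br_endo_eq_0[where F = "H (p+1) (p+1+1) 1" and G = "H p (p+1) 1"], unfold Rep_gl_op pairing_gl_op)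
      (use hop_serre2[of "p+1" p "p+1+1" 1] p in simp_all)
  show "br (gl_op (p + 1) p) (br (gl_op (p + 1) p) (gl_op (p + 2) (p + 1))) = 0"
    unfolding p2
    by (rule br_br_endo_eq_0[where F = "H p (p-1) (-1)" and G = "H (p+1) (p+1-1) (-1)"], unfold Rep_gl_op pairing_gl_op)
      (use hop_serre2[of p "p+1" "p-1" "-1"] p in simp_all)
  show "br (gl_op (p + 2) (p + 1)) (br (gl_op (p + 2) (p + 1)) (gl_op (p + 1) p)) = 0"
    unfolding p2
    by (rule br_br_endo_eq_0[where F = "H (p+1) (p+1-1) (-1)" and G = "H p (p-1) (-1)"], unfold Rep_gl_op pairing_gl_op)
      (use hop_serre1[of "p+1" p "p-1" "-1"] p in simp_all)
qed

theorem gt_E_relations: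
  assumes "1 \<le> r" "r \<le> n" "1 \<le> s" "s \<le> n" and "1 \<le> t" "t \<le> n" "1 \<le> u" "u \<le> n"
  shows "gt_E n a v r s (gt_E n a v t u x) - gt_E n a v t u (gt_E n a v r s x) =
    (if s = t then gt_E n a v r u x else 0) - (if u = r then gt_E n a v t s x else 0)"
proof -
  have "br (gl_op r s) (gl_op t u) = (if s = t then gl_op r u else 0) - (if u = r then gl_op t s else 0)"
    by (rule gl_generators.gl_relations[OF gl_op_gl_generators assms])
  hence "Rep_endo (br (gl_op r s) (gl_op t u)) x =
      Rep_endo ((if s = t then gl_op r u else 0) - (if u = r then gl_op t s else 0)) x" by simp
  thus ?thesis
    by (auto simp: br_endo commutator_def Rep_gl_op minus_endo.rep_eq zero_endo.rep_eq split: if_splits)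
qed

end

section \<open>Support of the coefficients\<close>

lemma gt_E_zero: "gt_E n a v r s 0 = 0"
  using gt_E_scale[of n a v r s 0 0] by (simp add: pm.scale_zero_left)

lemma gt_E_sum: "gt_E n a v r s (\<Sum>i\<in>I. f i) = (\<Sum>i\<in>I. gt_E n a v r s (f i))"
  by (induction I rule: infinite_finite_induct) (simp_all add: gt_E_zero gt_E_additive)

lemma pm_expand:
  assumes "finite S" "Poly_Mapping.keys x \<subseteq> S"
  shows "x = (\<Sum>z\<in>S. pm_scale (Poly_Mapping.lookup x z) (Poly_Mapping.single z 1))"
proof (rule poly_mapping_eqI)
  fix z
  have "(\<Sum>z'\<in>S. Poly_Mapping.lookup x z' * Poly_Mapping.lookup (Poly_Mapping.single z' 1) z) =
      (\<Sum>z'\<in>S. if z' = z then Poly_Mapping.lookup x z else 0)"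
    by (intro sum.cong refl) (auto simp: lookup_single)
  also have "\<dots> = Poly_Mapping.lookup x z"
    using assms by (auto simp: in_keys_iff)
  finally show "Poly_Mapping.lookup x z =
      Poly_Mapping.lookup (\<Sum>z\<in>S. pm_scale (Poly_Mapping.lookup x z) (Poly_Mapping.single z 1)) z"
    by (simp add: lookup_sum)
qed

lemma lookup_gt_E:
  assumes "finite S" "Poly_Mapping.keys x \<subseteq> S"
  shows "Poly_Mapping.lookup (gt_E n a v r s x) z' = (\<Sum>z\<in>S. Poly_Mapping.lookup x z * gt_coeff n a r s z z' v)"
  by (subst pm_expand[OF assms]) (simp add: gt_E_sum gt_E_scale lookup_sum gt_coeff_def)

text \<open>
  The rows that are moved by the generators occurring in \<open>E\<^sub>r\<^sub>s\<close>.
\<close>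

definition between :: "nat \<Rightarrow> nat \<Rightarrow> nat \<Rightarrow> bool" where
  "between r s p \<longleftrightarrow> r \<le> p \<and> p < s \<or> s \<le> p \<and> p < r"

text \<open>
  A finite set, independent of \<open>v\<close>, that contains all tableaux occurring in \<open>E\<^sub>r\<^sub>s T(v + z)\<close>. Entries change
  by at most 1 because each row is moved by at most one generator.
\<close>

definition reach :: "nat \<Rightarrow> nat \<Rightarrow> zvec \<Rightarrow> zvec set" where
  "reach r s z = {z'. \<forall>p q. \<bar>z' p q - z p q\<bar> \<le> 1 \<and> (\<not> (1 \<le> q \<and> q \<le> p \<and> between r s p) \<longrightarrow> z' p q = z p q)}"

lemma finite_reach: "finite (reach r s z)"
proof -
  define A where "A = {..r + s} \<times> {..r + s}"
  define F where "F = {f :: nat \<times> nat \<Rightarrow> int. \<forall>x. (x \<in> A \<longrightarrow> f x \<in> {-1..1}) \<and> (x \<notin> A \<longrightarrow> f x = 0)}"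
  have "finite F" unfolding F_def by (rule finite_set_of_finite_funs) (auto simp: A_def)
  moreover have "reach r s z \<subseteq> (\<lambda>f p q. z p q + f (p, q)) ` F"
  proof
    fix z' assume z': "z' \<in> reach r s z"
    have "z' = (\<lambda>p q. z p q + (\<lambda>(p, q). z' p q - z p q) (p, q))" by simp
    moreover have "(\<lambda>(p, q). z' p q - z p q) \<in> F"
    proof -
      have "-1 \<le> z' p q - z p q \<and> z' p q - z p q \<le> 1" for p q
        using z' by (auto simp: reach_def abs_le_iff) (smt (verit))
      moreover have "z' p q = z p q" if "(p, q) \<notin> A" for p q
      proof -
        have "\<not> (1 \<le> q \<and> q \<le> p \<and> between r s p)" using that by (auto simp: A_def between_def)
        thus ?thesis using z' by (auto simp: reach_def)
      qed
      ultimately show ?thesis by (auto simp: F_def)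
    qed
    ultimately show "z' \<in> (\<lambda>f p q. z p q + f (p, q)) ` F" by blast
  qed
  ultimately show ?thesis by (meson finite_surj)
qed

text \<open>
  Two successive steps that move disjoint sets of rows change each entry at most once.
\<close>

lemma reach_trans:
  assumes "z1 \<in> reach r m z" "z2 \<in> reach m' s z1" "\<And>p. \<not> (between r m p \<and> between m' s p)"
    "\<And>p. between r m p \<or> between m' s p \<Longrightarrow> between r' s' p"
  shows "z2 \<in> reach r' s' z"
  unfolding reach_def
proof (intro CollectI allI conjI impI)
  fix p q
  have 1: "\<bar>z1 p q - z p q\<bar> \<le> 1" "\<not> (1 \<le> q \<and> q \<le> p \<and> between r m p) \<Longrightarrow> z1 p q = z p q"
    and 2: "\<bar>z2 p q - z1 p q\<bar> \<le> 1" "\<not> (1 \<le> q \<and> q \<le> p \<and> between m' s p) \<Longrightarrow> z2 p q = z1 p q"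
    using assms(1,2) by (auto simp: reach_def)
  show "\<bar>z2 p q - z p q\<bar> \<le> 1" using 1 2 assms(3)[of p] by (cases "between r m p") auto
  assume "\<not> (1 \<le> q \<and> q \<le> p \<and> between r' s' p)"
  thus "z2 p q = z p q" using 1 2 assms(4)[of p] by metis
qed

lemma keys_minus_subset:
  assumes "Poly_Mapping.keys f \<subseteq> S" "Poly_Mapping.keys g \<subseteq> S"
  shows "Poly_Mapping.keys (f - g :: 'b \<Rightarrow>\<^sub>0 complex) \<subseteq> S"
proof
  fix x assume "x \<in> Poly_Mapping.keys (f - g)"
  hence "x \<in> Poly_Mapping.keys f \<or> x \<in> Poly_Mapping.keys g"
    by (auto simp: in_keys_iff lookup_minus)
  thus "x \<in> S" using assms by blast
qed

lemma keys_sum_subset: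
  "(\<And>i. i \<in> I \<Longrightarrow> Poly_Mapping.keys (f i) \<subseteq> S) \<Longrightarrow> Poly_Mapping.keys (\<Sum>i\<in>I. f i) \<subseteq> S"
proof (induction I rule: infinite_finite_induct)
  case (insert i I)
  have "Poly_Mapping.keys (f i + sum f I) \<subseteq> S"
    using keys_add[of "f i" "sum f I"] insert by blast
  thus ?case using insert by simp
qed auto

lemma keys_gt_E:
  assumes "\<And>z. z \<in> Poly_Mapping.keys x \<Longrightarrow> Poly_Mapping.keys (gt_E n a v r s (Poly_Mapping.single z 1)) \<subseteq> S"
  shows "Poly_Mapping.keys (gt_E n a v r s x) \<subseteq> S"
proof
  fix z' assume "z' \<in> Poly_Mapping.keys (gt_E n a v r s x)"
  hence "(\<Sum>z\<in>Poly_Mapping.keys x. Poly_Mapping.lookup x z * gt_coeff n a r s z z' v) \<noteq> 0"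
    by (simp add: in_keys_iff lookup_gt_E[OF finite_keys subset_refl])
  then obtain z where "z \<in> Poly_Mapping.keys x" "gt_coeff n a r s z z' v \<noteq> 0"
    by (metis (no_types, lifting) mult_zero_right sum.neutral)
  thus "z' \<in> S" using assms[of z] by (auto simp: gt_coeff_def in_keys_iff)
qed

lemma lin_pm_single_1: "lin_pm b (Poly_Mapping.single z 1) = b z"
  by (simp add: lin_ext_single[OF pm.vector_space_axioms])

lemma keys_gt_E_single:
  "Poly_Mapping.keys (gt_E n a v r s (Poly_Mapping.single z 1)) \<subseteq> reach r s z"
proof (induction "(r - s) + (s - r)" arbitrary: r s z rule: less_induct)
  case less
  have shift: "shift z p q e \<in> reach r s z" if "q \<in> {1..p}" "between r s p" "\<bar>e\<bar> \<le> 1" for p q e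
    using that by (auto simp: reach_def shift_def set_entry_def)
  have comm: "Poly_Mapping.keys (commutator (gt_E n a v r m) (gt_E n a v m s) (Poly_Mapping.single z 1)) \<subseteq> reach r s z"
    if m: "r < m \<and> m < s \<or> s < m \<and> m < r" for m
  proof -
    have lt: "(r - m) + (m - r) < (r - s) + (s - r)" "(m - s) + (s - m) < (r - s) + (s - r)"
      using m by auto
    have *: "\<not> (between r m p \<and> between m s p)" "\<not> (between m s p \<and> between r m p)"
        "between r m p \<or> between m s p \<Longrightarrow> between r s p" for p
      using m by (auto simp: between_def)
    have "Poly_Mapping.keys (gt_E n a v r m (gt_E n a v m s (Poly_Mapping.single z 1))) \<subseteq> reach r s z"
    proof (rule keys_gt_E)
      fix z1 assume "z1 \<in> Poly_Mapping.keys (gt_E n a v m s (Poly_Mapping.single z 1))"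
      hence "z1 \<in> reach m s z" using less[OF lt(2)] by blast
      thus "Poly_Mapping.keys (gt_E n a v r m (Poly_Mapping.single z1 1)) \<subseteq> reach r s z"
        using less[OF lt(1), of z1] reach_trans[of z1 m s z _ r m r s] * by blast
    qed
    moreover have "Poly_Mapping.keys (gt_E n a v m s (gt_E n a v r m (Poly_Mapping.single z 1))) \<subseteq> reach r s z"
    proof (rule keys_gt_E)
      fix z1 assume "z1 \<in> Poly_Mapping.keys (gt_E n a v r m (Poly_Mapping.single z 1))"
      hence "z1 \<in> reach r m z" using less[OF lt(1)] by blast
      thus "Poly_Mapping.keys (gt_E n a v m s (Poly_Mapping.single z1 1)) \<subseteq> reach r s z"
        using less[OF lt(2), of z1] reach_trans[of z1 r m z _ m s r s] * by blast
    qed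
    ultimately show ?thesis unfolding commutator_def by (rule keys_minus_subset)
  qed
  consider "r = s" | "s = r + 1" | "r = s + 1" | "r + 1 < s" | "s + 1 < r" by linarith
  then show ?case
  proof cases
    case 1
    have "z \<in> reach s s z" by (auto simp: reach_def)
    then show ?thesis
      unfolding 1 gt_E_diag lin_pm_single_1 gt_diag_def Let_def by simp
  next
    case 2
    have "shift z r q 1 \<in> reach r (r + 1) z" if "q \<in> {1..r}" for q
      using shift[OF that, of 1] by (simp add: 2 between_def)
    then show ?thesis unfolding 2 gt_E_up lin_pm_single_1 gt_up_def Let_def
      by (intro keys_sum_subset) auto
  next
    case 3
    have "shift z s q (-1) \<in> reach (s + 1) s z" if "q \<in> {1..s}" for q
      using shift[OF that, of "-1"] by (simp add: 3 between_def)
    then show ?thesis unfolding 3 gt_E_down lin_pm_single_1 gt_down_def Let_def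
      by (intro keys_sum_subset) auto
  next
    case 4
    show ?thesis unfolding gt_E_upper[OF 4] by (rule comm) (use 4 in auto)
  next
    case 5
    show ?thesis unfolding gt_E_lower[OF 5] by (rule comm) (use 5 in auto)
  qed
qed

lemma gt_coeff_reach: "z' \<notin> reach r s z \<Longrightarrow> gt_coeff n a r s z z' v = 0"
  using keys_gt_E_single[of n a v r s z] by (auto simp: gt_coeff_def in_keys_iff)

lemma lookup_gt_E_gt_E:
  "Poly_Mapping.lookup (gt_E n a v r s (gt_E n a v t u (Poly_Mapping.single z 1))) z' =
    (\<Sum>z1\<in>reach t u z. gt_coeff n a t u z z1 v * gt_coeff n a r s z1 z' v)"
  using lookup_gt_E[OF finite_reach keys_gt_E_single] by (simp add: gt_coeff_def)

lemma reach_zlattice: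
  assumes "z \<in> zlattice n" "r \<le> n" "s \<le> n"
  shows "reach r s z \<subseteq> zlattice n"
proof
  fix z' assume "z' \<in> reach r s z"
  then have "z' p q = z p q" if "\<not> (1 \<le> q \<and> q \<le> p \<and> p \<le> n - 1)" for p q
  proof -
    have "\<not> (1 \<le> q \<and> q \<le> p \<and> between r s p)" using that assms by (auto simp: between_def)
    thus ?thesis using \<open>z' \<in> reach r s z\<close> by (auto simp: reach_def)
  qed
  thus "z' \<in> zlattice n" using assms(1) by (auto simp: zlattice_def)
qed

section \<open>Functions regular at a point\<close>

lemma poly_funs_uminus: "f \<in> poly_funs n \<Longrightarrow> (\<lambda>v. - f v) \<in> poly_funs n"
  using poly_funs.mult[OF poly_funs.const[of "-1"]] by simp

lemma poly_funs_diff: "f \<in> poly_funs n \<Longrightarrow> g \<in> poly_funs n \<Longrightarrow> (\<lambda>v. f v - g v) \<in> poly_funs n"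
  using poly_funs.add[OF _ poly_funs_uminus] by fastforce

definition regular :: "nat \<Rightarrow> cvec \<Rightarrow> (cvec \<Rightarrow> complex) \<Rightarrow> bool" where
  "regular n v0 f \<longleftrightarrow> (\<exists>P\<in>poly_funs n. \<exists>Q\<in>poly_funs n. Q v0 \<noteq> 0 \<and> (\<forall>v. generic n v \<longrightarrow> f v * Q v = P v))"

lemma regular_poly: "f \<in> poly_funs n \<Longrightarrow> regular n v0 f"
  unfolding regular_def by (intro bexI[of _ f] bexI[of _ "\<lambda>_. 1"]) (auto intro: poly_funs.const)

lemma regular_const: "regular n v0 (\<lambda>_. c)"
  by (rule regular_poly) (rule poly_funs.const)

lemma regular_add:
  assumes "regular n v0 f" "regular n v0 g"
  shows "regular n v0 (\<lambda>v. f v + g v)"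
proof -
  obtain P Q P' Q' where *: "P \<in> poly_funs n" "Q \<in> poly_funs n" "Q v0 \<noteq> 0" "\<And>v. generic n v \<Longrightarrow> f v * Q v = P v"
    "P' \<in> poly_funs n" "Q' \<in> poly_funs n" "Q' v0 \<noteq> 0" "\<And>v. generic n v \<Longrightarrow> g v * Q' v = P' v"
    using assms unfolding regular_def by blast
  show ?thesis unfolding regular_def
  proof (intro bexI conjI allI impI)
    show "Q v0 * Q' v0 \<noteq> 0" using * by simp
    show "(f v + g v) * (Q v * Q' v) = P v * Q' v + P' v * Q v" if "generic n v" for v
      unfolding *(4,8)[OF that, symmetric] by (simp add: algebra_simps)
  qed (intro poly_funs.add poly_funs.mult *)+
qed

lemma regular_mult:
  assumes "regular n v0 f" "regular n v0 g"
  shows "regular n v0 (\<lambda>v. f v * g v)"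
proof -
  obtain P Q P' Q' where *: "P \<in> poly_funs n" "Q \<in> poly_funs n" "Q v0 \<noteq> 0" "\<And>v. generic n v \<Longrightarrow> f v * Q v = P v"
    "P' \<in> poly_funs n" "Q' \<in> poly_funs n" "Q' v0 \<noteq> 0" "\<And>v. generic n v \<Longrightarrow> g v * Q' v = P' v"
    using assms unfolding regular_def by blast
  show ?thesis unfolding regular_def
  proof (intro bexI conjI allI impI)
    show "Q v0 * Q' v0 \<noteq> 0" using * by simp
    show "(f v * g v) * (Q v * Q' v) = P v * P' v" if "generic n v" for v
      unfolding *(4,8)[OF that, symmetric] by (simp add: algebra_simps)
  qed (intro poly_funs.mult *)+
qed

lemma regular_diff:
  assumes "regular n v0 f" "regular n v0 g"
  shows "regular n v0 (\<lambda>v. f v - g v)"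
  using regular_add[OF assms(1) regular_mult[OF regular_const[of n v0 "-1"] assms(2)]] by simp

lemma regular_sum: "(\<And>i. i \<in> I \<Longrightarrow> regular n v0 (f i)) \<Longrightarrow> regular n v0 (\<lambda>v. \<Sum>i\<in>I. f i v)"
  by (induction I rule: infinite_finite_induct) (auto intro: regular_add regular_const)

lemma regular_prod: "(\<And>i. i \<in> I \<Longrightarrow> regular n v0 (f i)) \<Longrightarrow> regular n v0 (\<lambda>v. \<Prod>i\<in>I. f i v)"
  by (induction I rule: infinite_finite_induct) (auto intro: regular_mult regular_const)

lemma regular_cong: "(\<And>v. generic n v \<Longrightarrow> f v = g v) \<Longrightarrow> regular n v0 f \<Longrightarrow> regular n v0 g"
  unfolding regular_def by metis

text \<open>
  Zeros at generic vectors have to be excluded, because a rational function is represented by its values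
  there and division by zero would spoil them.
\<close>

lemma regular_inverse:
  assumes "f \<in> poly_funs n" "f v0 \<noteq> 0" "\<And>v. generic n v \<Longrightarrow> f v \<noteq> 0"
  shows "regular n v0 (\<lambda>v. inverse (f v))"
  unfolding regular_def using assms
  by (intro bexI[of _ "\<lambda>_. 1"] bexI[of _ f]) (auto intro: poly_funs.const)

lemma poly_funs_tableau:
  assumes "1 \<le> q" "q \<le> p" "p \<le> n"
  shows "(\<lambda>v. tableau n a v z p q) \<in> poly_funs n"
proof (cases "p = n")
  case True
  then show ?thesis by (simp add: tableau_def poly_funs.const)
next
  case False
  then show ?thesis using assms
    by (auto simp: tableau_def intro!: poly_funs.add poly_funs.const poly_funs.var)
qed

section \<open>Poles at a singular vector\<close>

locale singular_data =
  fixes n k i j :: nat and a :: "nat \<Rightarrow> complex" and vbar :: cvec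
  assumes i1: "1 \<le> i" and ij: "i < j" and jk: "j \<le> k" and kn: "k \<le> n - 1"
    and vbar_eq: "vbar k i = vbar k j"
    and vbar_nonint: "\<And>r s u. 1 \<le> s \<Longrightarrow> s < u \<Longrightarrow> u \<le> r \<Longrightarrow> r \<le> n - 1 \<Longrightarrow> (r, s, u) \<noteq> (k, i, j) \<Longrightarrow>
           vbar r s - vbar r u \<notin> \<int>"
begin

lemma bounds: "1 \<le> i" "i \<le> k" "1 \<le> j" "j \<le> k" "i \<noteq> j" "1 \<le> k" "k \<noteq> n" "k < n"
  using i1 ij jk kn by auto

abbreviation \<delta> :: "cvec \<Rightarrow> complex" where "\<delta> v \<equiv> v k i - v k j"

lemma regular_delta: "regular n vbar \<delta>"
  by (intro regular_poly poly_funs_diff poly_funs.var) (use bounds kn in auto)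

lemma tableau_delta: "tableau n a v z k i - tableau n a v z k j = \<delta> v + of_int (z k i - z k j)"
  using bounds by (simp add: tableau_def)

text \<open>
  A factor of a denominator vanishes at the singular vector only if it is the difference of the entries
  \<open>(k,i)\<close> and \<open>(k,j)\<close> of a tableau in which they agree.
\<close>

lemma regular_inverse_factor:
  assumes p: "1 \<le> p" "p < n" and q: "q \<in> {1..p}" "u \<in> {1..p}" "q \<noteq> u"
    and ns: "p = k \<Longrightarrow> {q, u} = {i, j} \<Longrightarrow> z k i \<noteq> z k j"
  shows "regular n vbar (\<lambda>v. inverse (tableau n a v z p q - tableau n a v z p u))"
proof (rule regular_inverse)
  show "(\<lambda>v. tableau n a v z p q - tableau n a v z p u) \<in> poly_funs n"
    by (intro poly_funs_diff poly_funs_tableau) (use assms in auto)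
  show "tableau n a v z p q - tableau n a v z p u \<noteq> 0" if "generic n v" for v
  proof -
    interpret gt_generic n a v by unfold_locales fact
    show ?thesis using row_entries_distinct(4)[OF p q] .
  qed
  show "tableau n a vbar z p q - tableau n a vbar z p u \<noteq> 0"
  proof
    assume 0: "tableau n a vbar z p q - tableau n a vbar z p u = 0"
    hence e: "vbar p q - vbar p u = of_int (z p u - z p q)"
      using p by (simp add: tableau_def algebra_simps)
    hence int: "vbar p q - vbar p u \<in> \<int>" by simp
    hence int': "vbar p u - vbar p q \<in> \<int>" using Ints_minus by fastforce
    have "p = k \<and> {q, u} = {i, j}"
    proof (rule ccontr)
      assume "\<not> ?thesis"
      hence "(p, q, u) \<noteq> (k, i, j)" "(p, u, q) \<noteq> (k, i, j)" by auto
      moreover have "q < u \<or> u < q" "1 \<le> q" "1 \<le> u" "q \<le> p" "u \<le> p" "p \<le> n - 1" using p q by auto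
      ultimately show False using vbar_nonint[of q u p] vbar_nonint[of u q p] int int' by blast
    qed
    moreover from this have "vbar p q = vbar p u" using vbar_eq by (auto simp: doubleton_eq_iff)
    hence "z p u = z p q" using e by simp
    ultimately show False using ns by (auto simp: doubleton_eq_iff)
  qed
qed

lemma regular_delta_inverse_factor:
  assumes q: "q \<in> {1..k}" "u \<in> {1..k}" "q \<noteq> u"
  shows "regular n vbar (\<lambda>v. \<delta> v * inverse (tableau n a v z k q - tableau n a v z k u))"
proof (cases "{q, u} = {i, j} \<and> z k i = z k j")
  case False
  then show ?thesis
    by (intro regular_mult regular_delta regular_inverse_factor) (use bounds q in auto)
next
  case True
  have nz: "\<delta> v \<noteq> 0" if "generic n v" for v
    using that bounds ij kn by (force simp: generic_def)
  have \<delta>: "tableau n a v z k i - tableau n a v z k j = \<delta> v" for v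
    using True by (simp add: tableau_delta)
  consider "q = i" "u = j" | "q = j" "u = i" using True by (auto simp: doubleton_eq_iff)
  then show ?thesis
  proof cases
    case 1
    show ?thesis
      by (rule regular_cong[OF _ regular_const[of n vbar 1]]) (use 1 nz in \<open>auto simp: \<delta>\<close>)
  next
    case 2
    have "tableau n a v z k j - tableau n a v z k i = - \<delta> v" for v
      using \<delta>[of v] by (metis minus_diff_eq)
    hence "-1 = \<delta> v * inverse (tableau n a v z k q - tableau n a v z k u)" if "generic n v" for v
      using nz[OF that] unfolding 2 by (simp only: inverse_minus_eq mult_minus_right right_inverse not_False_eq_True)
    thus ?thesis by (rule regular_cong[OF _ regular_const])
  qed
qed

lemma hop_coeff_inverse:
  "hop_coeff p c {} q w = (\<Prod>u\<in>{1..c}. w p q - w c u) * (\<Prod>u\<in>{1..p}-{q}. inverse (w p q - w p u))"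
  by (simp add: hop_coeff_def divide_inverse prod_inversef[symmetric] o_def)

text \<open>
  At most one factor of the denominator vanishes at the singular vector, and \<open>x - y\<close> cancels it.
\<close>

lemma regular_hop_coeff:
  assumes p: "1 \<le> p" "p < n" and q: "q \<in> {1..p}" and c: "c \<le> n"
  shows "p \<noteq> k \<or> z k i \<noteq> z k j \<Longrightarrow> regular n vbar (\<lambda>v. hop_coeff p c {} q (tableau n a v z))"
    and "regular n vbar (\<lambda>v. \<delta> v * hop_coeff p c {} q (tableau n a v z))"
proof -
  have num: "regular n vbar (\<lambda>v. \<Prod>u\<in>{1..c}. tableau n a v z p q - tableau n a v z c u)"
    by (intro regular_prod regular_poly poly_funs_diff poly_funs_tableau) (use assms in auto)
  show 1: "regular n vbar (\<lambda>v. hop_coeff p c {} q (tableau n a v z))" if "p \<noteq> k \<or> z k i \<noteq> z k j"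
    unfolding hop_coeff_inverse
    by (intro regular_mult num regular_prod regular_inverse_factor) (use that p q in auto)
  show "regular n vbar (\<lambda>v. \<delta> v * hop_coeff p c {} q (tableau n a v z))"
  proof (cases "p = k \<and> q \<in> {i, j}")
    case False
    have "regular n vbar (\<lambda>v. hop_coeff p c {} q (tableau n a v z))"
      unfolding hop_coeff_inverse
      by (intro regular_mult num regular_prod regular_inverse_factor)
        (use False p q in \<open>auto simp: doubleton_eq_iff\<close>)
    thus ?thesis by (intro regular_mult regular_delta)
  next
    case True
    define u where "u = (if q = i then j else i)"
    have u: "u \<in> {1..k}" "u \<noteq> q" "{q, u} = {i, j}" using True bounds by (auto simp: u_def)
    have eq: "\<delta> v * hop_coeff p c {} q (tableau n a v z) =
        (\<Prod>u\<in>{1..c}. tableau n a v z p q - tableau n a v z c u) *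
        (\<delta> v * inverse (tableau n a v z k q - tableau n a v z k u)) *
        (\<Prod>u\<in>{1..p}-{q}-{u}. inverse (tableau n a v z p q - tableau n a v z p u))" for v
    proof -
      have "(\<Prod>u\<in>{1..p}-{q}. inverse (tableau n a v z p q - tableau n a v z p u)) =
          inverse (tableau n a v z p q - tableau n a v z p u) *
          (\<Prod>u\<in>{1..p}-{q}-{u}. inverse (tableau n a v z p q - tableau n a v z p u))"
        by (rule prod.remove) (use u True in auto)
      thus ?thesis unfolding hop_coeff_inverse using True by (simp add: mult_ac)
    qed
    show ?thesis unfolding eq
      by (intro regular_mult[OF regular_mult] num regular_delta_inverse_factor regular_prod regular_inverse_factor)
        (use u True p q in \<open>auto simp: doubleton_eq_iff\<close>)
  qed
qed

lemma gt_coeff_diag: "gt_coeff n a p p z z' v = (if z' = z then weight p (tableau n a v z) else 0)"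
  unfolding gt_coeff_def gt_E_diag lin_pm_single_1 gt_diag_def Let_def weight_def
  by (simp add: lookup_single when_def)

lemma gt_coeff_up: "gt_coeff n a p (p + 1) z z' v =
    (\<Sum>q=1..p. (if shift z p q 1 = z' then -1 else 0) * hop_coeff p (p + 1) {} q (tableau n a v z))"
  unfolding gt_coeff_def gt_E_up lin_pm_single_1 gt_up_def Let_def lookup_sum hop_coeff_def
  by (intro sum.cong refl) (auto simp: lookup_single when_def)

lemma gt_coeff_down: "gt_coeff n a (p + 1) p z z' v =
    (\<Sum>q=1..p. (if shift z p q (-1) = z' then 1 else 0) * hop_coeff p (p - 1) {} q (tableau n a v z))"
  unfolding gt_coeff_def gt_E_down lin_pm_single_1 gt_down_def Let_def lookup_sum hop_coeff_def
  by (intro sum.cong refl) (auto simp: lookup_single when_def)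

lemmas gt_coeff_diag_fun = ext[OF gt_coeff_diag]
  and gt_coeff_up_fun = ext[OF gt_coeff_up]
  and gt_coeff_down_fun = ext[OF gt_coeff_down]

lemma gt_coeff_commutator:
  assumes "r < m \<and> m < s \<and> m = s - 1 \<or> s < m \<and> m < r \<and> m = s + 1"
  shows "gt_coeff n a r s z z' v =
    (\<Sum>z1\<in>reach m s z. gt_coeff n a m s z z1 v * gt_coeff n a r m z1 z' v) -
    (\<Sum>z1\<in>reach r m z. gt_coeff n a r m z z1 v * gt_coeff n a m s z1 z' v)"
proof -
  have "gt_E n a v r s = commutator (gt_E n a v r m) (gt_E n a v m s)"
    using assms gt_E_upper[of r s] gt_E_lower[of s r] by auto
  hence "gt_coeff n a r s z z' v = Poly_Mapping.lookup
     (gt_E n a v r m (gt_E n a v m s (Poly_Mapping.single z 1)) - gt_E n a v m s (gt_E n a v r m (Poly_Mapping.single z 1))) z'"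
    by (simp add: gt_coeff_def commutator_def)
  thus ?thesis by (simp add: lookup_minus lookup_gt_E_gt_E)
qed

lemma reach_inactive: "z' \<in> reach r s z \<Longrightarrow> \<not> between r s k \<Longrightarrow> z' k q = z k q"
  by (auto simp: reach_def)

text \<open>
  The generators that do not move row \<open>k\<close> have regular coefficients and keep the entries of row \<open>k\<close>. In
  the commutator that defines \<open>E\<^sub>r\<^sub>s\<close> at most one factor moves row \<open>k\<close>; so if row \<open>k\<close> of \<open>z\<close> has different
  entries in columns \<open>i\<close> and \<open>j\<close>, it still has them when that factor is applied, and the factor is
  regular there by induction.
\<close>

lemma regular_gt_coeff:
  assumes "1 \<le> r" "r \<le> n" "1 \<le> s" "s \<le> n"
  shows "(\<not> between r s k \<or> z k i \<noteq> z k j \<longrightarrow> regular n vbar (gt_coeff n a r s z z')) \<and>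
    regular n vbar (\<lambda>v. \<delta> v * gt_coeff n a r s z z' v)"
  using assms
proof (induction "(r - s) + (s - r)" arbitrary: r s z z' rule: less_induct)
  case less
  have reg: "(\<not> between r s k \<or> z k i \<noteq> z k j \<longrightarrow> regular n vbar (gt_coeff n a r s z z')) \<and>
      regular n vbar (\<lambda>v. \<delta> v * gt_coeff n a r s z z' v)"
    if m: "r < m \<and> m < s \<and> m = s - 1 \<or> s < m \<and> m < r \<and> m = s + 1" for m
  proof -
    have lt: "(r - m) + (m - r) < (r - s) + (s - r)" "(m - s) + (s - m) < (r - s) + (s - r)"
      and mn: "1 \<le> m" "m \<le> n" using m less.prems by auto
    note A = less.hyps[OF lt(1) less.prems(1,2) mn] and B = less.hyps[OF lt(2) mn less.prems(3,4)]
    have btw: "between r s k \<longleftrightarrow> between r m k \<or> between m s k" "\<not> (between r m k \<and> between m s k)"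
      using m by (auto simp: between_def)
    have A1: "regular n vbar (gt_coeff n a r m z z')" if "\<not> between r m k \<or> z k i \<noteq> z k j" for z z'
      using A that by blast
    have B1: "regular n vbar (gt_coeff n a m s z z')" if "\<not> between m s k \<or> z k i \<noteq> z k j" for z z'
      using B that by blast
    have A2: "regular n vbar (\<lambda>v. \<delta> v * gt_coeff n a r m z z' v)" for z z' using A by blast
    have B2: "regular n vbar (\<lambda>v. \<delta> v * gt_coeff n a m s z z' v)" for z z' using B by blast
    have "regular n vbar (gt_coeff n a r s z z')" if ns: "\<not> between r s k \<or> z k i \<noteq> z k j"
    proof -
      have "regular n vbar (\<lambda>v. (\<Sum>z1\<in>reach m s z. gt_coeff n a m s z z1 v * gt_coeff n a r m z1 z' v) -
          (\<Sum>z1\<in>reach r m z. gt_coeff n a r m z z1 v * gt_coeff n a m s z1 z' v))"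
      proof (intro regular_diff regular_sum regular_mult)
        fix z1 assume z1: "z1 \<in> reach m s z"
        show "regular n vbar (gt_coeff n a m s z z1)" using ns btw by (intro B1) auto
        show "regular n vbar (gt_coeff n a r m z1 z')"
          using ns btw reach_inactive[OF z1] by (intro A1) metis
      next
        fix z1 assume z1: "z1 \<in> reach r m z"
        show "regular n vbar (gt_coeff n a r m z z1)" using ns btw by (intro A1) auto
        show "regular n vbar (gt_coeff n a m s z1 z')"
          using ns btw reach_inactive[OF z1] by (intro B1) metis
      qed
      thus ?thesis by (rule regular_cong[rotated]) (simp add: gt_coeff_commutator[OF m])
    qed
    moreover have "regular n vbar (\<lambda>v. \<delta> v * gt_coeff n a r s z z' v)"
    proof -
      have prod: "regular n vbar (\<lambda>v. \<delta> v * (gt_coeff n a m s z z1 v * gt_coeff n a r m z1 z' v))"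
        "regular n vbar (\<lambda>v. \<delta> v * (gt_coeff n a r m z z1 v * gt_coeff n a m s z1 z' v))" for z1
      proof -
        consider "\<not> between r m k" | "\<not> between m s k" using btw by blast
        then have "regular n vbar (\<lambda>v. \<delta> v * (gt_coeff n a m s z z1 v * gt_coeff n a r m z1 z' v)) \<and>
          regular n vbar (\<lambda>v. \<delta> v * (gt_coeff n a r m z z1 v * gt_coeff n a m s z1 z' v))"
        proof cases
          case 1
          show ?thesis
            using regular_mult[OF B2[of z z1] A1[of z1 z']] regular_mult[OF A1[of z z1] B2[of z1 z']] 1
            by (simp add: mult_ac)
        next
          case 2
          show ?thesis
            using regular_mult[OF B1[of z z1] A2[of z1 z']] regular_mult[OF A2[of z z1] B1[of z1 z']] 2
            by (simp add: mult_ac)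
        qed
        thus "regular n vbar (\<lambda>v. \<delta> v * (gt_coeff n a m s z z1 v * gt_coeff n a r m z1 z' v))"
          "regular n vbar (\<lambda>v. \<delta> v * (gt_coeff n a r m z z1 v * gt_coeff n a m s z1 z' v))" by auto
      qed
      have "regular n vbar (\<lambda>v. (\<Sum>z1\<in>reach m s z. \<delta> v * (gt_coeff n a m s z z1 v * gt_coeff n a r m z1 z' v)) -
          (\<Sum>z1\<in>reach r m z. \<delta> v * (gt_coeff n a r m z z1 v * gt_coeff n a m s z1 z' v)))"
        by (intro regular_diff regular_sum prod)
      thus ?thesis
        by (rule regular_cong[rotated])
          (simp add: gt_coeff_commutator[OF m] right_diff_distrib sum_distrib_left)
    qed
    ultimately show ?thesis by blast
  qed
  consider "r = s" | "s = r + 1" | "r = s + 1" | "r + 1 < s" | "s + 1 < r" by linarith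
  then show ?case
  proof cases
    case 1
    have "regular n vbar (gt_coeff n a r s z z')"
    proof -
      have "(\<lambda>v. weight s (tableau n a v z)) \<in> poly_funs n"
      proof -
        have sum: "(\<And>i. i \<in> I \<Longrightarrow> f i \<in> poly_funs n) \<Longrightarrow> (\<lambda>v. \<Sum>i\<in>I. f i v) \<in> poly_funs n" for I :: "nat set" and f
          by (induction I rule: infinite_finite_induct) (auto intro: poly_funs.add poly_funs.const)
        show ?thesis unfolding weight_def
          by (intro poly_funs_diff sum poly_funs.add poly_funs_tableau poly_funs.const)
            (use less.prems in auto)
      qed
      thus ?thesis unfolding 1 gt_coeff_diag_fun
        by (cases "z' = z") (simp_all add: regular_poly regular_const)
    qed
    then show ?thesis using regular_mult[OF regular_delta] by auto
  next
    case 2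
    have "regular n vbar (gt_coeff n a r s z z')" if "r \<noteq> k \<or> z k i \<noteq> z k j"
      unfolding 2 gt_coeff_up_fun
      by (intro regular_sum regular_mult regular_const regular_hop_coeff) (use that less.prems 2 in auto)
    moreover have "regular n vbar (\<lambda>v. \<Sum>q=1..r. (if shift z r q 1 = z' then -1 else 0) *
        (\<delta> v * hop_coeff r (r + 1) {} q (tableau n a v z)))"
      by (intro regular_sum regular_mult[OF regular_const] regular_hop_coeff) (use less.prems 2 in auto)
    hence "regular n vbar (\<lambda>v. \<delta> v * gt_coeff n a r s z z' v)"
      by (rule regular_cong[rotated]) (simp add: 2 gt_coeff_up[simplified] sum_distrib_left mult_ac)
    ultimately show ?thesis using 2 by (auto simp: between_def)
  next
    case 3
    have "regular n vbar (gt_coeff n a r s z z')" if "s \<noteq> k \<or> z k i \<noteq> z k j"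
      unfolding 3 gt_coeff_down_fun
      by (intro regular_sum regular_mult regular_const regular_hop_coeff) (use that less.prems 3 in auto)
    moreover have "regular n vbar (\<lambda>v. \<Sum>q=1..s. (if shift z s q (-1) = z' then 1 else 0) *
        (\<delta> v * hop_coeff s (s - 1) {} q (tableau n a v z)))"
      by (intro regular_sum regular_mult[OF regular_const] regular_hop_coeff) (use less.prems 3 in auto)
    hence "regular n vbar (\<lambda>v. \<delta> v * gt_coeff n a r s z z' v)"
      by (rule regular_cong[rotated]) (simp add: 3 gt_coeff_down[simplified] sum_distrib_left mult_ac)
    ultimately show ?thesis using 3 by (auto simp: between_def)
  next
    case 4
    show ?thesis by (rule reg[of "s - 1"]) (use 4 in auto)
  next
    case 5
    show ?thesis by (rule reg[of "s + 1"]) (use 5 in auto)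
  qed
qed

end

section \<open>Laurent series\<close>

lemma has_laurent_expansion_transfer:
  assumes "f has_laurent_expansion F" "\<forall>\<^sub>F x in at 0. f x = g x"
  shows "g has_laurent_expansion F"
  using has_laurent_expansion_cong[OF assms(2) refl] assms(1) by simp

text \<open>
  The two coefficients of a product that \<open>ev\<close> reads, when the product has at most a simple pole.
\<close>

lemma fls_nth_mult_simple_pole:
  fixes F G :: "complex fls"
  assumes F: "\<And>p. p < -1 \<Longrightarrow> fls_nth F p = 0" and G: "\<And>p. p < 0 \<Longrightarrow> fls_nth G p = 0"
  shows "p < -1 \<Longrightarrow> fls_nth (F * G) p = 0"
    and "fls_nth (F * G) (-1) = fls_nth F (-1) * fls_nth G 0"
    and "fls_nth (F * G) 0 = fls_nth F (-1) * fls_nth G 1 + fls_nth F 0 * fls_nth G 0"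
proof -
  define f where "f = fls_regpart (fls_shift (-1) F)"
  define g where "g = fls_regpart G"
  have F': "F = fls_shift 1 (fps_to_fls f)"
    by (rule fls_eqI) (use F in \<open>auto simp: f_def\<close>)
  have G': "G = fps_to_fls g"
    by (rule fls_eqI) (use G in \<open>auto simp: g_def\<close>)
  have FG: "F * G = fls_shift 1 (fps_to_fls (f * g))"
    unfolding F' G' by (simp add: fls_shifted_times_simps fls_times_fps_to_fls)
  show "p < -1 \<Longrightarrow> fls_nth (F * G) p = 0"
    unfolding FG by simp
  show "fls_nth (F * G) (-1) = fls_nth F (-1) * fls_nth G 0"
    unfolding FG unfolding F' G' by simp
  show "fls_nth (F * G) 0 = fls_nth F (-1) * fls_nth G 1 + fls_nth F 0 * fls_nth G 0"
    unfolding FG unfolding F' G' by (simp add: fps_mult_nth_1)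
qed

section \<open>Equivariance under the transposition\<close>

context singular_data
begin

abbreviation \<tau> :: "(nat \<Rightarrow> nat \<Rightarrow> 'b) \<Rightarrow> nat \<Rightarrow> nat \<Rightarrow> 'b" where "\<tau> \<equiv> tau k i j"

text \<open>
  The permutation of the columns of row \<open>p\<close> that \<open>\<tau>\<close> induces: a transposition for \<open>p = k\<close>, and the
  identity in all other rows.
\<close>

definition col_swap :: "nat \<Rightarrow> nat \<Rightarrow> nat" where
  "col_swap p q = (if p = k \<and> q = i then j else if p = k \<and> q = j then i else q)"

lemma tau_apply: "\<tau> z p q = z p (col_swap p q)"
  using bounds by (auto simp: tau_def set_entry_def col_swap_def)

lemma col_swap_col_swap [simp]: "col_swap p (col_swap p q) = q"
  by (auto simp: col_swap_def)

lemma col_swap_mem: "q \<in> {1..p} \<Longrightarrow> col_swap p q \<in> {1..p}"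
  using bounds by (auto simp: col_swap_def)

lemma col_swap_n [simp]: "col_swap n q = q"
  using bounds by (simp add: col_swap_def)

lemma bij_col_swap: "bij_betw (col_swap p) {1..p} {1..p}"
  by (rule bij_betwI[of _ _ _ "col_swap p"]) (use col_swap_mem in auto)

lemma bij_col_swap_remove: "bij_betw (col_swap p) ({1..p} - {q}) ({1..p} - {col_swap p q})"
proof (rule bij_betwI[of _ _ _ "col_swap p"])
  show "col_swap p \<in> {1..p} - {q} \<rightarrow> {1..p} - {col_swap p q}"
    using col_swap_mem[of _ p] by (auto simp del: One_nat_def) (metis col_swap_col_swap)
  show "col_swap p \<in> {1..p} - {col_swap p q} \<rightarrow> {1..p} - {q}"
    using col_swap_mem[of _ p] by (auto simp del: One_nat_def)
qed auto

lemma tau_tau [simp]: "\<tau> (\<tau> z) = z"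
  by (intro ext) (simp add: tau_apply)

lemma tau_inj: "\<tau> z = \<tau> z' \<longleftrightarrow> z = z'"
  by (metis tau_tau)

lemma tau_fixed_iff: "\<tau> z = z \<longleftrightarrow> z k i = z k j"
proof
  assume "\<tau> z = z"
  hence "\<tau> z k i = z k i" by simp
  thus "z k i = z k j" by (simp add: tau_apply col_swap_def)
next
  assume "z k i = z k j"
  thus "\<tau> z = z" by (intro ext) (auto simp: tau_apply col_swap_def)
qed

lemma tau_zlattice: "z \<in> zlattice n \<Longrightarrow> \<tau> z \<in> zlattice n"
  using bounds kn by (auto simp: zlattice_def tau_apply col_swap_def)

lemma tableau_tau: "tableau n a (\<tau> v) (\<tau> z) = \<tau> (tableau n a v z)"
  using bounds by (intro ext) (auto simp: tableau_def tau_apply col_swap_def)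

lemma tau_shift: "\<tau> (shift z p q e) = shift (\<tau> z) p (col_swap p q) e"
proof (intro ext)
  fix r s
  have "col_swap p s = q \<longleftrightarrow> s = col_swap p q" using col_swap_col_swap by metis
  thus "\<tau> (shift z p q e) r s = shift (\<tau> z) p (col_swap p q) e r s"
    by (auto simp: tau_apply shift_def set_entry_def)
qed

lemma hop_coeff_tau: "hop_coeff p c {} (col_swap p q) (\<tau> w) = hop_coeff p c {} q w"
proof -
  have "(\<Prod>u\<in>{1..c}. w p q - w c (col_swap c u)) = (\<Prod>u\<in>{1..c}. w p q - w c u)"
    by (rule prod.reindex_bij_betw[OF bij_col_swap])
  moreover have "(\<Prod>u\<in>{1..p}-{col_swap p q}. w p q - w p (col_swap p u)) = (\<Prod>u\<in>{1..p}-{q}. w p q - w p u)"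
    using prod.reindex_bij_betw[OF bij_col_swap_remove[of p "col_swap p q"], of "\<lambda>u. w p q - w p u"] by simp
  ultimately show ?thesis by (simp add: hop_coeff_def tau_apply)
qed

lemma weight_tau: "weight p (\<tau> w) = weight p w"
proof -
  have "(\<Sum>q=1..m. w m (col_swap m q) + of_nat q - 1) = (\<Sum>q=1..m. w m q + of_nat q - 1)" for m
  proof -
    have "(\<Sum>q=1..m. w m (col_swap m q)) = (\<Sum>q=1..m. w m q)"
      by (rule sum.reindex_bij_betw[OF bij_col_swap])
    thus ?thesis by (simp add: sum.distrib sum_subtractf)
  qed
  thus ?thesis by (simp add: weight_def tau_apply)
qed

lemma hop_tau: "hop n a (\<tau> v) p c e f (\<tau> z) = hop n a v p c e (\<lambda>y. f (\<tau> y)) z"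
proof -
  have "hop n a (\<tau> v) p c e f (\<tau> z) =
      (\<Sum>q=1..p. - of_int e * hop_coeff p c {} (col_swap p q) (\<tau> (tableau n a v z)) * f (shift (\<tau> z) p (col_swap p q) e))"
    unfolding hop_def tableau_tau by (rule sum.reindex_bij_betw[OF bij_col_swap, symmetric])
  thus ?thesis by (simp add: hop_def hop_coeff_tau tau_shift)
qed

definition tau_lin :: "(zvec \<Rightarrow>\<^sub>0 complex) \<Rightarrow> (zvec \<Rightarrow>\<^sub>0 complex)" where
  "tau_lin = lin_pm (\<lambda>z. Poly_Mapping.single (\<tau> z) 1)"

lemma pairing_tau_lin: "pairing f (tau_lin x) = pairing (\<lambda>z. f (\<tau> z)) x"
  by (simp add: tau_lin_def pairing_lin_pm pairing_single)

lemma tau_lin_diff: "tau_lin (x - y) = tau_lin x - tau_lin y"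
  unfolding tau_lin_def by (rule lin_ext_diff[OF pm.vector_space_axioms])

lemma gt_E_tau: "gt_E n a (\<tau> v) r s (tau_lin x) = tau_lin (gt_E n a v r s x)"
proof (induction "(r - s) + (s - r)" arbitrary: r s x rule: less_induct)
  case less
  consider "r = s" | "s = r + 1" | "r = s + 1" | "r + 1 < s" | "s + 1 < r" by linarith
  then show ?case
  proof cases
    case 1
    show ?thesis unfolding 1
      by (rule pairing_eqI) (simp add: pairing_gt_E_diag pairing_tau_lin tableau_tau weight_tau)
  next
    case 2
    show ?thesis unfolding 2
      by (rule pairing_eqI) (simp only: pairing_gt_E_up pairing_tau_lin hop_tau)
  next
    case 3
    show ?thesis unfolding 3
      by (rule pairing_eqI) (simp only: pairing_gt_E_down pairing_tau_lin hop_tau)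
  next
    case 4
    have lt: "(r - (s-1)) + ((s-1) - r) < (r - s) + (s - r)" "((s-1) - s) + (s - (s-1)) < (r - s) + (s - r)"
      using 4 by auto
    show ?thesis unfolding gt_E_upper[OF 4] commutator_def tau_lin_diff less[OF lt(1)] less[OF lt(2)] ..
  next
    case 5
    have lt: "(r - (s+1)) + ((s+1) - r) < (r - s) + (s - r)" "((s+1) - s) + (s - (s+1)) < (r - s) + (s - r)"
      using 5 by auto
    show ?thesis unfolding gt_E_lower[OF 5] commutator_def tau_lin_diff less[OF lt(1)] less[OF lt(2)] ..
  qed
qed

lemma lookup_tau_lin: "Poly_Mapping.lookup (tau_lin x) (\<tau> z) = Poly_Mapping.lookup x z"
proof -
  have l: "Poly_Mapping.lookup y z = pairing (\<lambda>u. if u = z then 1 else 0) y" for y :: "zvec \<Rightarrow>\<^sub>0 complex" and z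
    by (simp add: pairing_def lin_ext_def if_distrib in_keys_iff cong: if_cong)
  show ?thesis unfolding l pairing_tau_lin tau_inj ..
qed

lemma tau_lin_single: "tau_lin (Poly_Mapping.single z 1) = Poly_Mapping.single (\<tau> z) 1"
  by (simp add: tau_lin_def lin_pm_single_1)

lemma gt_coeff_tau: "gt_coeff n a r s (\<tau> z) (\<tau> z') (\<tau> v) = gt_coeff n a r s z z' v"
  unfolding gt_coeff_def tau_lin_single[symmetric] gt_E_tau lookup_tau_lin ..

section \<open>Restriction to the line through the singular vector\<close>

definition line :: "complex \<Rightarrow> cvec" where
  "line t = set_entry (set_entry vbar k i (vbar k i + t / 2)) k j (vbar k j - t / 2)"

lemma line_apply: "line t p q = vbar p q + (if p = k \<and> q = i then t / 2 else if p = k \<and> q = j then - t / 2 else 0)"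
  using bounds by (simp add: line_def set_entry_def)

lemma line_0 [simp]: "line 0 = vbar"
  by (intro ext) (simp add: line_apply)

lemma delta_line: "\<delta> (line t) = t"
  using bounds by (simp add: line_apply vbar_eq)

lemma tau_line: "\<tau> (line t) = line (- t)"
  using bounds by (intro ext) (auto simp: tau_apply col_swap_def line_apply vbar_eq)

lemma tendsto_line: "((\<lambda>t. line t p q) \<longlongrightarrow> vbar p q) (at 0)"
  unfolding line_apply
  by (cases "p = k \<and> q = i"; cases "p = k \<and> q = j") (auto intro!: tendsto_eq_intros)

lemma eventually_generic_line: "\<forall>\<^sub>F t in at 0. generic n (line t)"
proof -
  define A where "A = {(r, s, u). 1 \<le> s \<and> s < u \<and> u \<le> r \<and> r \<le> n - 1}"
  have "A \<subseteq> {..n} \<times> {..n} \<times> {..n}" by (auto simp: A_def)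
  hence "finite A" by (rule finite_subset) simp
  moreover have "\<forall>\<^sub>F t in at 0. (\<lambda>(r, s, u). line t r s - line t r u \<notin> \<int>) x" if x: "x \<in> A" for x
  proof -
    obtain r s u where rsu: "x = (r, s, u)" "1 \<le> s" "s < u" "u \<le> r" "r \<le> n - 1"
      using x by (auto simp: A_def)
    show ?thesis
    proof (cases "(r, s, u) = (k, i, j)")
      case True
      have "\<forall>\<^sub>F t in at (0::complex). t \<in> ball 0 1 - {0}"
        by (rule eventually_at_in_open) auto
      thus ?thesis
      proof eventually_elim
        case (elim t)
        hence "t \<notin> \<int>" by (auto simp: Ints_def)
        thus ?case using True rsu delta_line by simp
      qed
    next
      case False
      have "((\<lambda>t. line t r s - line t r u) \<longlongrightarrow> vbar r s - vbar r u) (at 0)"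
        by (intro tendsto_diff tendsto_line)
      moreover have "open (- \<int> :: complex set)" by (simp add: open_Compl)
      moreover have "vbar r s - vbar r u \<in> - \<int>"
        using vbar_nonint[OF rsu(2-5) False] by simp
      ultimately have "\<forall>\<^sub>F t in at 0. line t r s - line t r u \<in> - \<int>"
        by (rule topological_tendstoD)
      thus ?thesis by (simp add: rsu(1))
    qed
  qed
  ultimately have "\<forall>\<^sub>F t in at 0. \<forall>x\<in>A. (\<lambda>(r, s, u). line t r s - line t r u \<notin> \<int>) x"
    by (simp add: eventually_ball_finite_distrib)
  thus ?thesis by eventually_elim (auto simp: A_def generic_def)
qed

lemma poly_funs_line:
  assumes "P \<in> poly_funs n"
  shows "\<exists>F. (\<lambda>t. P (line t)) has_fps_expansion F"
  using assms
proof induction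
  case (var q p)
  have "(\<lambda>t. vbar p q + (if p = k \<and> q = i then 1/2 else if p = k \<and> q = j then -1/2 else 0) * t) has_fps_expansion
      fps_const (vbar p q) + fps_const (if p = k \<and> q = i then 1/2 else if p = k \<and> q = j then -1/2 else 0) * fps_X"
    by (intro fps_expansion_intros)
  moreover have "(\<lambda>t. vbar p q + (if p = k \<and> q = i then 1/2 else if p = k \<and> q = j then -1/2 else 0) * t) =
      (\<lambda>t. line t p q)" by (auto simp: line_apply)
  ultimately show ?case by metis
next
  case (add f g)
  then obtain F G where "(\<lambda>t. f (line t)) has_fps_expansion F" "(\<lambda>t. g (line t)) has_fps_expansion G" by blast
  thus ?case using has_fps_expansion_add by blast
next
  case (mult f g)
  then obtain F G where "(\<lambda>t. f (line t)) has_fps_expansion F" "(\<lambda>t. g (line t)) has_fps_expansion G" by blast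
  thus ?case using has_fps_expansion_mult by blast
qed auto

text \<open>
  The chain rule along the line, whose direction \<open>(1/2, -1/2)\<close> in the entries \<open>(k,i)\<close> and \<open>(k,j)\<close> is that
  of the derivation \<open>D\<close>. Partial derivatives appear as derivatives of functions of one variable, in the
  form in which \<open>rat_partial\<close> uses them.
\<close>

lemma poly_funs_deriv:
  assumes "P \<in> poly_funs n"
  shows "\<exists>D1 D2. ((\<lambda>t. P (set_entry vbar k i t)) has_field_derivative D1) (at (vbar k i)) \<and>
    ((\<lambda>t. P (set_entry vbar k j t)) has_field_derivative D2) (at (vbar k j)) \<and>
    ((\<lambda>t. P (line t)) has_field_derivative (D1 - D2) / 2) (at 0)"
  using assms
proof induction
  case (const c)
  show ?case by (intro exI[of _ 0]) simp
next
  case (var q p)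
  let ?D1 = "if p = k \<and> q = i then 1 else 0 :: complex" and ?D2 = "if p = k \<and> q = j then 1 else 0 :: complex"
  have 1: "(\<lambda>t. set_entry vbar k i t p q) = (\<lambda>t. if p = k \<and> q = i then t else vbar p q)"
    and 2: "(\<lambda>t. set_entry vbar k j t p q) = (\<lambda>t. if p = k \<and> q = j then t else vbar p q)"
    by (auto simp: set_entry_def)
  have 3: "(\<lambda>t. line t p q) = (\<lambda>t. vbar p q + t * ((?D1 - ?D2) / 2))"
    using bounds by (auto simp: line_apply)
  show ?case unfolding 1 2 3
    by (rule exI[of _ ?D1], rule exI[of _ ?D2]) (auto intro!: derivative_eq_intros)
next
  case (add f g)
  then obtain D1 D2 D1' D2' where
    *: "((\<lambda>t. f (set_entry vbar k i t)) has_field_derivative D1) (at (vbar k i))"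
    "((\<lambda>t. f (set_entry vbar k j t)) has_field_derivative D2) (at (vbar k j))"
    "((\<lambda>t. f (line t)) has_field_derivative (D1 - D2) / 2) (at 0)"
    "((\<lambda>t. g (set_entry vbar k i t)) has_field_derivative D1') (at (vbar k i))"
    "((\<lambda>t. g (set_entry vbar k j t)) has_field_derivative D2') (at (vbar k j))"
    "((\<lambda>t. g (line t)) has_field_derivative (D1' - D2') / 2) (at 0)" by blast
  have eq: "(D1 + D1' - (D2 + D2')) / 2 = (D1 - D2) / 2 + (D1' - D2') / 2"
    by (simp add: add_divide_distrib diff_divide_distrib)
  show ?case
    by (intro exI[of _ "D1 + D1'"] exI[of _ "D2 + D2'"] conjI, unfold eq) (intro DERIV_add *)+
next
  case (mult f g)
  then obtain D1 D2 D1' D2' where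
    *: "((\<lambda>t. f (set_entry vbar k i t)) has_field_derivative D1) (at (vbar k i))"
    "((\<lambda>t. f (set_entry vbar k j t)) has_field_derivative D2) (at (vbar k j))"
    "((\<lambda>t. f (line t)) has_field_derivative (D1 - D2) / 2) (at 0)"
    "((\<lambda>t. g (set_entry vbar k i t)) has_field_derivative D1') (at (vbar k i))"
    "((\<lambda>t. g (set_entry vbar k j t)) has_field_derivative D2') (at (vbar k j))"
    "((\<lambda>t. g (line t)) has_field_derivative (D1' - D2') / 2) (at 0)" by blast
  have se: "set_entry vbar k i (vbar k i) = vbar" "set_entry vbar k j (vbar k j) = vbar"
    by (auto simp: set_entry_def)
  have eq: "((D1 * g vbar + D1' * f vbar) - (D2 * g vbar + D2' * f vbar)) / 2 =
      (D1 - D2) / 2 * g vbar + (D1' - D2') / 2 * f vbar"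
    by (simp add: add_divide_distrib diff_divide_distrib algebra_simps)
  show ?case
    by (rule exI[of _ "D1 * g vbar + D1' * f vbar"], rule exI[of _ "D2 * g vbar + D2' * f vbar"], unfold eq)
      (intro conjI DERIV_mult[OF *(1,4), unfolded se] DERIV_mult[OF *(2,5), unfolded se]
        DERIV_mult[OF *(3,6), unfolded line_0])
qed

text \<open>
  Whatever quotient of polynomials represents \<open>f\<close>, near \<open>t = 0\<close> it agrees on the punctured line with
  \<open>f\<close> itself. So the value and the derivation of \<open>f\<close> at the singular vector are the first two
  coefficients of one power series that depends on \<open>f\<close> alone.
\<close>

lemma regular_line:
  assumes "regular n vbar f"
  shows "\<exists>F. (\<lambda>t. f (line t)) has_laurent_expansion fps_to_fls F \<and>
    rat_value n vbar f = fps_nth F 0 \<and> D_rat n k i j vbar f = fps_nth F 1"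
proof -
  define g where "g = regular_form n vbar f"
  have "\<exists>g. \<exists>P\<in>poly_funs n. \<exists>Q\<in>poly_funs n. Q vbar \<noteq> 0 \<and> (\<forall>v. generic n v \<longrightarrow> f v * Q v = P v) \<and> g = (\<lambda>v. P v / Q v)"
    using assms unfolding regular_def by blast
  from someI_ex[OF this] obtain P Q where P: "P \<in> poly_funs n" and Q: "Q \<in> poly_funs n"
    and Q0: "Q vbar \<noteq> 0" and eq: "\<And>v. generic n v \<Longrightarrow> f v * Q v = P v" and g: "g = (\<lambda>v. P v / Q v)"
    unfolding g_def regular_form_def by blast
  obtain FP FQ where F: "(\<lambda>t. P (line t)) has_fps_expansion FP" "(\<lambda>t. Q (line t)) has_fps_expansion FQ"
    using poly_funs_line P Q by blast
  have FQ0: "fps_nth FQ 0 \<noteq> 0"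
    using has_fps_expansion_imp_0_eq_fps_nth_0[OF F(2)] Q0 by simp
  define G where "G = FP / FQ"
  have G: "(\<lambda>t. g (line t)) has_fps_expansion G"
    unfolding g G_def by (rule has_fps_expansion_divide'[OF F FQ0])
  obtain D1 D2 where D:
    "((\<lambda>t. P (set_entry vbar k i t)) has_field_derivative D1) (at (vbar k i))"
    "((\<lambda>t. P (set_entry vbar k j t)) has_field_derivative D2) (at (vbar k j))"
    "((\<lambda>t. P (line t)) has_field_derivative (D1 - D2) / 2) (at 0)" using poly_funs_deriv[OF P] by blast
  obtain D1' D2' where D':
    "((\<lambda>t. Q (set_entry vbar k i t)) has_field_derivative D1') (at (vbar k i))"
    "((\<lambda>t. Q (set_entry vbar k j t)) has_field_derivative D2') (at (vbar k j))"
    "((\<lambda>t. Q (line t)) has_field_derivative (D1' - D2') / 2) (at 0)" using poly_funs_deriv[OF Q] by blast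
  have se: "set_entry vbar k i (vbar k i) = vbar" "set_entry vbar k j (vbar k j) = vbar"
    by (auto simp: set_entry_def)
  have d1: "deriv (\<lambda>t. g (set_entry vbar k i t)) (vbar k i) = (D1 * Q vbar - P vbar * D1') / (Q vbar * Q vbar)"
    using DERIV_divide[OF D(1) D'(1)] Q0 unfolding g se by (intro DERIV_imp_deriv) auto
  have d2: "deriv (\<lambda>t. g (set_entry vbar k j t)) (vbar k j) = (D2 * Q vbar - P vbar * D2') / (Q vbar * Q vbar)"
    using DERIV_divide[OF D(2) D'(2)] Q0 unfolding g se by (intro DERIV_imp_deriv) auto
  have d3: "deriv (\<lambda>t. g (line t)) 0 = ((D1 - D2) / 2 * Q vbar - P vbar * ((D1' - D2') / 2)) / (Q vbar * Q vbar)"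
    using DERIV_divide[OF D(3) D'(3)] Q0 unfolding g line_0 by (intro DERIV_imp_deriv) auto
  have "D_rat n k i j vbar f = deriv (\<lambda>t. g (line t)) 0"
    unfolding D_rat_def rat_partial_def g_def[symmetric] d1 d2 d3 diff_divide_distrib[symmetric]
    by (simp add: add_divide_distrib diff_divide_distrib algebra_simps)
  also have "\<dots> = fps_nth (fps_deriv G) 0"
    by (rule has_fps_expansion_imp_0_eq_fps_nth_0[OF has_fps_expansion_deriv[OF G]])
  also have "\<dots> = fps_nth G 1" by simp
  finally have D_rat: "D_rat n k i j vbar f = fps_nth G 1" .
  have val: "rat_value n vbar f = fps_nth G 0"
    using has_fps_expansion_imp_0_eq_fps_nth_0[OF G] by (simp add: rat_value_def g_def)
  have "\<forall>\<^sub>F t in at 0. Q (line t) \<noteq> 0"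
    using tendsto_imp_eventually_ne[OF isContD[OF DERIV_isCont[OF D'(3)]]] Q0 by simp
  hence gf: "\<forall>\<^sub>F t in at 0. g (line t) = f (line t)"
    using eventually_generic_line by eventually_elim (use eq in \<open>auto simp: g field_simps\<close>)
  have "(\<lambda>t. f (line t)) has_laurent_expansion fps_to_fls G"
    by (rule has_laurent_expansion_transfer[OF has_laurent_expansion_fps[OF G] gf])
  thus ?thesis using D_rat val by blast
qed

section \<open>Laurent expansions of the coefficients\<close>

text \<open>
  The Laurent series in \<open>t\<close> of the coefficient of \<open>T(v\<^sub>t + z')\<close> in \<open>E\<^sub>r\<^sub>s T(v\<^sub>t + z)\<close>.
\<close>

definition gt_fls :: "nat \<Rightarrow> nat \<Rightarrow> zvec \<Rightarrow> zvec \<Rightarrow> complex fls" where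
  "gt_fls r s z z' = (SOME F. (\<lambda>t. gt_coeff n a r s z z' (line t)) has_laurent_expansion F)"

text \<open>
  The substitution of \<open>-t\<close> for \<open>t\<close>.
\<close>

definition flip :: "complex fls \<Rightarrow> complex fls" where
  "flip F = fls_compose_fps F (fps_const (-1) * fps_X)"

lemma flip_nth: "fls_nth (flip F) m = fls_nth F m * (-1) powi m"
  unfolding flip_def by (rule fls_nth_fls_compose_fps_linear) simp

lemma flip_mult: "flip (F * G) = flip F * flip G"
  unfolding flip_def by (rule fls_compose_fps_mult) (auto simp: fps_eq_iff)

lemma flip_sum: "flip (\<Sum>x\<in>A. F x) = (\<Sum>x\<in>A. flip (F x))"
proof (rule fls_eqI)
  fix m show "fls_nth (flip (\<Sum>x\<in>A. F x)) m = fls_nth (\<Sum>x\<in>A. flip (F x)) m"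
    by (simp add: flip_nth fls_nth_sum sum_distrib_right)
qed

context
  fixes r s :: nat
  assumes rs: "1 \<le> r" "r \<le> n" "1 \<le> s" "s \<le> n"
begin

lemma gt_coeff_line_pole:
  "\<exists>F. (\<lambda>t. gt_coeff n a r s z z' (line t)) has_laurent_expansion fls_shift 1 (fps_to_fls F) \<and>
    rat_value n vbar (\<lambda>v. \<delta> v * gt_coeff n a r s z z' v) = fps_nth F 0 \<and>
    D_rat n k i j vbar (\<lambda>v. \<delta> v * gt_coeff n a r s z z' v) = fps_nth F 1"
proof -
  obtain F where F: "(\<lambda>t. t * gt_coeff n a r s z z' (line t)) has_laurent_expansion fps_to_fls F"
    "rat_value n vbar (\<lambda>v. \<delta> v * gt_coeff n a r s z z' v) = fps_nth F 0"
    "D_rat n k i j vbar (\<lambda>v. \<delta> v * gt_coeff n a r s z z' v) = fps_nth F 1"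
    using regular_line[OF conjunct2[OF regular_gt_coeff[OF rs]]] unfolding delta_line by blast
  have "(\<lambda>t. t * gt_coeff n a r s z z' (line t) * t powi (-1)) has_laurent_expansion fls_shift 1 (fps_to_fls F)"
    by (rule has_laurent_expansion_shift'[OF F(1)])
  moreover have "\<forall>\<^sub>F t in at 0. t * gt_coeff n a r s z z' (line t) * t powi (-1) = gt_coeff n a r s z z' (line t)"
    by (auto simp: eventually_at_filter power_int_minus)
  ultimately have "(\<lambda>t. gt_coeff n a r s z z' (line t)) has_laurent_expansion fls_shift 1 (fps_to_fls F)"
    by (rule has_laurent_expansion_transfer)
  thus ?thesis using F(2,3) by blast
qed

lemma gt_fls_expansion: "(\<lambda>t. gt_coeff n a r s z z' (line t)) has_laurent_expansion gt_fls r s z z'"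
  unfolding gt_fls_def by (rule someI_ex) (use gt_coeff_line_pole in blast)

lemma gt_fls_pole:
  "m < -1 \<Longrightarrow> fls_nth (gt_fls r s z z') m = 0"
  "rat_value n vbar (\<lambda>v. \<delta> v * gt_coeff n a r s z z' v) = fls_nth (gt_fls r s z z') (-1)"
  "D_rat n k i j vbar (\<lambda>v. \<delta> v * gt_coeff n a r s z z' v) = fls_nth (gt_fls r s z z') 0"
proof -
  obtain F where F: "(\<lambda>t. gt_coeff n a r s z z' (line t)) has_laurent_expansion fls_shift 1 (fps_to_fls F)"
    "rat_value n vbar (\<lambda>v. \<delta> v * gt_coeff n a r s z z' v) = fps_nth F 0"
    "D_rat n k i j vbar (\<lambda>v. \<delta> v * gt_coeff n a r s z z' v) = fps_nth F 1"
    using gt_coeff_line_pole by blast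
  have L: "gt_fls r s z z' = fls_shift 1 (fps_to_fls F)"
    using has_laurent_expansion_unique[OF gt_fls_expansion F(1)] .
  show "m < -1 \<Longrightarrow> fls_nth (gt_fls r s z z') m = 0"
    "rat_value n vbar (\<lambda>v. \<delta> v * gt_coeff n a r s z z' v) = fls_nth (gt_fls r s z z') (-1)"
    "D_rat n k i j vbar (\<lambda>v. \<delta> v * gt_coeff n a r s z z' v) = fls_nth (gt_fls r s z z') 0"
    unfolding L using F(2,3) by auto
qed

lemma gt_fls_regular:
  assumes "\<tau> z \<noteq> z"
  shows "m < 0 \<Longrightarrow> fls_nth (gt_fls r s z z') m = 0"
    "rat_value n vbar (gt_coeff n a r s z z') = fls_nth (gt_fls r s z z') 0"
    "D_rat n k i j vbar (gt_coeff n a r s z z') = fls_nth (gt_fls r s z z') 1"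
proof -
  have "regular n vbar (gt_coeff n a r s z z')"
    using regular_gt_coeff[OF rs] assms tau_fixed_iff by blast
  then obtain F where F: "(\<lambda>t. gt_coeff n a r s z z' (line t)) has_laurent_expansion fps_to_fls F"
    "rat_value n vbar (gt_coeff n a r s z z') = fps_nth F 0"
    "D_rat n k i j vbar (gt_coeff n a r s z z') = fps_nth F 1"
    using regular_line by blast
  have L: "gt_fls r s z z' = fps_to_fls F"
    using has_laurent_expansion_unique[OF gt_fls_expansion F(1)] .
  show "m < 0 \<Longrightarrow> fls_nth (gt_fls r s z z') m = 0"
    "rat_value n vbar (gt_coeff n a r s z z') = fls_nth (gt_fls r s z z') 0"
    "D_rat n k i j vbar (gt_coeff n a r s z z') = fls_nth (gt_fls r s z z') 1"
    unfolding L using F(2,3) by auto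
qed

lemma gt_fls_eq_0: "(\<And>v. generic n v \<Longrightarrow> gt_coeff n a r s z z' v = 0) \<Longrightarrow> gt_fls r s z z' = 0"
proof -
  assume *: "\<And>v. generic n v \<Longrightarrow> gt_coeff n a r s z z' v = 0"
  have "\<forall>\<^sub>F t in at 0. gt_coeff n a r s z z' (line t) = 0"
    using eventually_generic_line by eventually_elim (rule *)
  hence "(\<lambda>_. 0) has_laurent_expansion gt_fls r s z z'"
    by (rule has_laurent_expansion_transfer[OF gt_fls_expansion])
  thus ?thesis by (rule zero_has_laurent_expansion_imp_eq_0)
qed

lemma gt_fls_reach: "z' \<notin> reach r s z \<Longrightarrow> gt_fls r s z z' = 0"
  by (rule gt_fls_eq_0) (rule gt_coeff_reach)

lemma gt_fls_tau: "gt_fls r s (\<tau> z) (\<tau> z') = flip (gt_fls r s z z')"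
proof -
  have "((\<lambda>t. gt_coeff n a r s z z' (line t)) \<circ> (\<lambda>t. -1 * t)) has_laurent_expansion flip (gt_fls r s z z')"
    unfolding flip_def
  proof (rule has_laurent_expansion_compose[OF gt_fls_expansion])
    show "(\<lambda>t. -1 * t) has_laurent_expansion fps_to_fls (fps_const (-1) * fps_X)"
      by (intro has_laurent_expansion_fps fps_expansion_intros)
  qed (auto simp: fps_eq_iff)
  moreover have "gt_coeff n a r s z z' (line (- t)) = gt_coeff n a r s (\<tau> z) (\<tau> z') (line t)" for t
    using gt_coeff_tau[of r s z z' "line (- t)"] by (simp add: tau_line)
  ultimately have "(\<lambda>t. gt_coeff n a r s (\<tau> z) (\<tau> z') (line t)) has_laurent_expansion flip (gt_fls r s z z')"
    by (simp add: o_def)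
  thus ?thesis using has_laurent_expansion_unique[OF gt_fls_expansion] by blast
qed

end

text \<open>
  The relations hold at \<open>v\<^sub>t\<close> for all small \<open>t \<noteq> 0\<close>, and Laurent expansions are unique.
\<close>

lemma gt_fls_relations:
  assumes rs: "1 \<le> r" "r \<le> n" "1 \<le> s" "s \<le> n" and tu: "1 \<le> t" "t \<le> n" "1 \<le> u" "u \<le> n"
  shows "(\<Sum>y\<in>reach t u z. gt_fls t u z y * gt_fls r s y z') - (\<Sum>y\<in>reach r s z. gt_fls r s z y * gt_fls t u y z') =
    (if s = t then gt_fls r u z z' else 0) - (if u = r then gt_fls t s z z' else 0)"
proof (rule has_laurent_expansion_unique)
  let ?f = "\<lambda>r s y z t. gt_coeff n a r s y z (line t)"
  let ?g = "\<lambda>x. (\<Sum>y\<in>reach t u z. ?f t u z y x * ?f r s y z' x) - (\<Sum>y\<in>reach r s z. ?f r s z y x * ?f t u y z' x)"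
  let ?h = "\<lambda>x. (if s = t then ?f r u z z' x else 0) - (if u = r then ?f t s z z' x else 0)"
  show "?g has_laurent_expansion
      (\<Sum>y\<in>reach t u z. gt_fls t u z y * gt_fls r s y z') - (\<Sum>y\<in>reach r s z. gt_fls r s z y * gt_fls t u y z')"
    by (intro laurent_expansion_intros gt_fls_expansion assms)
  have "?h has_laurent_expansion (if s = t then gt_fls r u z z' else 0) - (if u = r then gt_fls t s z z' else 0)"
    by (cases "s = t"; cases "u = r") (use assms in \<open>auto intro!: laurent_expansion_intros gt_fls_expansion\<close>)
  moreover have "\<forall>\<^sub>F x in at 0. ?h x = ?g x"
    using eventually_generic_line
  proof eventually_elim
    case (elim x)
    interpret gt_generic n a "line x" by unfold_locales fact
    have "Poly_Mapping.lookup (gt_E n a (line x) r s (gt_E n a (line x) t u (Poly_Mapping.single z 1)) -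
        gt_E n a (line x) t u (gt_E n a (line x) r s (Poly_Mapping.single z 1))) z' =
      Poly_Mapping.lookup ((if s = t then gt_E n a (line x) r u (Poly_Mapping.single z 1) else 0) -
        (if u = r then gt_E n a (line x) t s (Poly_Mapping.single z 1) else 0)) z'"
      unfolding gt_E_relations[OF rs tu] ..
    thus ?case by (auto simp: lookup_minus lookup_gt_E_gt_E gt_coeff_def split: if_splits)
  qed
  ultimately show "?g has_laurent_expansion (if s = t then gt_fls r u z z' else 0) - (if u = r then gt_fls t s z z' else 0)"
    by (rule has_laurent_expansion_transfer)
qed

end

section \<open>Modules over gl(n) from bracket relations\<close>

lemma gl_moduleI:
  fixes sc :: "complex \<Rightarrow> 'v \<Rightarrow> 'v::ab_group_add" and R :: "nat \<Rightarrow> nat \<Rightarrow> 'v \<Rightarrow> 'v"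
  assumes vector_space_sc: "vector_space sc"
    and lin: "\<And>r s. r < n \<Longrightarrow> s < n \<Longrightarrow> Vector_Spaces.linear sc sc (R r s)"
    and rel: "\<And>r s t u x. r < n \<Longrightarrow> s < n \<Longrightarrow> t < n \<Longrightarrow> u < n \<Longrightarrow>
      R r s (R t u x) - R t u (R r s x) = (if s = t then R r u x else 0) - (if u = r then R t s x else 0)"
  shows "gl_module n sc (\<lambda>A x. \<Sum>r<n. \<Sum>s<n. sc (A $$ (r, s)) (R r s x))"
proof -
  interpret V: vector_space sc by fact
  let ?\<rho> = "\<lambda>A x. \<Sum>r<n. \<Sum>s<n. sc (A $$ (r, s)) (R r s x)"
  have add: "R r s (x + y) = R r s x + R r s y" and scale: "R r s (sc c x) = sc c (R r s x)"
    if "r < n" "s < n" for r s x y c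
    using lin[OF that] by (simp_all add: Vector_Spaces.linear_iff)
  have zero: "R r s 0 = 0" if "r < n" "s < n" for r s
    using scale[OF that, of 0 0] by simp
  have sum: "R r s (\<Sum>i\<in>I. f i) = (\<Sum>i\<in>I. R r s (f i))" if "r < n" "s < n" for r s f and I :: "nat set"
    by (induction I rule: infinite_finite_induct) (simp_all add: zero[OF that] add[OF that])
  have "?\<rho> (A * B - B * A) x = ?\<rho> A (?\<rho> B x) - ?\<rho> B (?\<rho> A x)"
    if A: "A \<in> carrier_mat n n" and B: "B \<in> carrier_mat n n" for A B x
  proof -
    have mult: "(A * B) $$ (r, u) = (\<Sum>s<n. A $$ (r, s) * B $$ (s, u))"
      if "A \<in> carrier_mat n n" "B \<in> carrier_mat n n" "r < n" "u < n" for A B :: "complex mat" and r u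
      using that by (simp add: scalar_prod_def lessThan_atLeast0)
    have comp: "?\<rho> A (?\<rho> B x) = (\<Sum>r<n. \<Sum>s<n. \<Sum>t<n. \<Sum>u<n. sc (A $$ (r, s) * B $$ (t, u)) (R r s (R t u x)))"
      for A B
      by (intro sum.cong refl) (simp add: sum scale V.scale_sum_right)
    have "?\<rho> B (?\<rho> A x) = (\<Sum>t<n. \<Sum>u<n. \<Sum>r<n. \<Sum>s<n. sc (A $$ (r, s) * B $$ (t, u)) (R t u (R r s x)))"
      unfolding comp by (simp add: mult.commute)
    also have "\<dots> = (\<Sum>r<n. \<Sum>s<n. \<Sum>t<n. \<Sum>u<n. sc (A $$ (r, s) * B $$ (t, u)) (R t u (R r s x)))"
    proof -
      have "(\<Sum>t<n. \<Sum>u<n. \<Sum>r<n. \<Sum>s<n. g r s t u) = (\<Sum>r<n. \<Sum>s<n. \<Sum>t<n. \<Sum>u<n. g r s t u)"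
        for g :: "nat \<Rightarrow> nat \<Rightarrow> nat \<Rightarrow> nat \<Rightarrow> 'v"
      proof -
        have "(\<Sum>t<n. \<Sum>u<n. \<Sum>r<n. \<Sum>s<n. g r s t u) = (\<Sum>t<n. \<Sum>r<n. \<Sum>s<n. \<Sum>u<n. g r s t u)"
          by (intro sum.cong refl sum_swap3[symmetric])
        also have "\<dots> = (\<Sum>r<n. \<Sum>s<n. \<Sum>t<n. \<Sum>u<n. g r s t u)" by (rule sum_swap3[symmetric])
        finally show ?thesis .
      qed
      thus ?thesis .
    qed
    finally have "?\<rho> A (?\<rho> B x) - ?\<rho> B (?\<rho> A x) =
       (\<Sum>r<n. \<Sum>s<n. \<Sum>t<n. \<Sum>u<n. sc (A $$ (r, s) * B $$ (t, u)) (R r s (R t u x) - R t u (R r s x)))"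
      unfolding comp by (simp only: sum_subtractf V.scale_right_diff_distrib)
    also have "\<dots> = (\<Sum>r<n. \<Sum>s<n. \<Sum>t<n. \<Sum>u<n.
        (if s = t then sc (A $$ (r, s) * B $$ (t, u)) (R r u x) else 0) -
        (if u = r then sc (A $$ (r, s) * B $$ (t, u)) (R t s x) else 0))"
      by (intro sum.cong refl) (auto simp: rel V.scale_right_diff_distrib)
    also have "\<dots> = (\<Sum>r<n. \<Sum>s<n. \<Sum>u<n. sc (A $$ (r, s) * B $$ (s, u)) (R r u x)) -
        (\<Sum>r<n. \<Sum>s<n. \<Sum>t<n. sc (A $$ (r, s) * B $$ (t, r)) (R t s x))"
    proof -
      have "(\<Sum>t<n. \<Sum>u<n. if s = t then sc (A $$ (r, s) * B $$ (t, u)) (R r u x) else 0) =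
          (\<Sum>u<n. sc (A $$ (r, s) * B $$ (s, u)) (R r u x))" if "s < n" for r s
        by (subst sum.swap) (use that in simp)
      thus ?thesis unfolding sum_subtractf by simp
    qed
    finally have diff: "?\<rho> A (?\<rho> B x) - ?\<rho> B (?\<rho> A x) =
        (\<Sum>r<n. \<Sum>s<n. \<Sum>u<n. sc (A $$ (r, s) * B $$ (s, u)) (R r u x)) -
        (\<Sum>r<n. \<Sum>s<n. \<Sum>t<n. sc (A $$ (r, s) * B $$ (t, r)) (R t s x))" .
    have AB: "(\<Sum>r<n. \<Sum>s<n. \<Sum>u<n. sc (A $$ (r, s) * B $$ (s, u)) (R r u x)) = ?\<rho> (A * B) x"
    proof (rule sum.cong, rule refl)
      fix r assume r: "r \<in> {..<n}"
      have "(\<Sum>s<n. \<Sum>u<n. sc (A $$ (r, s) * B $$ (s, u)) (R r u x)) =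
          (\<Sum>u<n. \<Sum>s<n. sc (A $$ (r, s) * B $$ (s, u)) (R r u x))" by (rule sum.swap)
      also have "\<dots> = (\<Sum>u<n. sc ((A * B) $$ (r, u)) (R r u x))"
        using r by (intro sum.cong refl) (simp add: mult[OF A B] V.scale_sum_left)
      finally show "(\<Sum>s<n. \<Sum>u<n. sc (A $$ (r, s) * B $$ (s, u)) (R r u x)) =
          (\<Sum>u<n. sc ((A * B) $$ (r, u)) (R r u x))" .
    qed
    have BA: "(\<Sum>r<n. \<Sum>s<n. \<Sum>t<n. sc (A $$ (r, s) * B $$ (t, r)) (R t s x)) = ?\<rho> (B * A) x"
    proof -
      have "(\<Sum>r<n. \<Sum>s<n. \<Sum>t<n. sc (A $$ (r, s) * B $$ (t, r)) (R t s x)) =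
          (\<Sum>t<n. \<Sum>r<n. \<Sum>s<n. sc (A $$ (r, s) * B $$ (t, r)) (R t s x))" by (rule sum_swap3)
      also have "\<dots> = (\<Sum>t<n. \<Sum>s<n. \<Sum>r<n. sc (A $$ (r, s) * B $$ (t, r)) (R t s x))"
        by (intro sum.cong refl sum.swap)
      also have "\<dots> = ?\<rho> (B * A) x"
        by (intro sum.cong refl) (simp add: mult[OF B A] V.scale_sum_left mult.commute)
      finally show ?thesis .
    qed
    have "?\<rho> A (?\<rho> B x) - ?\<rho> B (?\<rho> A x) = ?\<rho> (A * B) x - ?\<rho> (B * A) x"
      unfolding diff AB BA ..
    also have "\<dots> = ?\<rho> (A * B - B * A) x"
      unfolding sum_subtractf[symmetric] V.scale_left_diff_distrib[symmetric]
      by (intro sum.cong refl) (use A B in simp)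
    finally show ?thesis ..
  qed
  moreover have "Vector_Spaces.linear sc sc (?\<rho> A)" for A
    by (simp add: Vector_Spaces.linear_iff vector_space_sc add scale sum.distrib V.scale_right_distrib V.scale_sum_right mult.commute)
  moreover have "?\<rho> (A + B) x = ?\<rho> A x + ?\<rho> B x" if "A \<in> carrier_mat n n" "B \<in> carrier_mat n n" for A B x
    unfolding sum.distrib[symmetric] V.scale_left_distrib[symmetric]
    by (intro sum.cong refl) (use that in simp)
  moreover have "?\<rho> (c \<cdot>\<^sub>m A) x = sc c (?\<rho> A x)" if "A \<in> carrier_mat n n" for c A x
    unfolding V.scale_sum_right V.scale_scale
    by (intro sum.cong refl) (use that in simp)
  ultimately show ?thesis unfolding gl_module_def using vector_space_sc by blast
qed

section \<open>The space of tableaux and derivative tableaux\<close>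

locale singular_module = singular_data +
  fixes sc :: "complex \<Rightarrow> 'v \<Rightarrow> 'v::ab_group_add" and T DT :: "zvec \<Rightarrow> 'v"
  assumes space: "tableau_space n k i j sc T DT"
begin

sublocale V: vector_space sc
  using space by (simp add: tableau_space_def)

abbreviation \<phi> where "\<phi> \<equiv> lin_ext sc (case_symb T DT)"

lemmas vector_space_sc = V.vector_space_axioms

lemma kernel: "Poly_Mapping.keys f \<subseteq> symbols n \<Longrightarrow> \<phi> f = 0 \<longleftrightarrow> f \<in> pm_span (relators n k i j)"
  using space by (simp add: tableau_space_def)

lemma surj: "\<exists>f. Poly_Mapping.keys f \<subseteq> symbols n \<and> \<phi> f = x"
proof -
  have "x \<in> \<phi> ` {f. Poly_Mapping.keys f \<subseteq> symbols n}"
    using space by (simp add: tableau_space_def)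
  thus ?thesis by blast
qed

lemma relator_Tab: "z \<in> zlattice n \<Longrightarrow>
    Poly_Mapping.single (Tab z) 1 - Poly_Mapping.single (Tab (\<tau> z)) 1 \<in> relators n k i j"
  and relator_DTab: "z \<in> zlattice n \<Longrightarrow>
    Poly_Mapping.single (DTab z) 1 + Poly_Mapping.single (DTab (\<tau> z)) 1 \<in> relators n k i j"
  by (auto simp: relators_def)

lemma keys_relator:
  assumes "z \<in> zlattice n"
  shows "Poly_Mapping.keys (Poly_Mapping.single (Tab z) 1 - Poly_Mapping.single (Tab (\<tau> z)) (1::complex)) \<subseteq> symbols n"
    and "Poly_Mapping.keys (Poly_Mapping.single (DTab z) 1 + Poly_Mapping.single (DTab (\<tau> z)) (1::complex)) \<subseteq> symbols n"
  using assms tau_zlattice[OF assms]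
  by (auto simp: in_keys_iff lookup_minus lookup_add lookup_single when_def symbols_def split: if_splits)

lemma T_tau: "z \<in> zlattice n \<Longrightarrow> T (\<tau> z) = T z"
  using kernel[OF keys_relator(1)] pm.span_base[OF relator_Tab]
  by (simp add: lin_ext_diff[OF vector_space_sc] lin_ext_single[OF vector_space_sc])

lemma DT_tau: "z \<in> zlattice n \<Longrightarrow> DT (\<tau> z) = - DT z"
  using kernel[OF keys_relator(2)] pm.span_base[OF relator_DTab]
  by (simp add: lin_ext_add[OF vector_space_sc] lin_ext_single[OF vector_space_sc] eq_neg_iff_add_eq_0 add.commute)

text \<open>
  The kernel of the presentation is spanned by the relators, so values on the symbols that respect the
  two families of relators extend linearly.
\<close>

lemma linear_extension:
  assumes "\<And>z. z \<in> zlattice n \<Longrightarrow> g (\<tau> z) = g z" and "\<And>z. z \<in> zlattice n \<Longrightarrow> h (\<tau> z) = - h z"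
  shows "\<exists>\<rho>. Vector_Spaces.linear sc sc \<rho> \<and> (\<forall>z\<in>zlattice n. \<rho> (T z) = g z \<and> \<rho> (DT z) = h z)"
proof -
  define \<gamma> where "\<gamma> = lin_ext sc (case_symb g h)"
  have add: "\<gamma> (f + f') = \<gamma> f + \<gamma> f'" and diff: "\<gamma> (f - f') = \<gamma> f - \<gamma> f'"
    and scale: "\<gamma> (pm_scale c f) = sc c (\<gamma> f)" for f f' c
    by (simp_all add: \<gamma>_def lin_ext_add[OF vector_space_sc] lin_ext_diff[OF vector_space_sc] lin_ext_scale[OF vector_space_sc])
  have "pm_span (relators n k i j) \<subseteq> {f. \<gamma> f = 0}"
  proof (rule pm.span_minimal)
    show "relators n k i j \<subseteq> {f. \<gamma> f = 0}"
      using assms by (auto simp: relators_def \<gamma>_def lin_ext_add[OF vector_space_sc] lin_ext_diff[OF vector_space_sc] lin_ext_single[OF vector_space_sc])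
    show "pm.subspace {f. \<gamma> f = 0}"
      by (simp add: pm.subspace_def add scale) (simp add: \<gamma>_def)
  qed
  hence ker: "\<gamma> f = 0" if "Poly_Mapping.keys f \<subseteq> symbols n" "\<phi> f = 0" for f
    using kernel that by blast
  define \<rho> where "\<rho> x = \<gamma> (SOME f. Poly_Mapping.keys f \<subseteq> symbols n \<and> \<phi> f = x)" for x
  have \<rho>: "\<rho> (\<phi> f) = \<gamma> f" if f: "Poly_Mapping.keys f \<subseteq> symbols n" for f
  proof -
    define f' where "f' = (SOME f'. Poly_Mapping.keys f' \<subseteq> symbols n \<and> \<phi> f' = \<phi> f)"
    have f': "Poly_Mapping.keys f' \<subseteq> symbols n \<and> \<phi> f' = \<phi> f"
      unfolding f'_def by (rule someI[of _ f]) (use f in simp)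
    hence "\<gamma> (f' - f) = 0"
      by (intro ker keys_minus_subset) (use f in \<open>simp_all add: lin_ext_diff[OF vector_space_sc]\<close>)
    thus ?thesis by (simp add: \<rho>_def f'_def[symmetric] diff)
  qed
  have "\<rho> (x + y) = \<rho> x + \<rho> y" for x y
  proof -
    obtain f f' where f: "Poly_Mapping.keys f \<subseteq> symbols n" "\<phi> f = x" "Poly_Mapping.keys f' \<subseteq> symbols n" "\<phi> f' = y"
      using surj by meson
    have "Poly_Mapping.keys (f + f') \<subseteq> symbols n" using f keys_add[of f f'] by blast
    from \<rho>[OF this] show ?thesis using \<rho>[OF f(1)] \<rho>[OF f(3)] f by (simp add: add lin_ext_add[OF vector_space_sc])
  qed
  moreover have "\<rho> (sc c x) = sc c (\<rho> x)" for c x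
  proof -
    obtain f where f: "Poly_Mapping.keys f \<subseteq> symbols n" "\<phi> f = x" using surj by meson
    have "Poly_Mapping.keys (pm_scale c f) \<subseteq> symbols n" using f by (auto simp: in_keys_iff)
    from \<rho>[OF this] show ?thesis using \<rho>[OF f(1)] f by (simp add: scale lin_ext_scale[OF vector_space_sc])
  qed
  moreover have "\<rho> (T z) = g z" "\<rho> (DT z) = h z" if "z \<in> zlattice n" for z
  proof -
    have "Poly_Mapping.keys (Poly_Mapping.single (Tab z) (1::complex)) \<subseteq> symbols n"
      "Poly_Mapping.keys (Poly_Mapping.single (DTab z) (1::complex)) \<subseteq> symbols n"
      using that by (auto simp: symbols_def)
    from this[THEN \<rho>] show "\<rho> (T z) = g z" "\<rho> (DT z) = h z"
      by (simp_all add: \<gamma>_def lin_ext_single[OF vector_space_sc])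
  qed
  ultimately show ?thesis using vector_space_sc
    by (intro exI[of _ \<rho>]) (simp add: Vector_Spaces.linear_iff)
qed

lemma linear_eqI:
  assumes "Vector_Spaces.linear sc sc A" "Vector_Spaces.linear sc sc B"
    and "\<And>z. z \<in> zlattice n \<Longrightarrow> A (T z) = B (T z)" "\<And>z. z \<in> zlattice n \<Longrightarrow> A (DT z) = B (DT z)"
  shows "A x = B x"
proof -
  obtain f where f: "Poly_Mapping.keys f \<subseteq> symbols n" "\<phi> f = x" using surj by meson
  have exp: "C x = (\<Sum>y\<in>Poly_Mapping.keys f. sc (Poly_Mapping.lookup f y) (C (case_symb T DT y)))"
    if "Vector_Spaces.linear sc sc C" for C
  proof -
    interpret C: Vector_Spaces.linear sc sc C by fact
    show ?thesis unfolding f(2)[symmetric] lin_ext_def by (simp add: C.sum C.scale)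
  qed
  show ?thesis unfolding exp[OF assms(1)] exp[OF assms(2)]
  proof (intro sum.cong refl)
    fix y assume "y \<in> Poly_Mapping.keys f"
    hence "y \<in> symbols n" using f by blast
    thus "sc (Poly_Mapping.lookup f y) (A (case_symb T DT y)) = sc (Poly_Mapping.lookup f y) (B (case_symb T DT y))"
      using assms(3,4) by (auto simp: symbols_def)
  qed
qed

section \<open>Evaluation of Laurent series at the singular vector\<close>

definition supp :: "(zvec \<Rightarrow> complex fls) \<Rightarrow> zvec set" where
  "supp m = {z. m z \<noteq> 0}"

text \<open>
  The contribution of \<open>F T(v\<^sub>t + z)\<close>. For regular \<open>f\<close> it sends \<open>f/t\<close> to
  \<open>f'(0) T(z) + f(0) DT(z)\<close>, the value of the derivation on \<open>f T(v + z)\<close>.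
\<close>

definition ev_term :: "complex fls \<Rightarrow> zvec \<Rightarrow> 'v" where
  "ev_term F z = sc (fls_nth F 0) (T z) + sc (fls_nth F (-1)) (DT z)"

definition ev :: "(zvec \<Rightarrow> complex fls) \<Rightarrow> 'v" where
  "ev m = (\<Sum>z\<in>supp m. ev_term (m z) z)"

lemma ev_term_0 [simp]: "ev_term 0 z = 0"
  and ev_term_add: "ev_term (F + G) z = ev_term F z + ev_term G z"
  and ev_term_diff: "ev_term (F - G) z = ev_term F z - ev_term G z"
  and ev_term_uminus: "ev_term (- F) z = - ev_term F z"
  by (simp_all add: ev_term_def V.scale_left_distrib V.scale_left_diff_distrib)

lemma ev_term_sum: "ev_term (\<Sum>i\<in>I. F i) z = (\<Sum>i\<in>I. ev_term (F i) z)"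
  by (induction I rule: infinite_finite_induct) (simp_all add: ev_term_add)

lemma ev_superset:
  assumes "finite S" "supp m \<subseteq> S"
  shows "ev m = (\<Sum>z\<in>S. ev_term (m z) z)"
  unfolding ev_def by (rule sum.mono_neutral_left) (use assms in \<open>auto simp: supp_def\<close>)

lemma ev_add:
  assumes "finite (supp m)" "finite (supp m')"
  shows "ev (\<lambda>z. m z + m' z) = ev m + ev m'"
proof -
  let ?S = "supp m \<union> supp m'"
  have "finite ?S" "supp m \<subseteq> ?S" "supp m' \<subseteq> ?S" "supp (\<lambda>z. m z + m' z) \<subseteq> ?S"
    using assms by (auto simp: supp_def)
  thus ?thesis by (simp add: ev_superset[of ?S] ev_term_add sum.distrib)
qed

lemma ev_diff:
  assumes "finite (supp m)" "finite (supp m')"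
  shows "ev (\<lambda>z. m z - m' z) = ev m - ev m'"
proof -
  let ?S = "supp m \<union> supp m'"
  have "finite ?S" "supp m \<subseteq> ?S" "supp m' \<subseteq> ?S" "supp (\<lambda>z. m z - m' z) \<subseteq> ?S"
    using assms by (auto simp: supp_def)
  thus ?thesis by (simp add: ev_superset[of ?S] ev_term_diff sum_subtractf)
qed

lemma ev_uminus: "ev (\<lambda>z. - m z) = - ev m"
  by (simp add: ev_def supp_def ev_term_uminus sum_negf)

lemma ev_zero: "ev (\<lambda>z. 0) = 0"
  by (simp add: ev_def supp_def)

lemma ev_single: "ev (\<lambda>z'. if z' = z then F else 0) = ev_term F z"
proof -
  have "supp (\<lambda>z'. if z' = z then F else 0) \<subseteq> {z}" by (auto simp: supp_def)
  thus ?thesis by (simp add: ev_superset[of "{z}"])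
qed

lemma flip_0 [simp]: "flip 0 = 0"
  by (rule fls_eqI) (simp add: flip_nth)

lemma flip_flip [simp]: "flip (flip F) = F"
proof (rule fls_eqI)
  fix m
  have "(-1 :: complex) powi m * (-1) powi m = ((-1) * (-1)) powi m"
    by (rule power_int_mult_distrib[symmetric])
  thus "fls_nth (flip (flip F)) m = fls_nth F m" by (simp add: flip_nth mult.assoc)
qed

lemma flip_eq_0_iff [simp]: "flip F = 0 \<longleftrightarrow> F = 0"
  by (metis flip_0 flip_flip)

lemma ev_term_flip: "z \<in> zlattice n \<Longrightarrow> ev_term (flip F) (\<tau> z) = ev_term F z"
  by (simp add: ev_term_def flip_nth T_tau DT_tau)

text \<open>
  Evaluation forgets the action of \<open>\<tau>\<close>, which combines \<open>t \<mapsto> -t\<close> with the transposition of the lattice: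
  the sign of \<open>[t\<^sup>-\<^sup>1]\<close> compensates the one in \<open>DT(\<tau> z) = - DT(z)\<close>.
\<close>

lemma ev_flip:
  assumes "supp m \<subseteq> zlattice n"
  shows "ev (\<lambda>z. flip (m (\<tau> z))) = ev m"
proof -
  have "supp (\<lambda>z. flip (m (\<tau> z))) = \<tau> ` supp m"
    by (auto simp: supp_def image_iff) (metis tau_tau)
  hence "ev (\<lambda>z. flip (m (\<tau> z))) = (\<Sum>z\<in>\<tau> ` supp m. ev_term (flip (m (\<tau> z))) z)"
    by (simp add: ev_def)
  also have "\<dots> = (\<Sum>z\<in>supp m. ev_term (flip (m z)) (\<tau> z))"
    by (subst sum.reindex) (auto simp: inj_on_def tau_inj)
  also have "\<dots> = ev m"
    unfolding ev_def by (intro sum.cong refl ev_term_flip) (use assms in auto)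
  finally show ?thesis .
qed

section \<open>The operators on the singular module\<close>

lemma supp_gt_fls:
  assumes "1 \<le> r" "r \<le> n" "1 \<le> s" "s \<le> n"
  shows "supp (gt_fls r s z) \<subseteq> reach r s z" "supp (\<lambda>y. fls_shift 1 (gt_fls r s z y)) \<subseteq> reach r s z"
  using gt_fls_reach[OF assms] by (force simp: supp_def)+

text \<open>
  The operators of the theorem in terms of evaluation; the shift of the series by one is the division
  by \<open>t\<close>. For \<open>\<tau> z = z\<close> the value 0 on \<open>DT z\<close> is forced, as then \<open>DT z = - DT z\<close>.
\<close>

definition \<rho> :: "nat \<Rightarrow> nat \<Rightarrow> 'v \<Rightarrow> 'v" where
  "\<rho> r s = (SOME \<rho>. Vector_Spaces.linear sc sc \<rho> \<and> (\<forall>z\<in>zlattice n. \<rho> (T z) = ev (gt_fls r s z) \<and>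
     \<rho> (DT z) = (if \<tau> z = z then 0 else ev (\<lambda>y. fls_shift 1 (gt_fls r s z y)))))"

definition act :: "nat \<Rightarrow> nat \<Rightarrow> (zvec \<Rightarrow> complex fls) \<Rightarrow> zvec \<Rightarrow> complex fls" where
  "act r s m y = (\<Sum>z\<in>supp m. m z * gt_fls r s z y)"

text \<open>
  The \<open>\<tau>\<close>-invariant combinations of the \<open>T(v\<^sub>t + z)\<close> with at most simple poles.
\<close>

definition invariant :: "(zvec \<Rightarrow> complex fls) \<Rightarrow> bool" where
  "invariant m \<longleftrightarrow> finite (supp m) \<and> supp m \<subseteq> zlattice n \<and> (\<forall>z p. p < -1 \<longrightarrow> fls_nth (m z) p = 0) \<and>
     (\<forall>z. m (\<tau> z) = flip (m z))"

text \<open>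
  At a fixed point of \<open>\<tau>\<close> an invariant combination has an even coefficient.
\<close>

lemma invariant_fixed:
  assumes "invariant m" "\<tau> z = z"
  shows "fls_nth (m z) (-1) = 0" "fls_nth (m z) 1 = 0" "p < 0 \<Longrightarrow> fls_nth (m z) p = 0"
proof -
  have "m z = flip (m z)" using assms unfolding invariant_def by metis
  hence *: "fls_nth (m z) p = fls_nth (m z) p * (-1) powi p" for p by (metis flip_nth)
  show 1: "fls_nth (m z) (-1) = 0" "fls_nth (m z) 1 = 0" using *[of "-1"] *[of 1] by simp_all
  show "p < 0 \<Longrightarrow> fls_nth (m z) p = 0"
    using assms(1) 1 by (cases "p = -1") (auto simp: invariant_def)
qed

lemma act_superset:
  assumes "finite S" "supp m \<subseteq> S"
  shows "act r s m y = (\<Sum>z\<in>S. m z * gt_fls r s z y)"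
  unfolding act_def by (rule sum.mono_neutral_left) (use assms in \<open>auto simp: supp_def\<close>)

context
  fixes r s :: nat
  assumes rs: "1 \<le> r" "r \<le> n" "1 \<le> s" "s \<le> n"
begin

lemma rho_spec:
  "Vector_Spaces.linear sc sc (\<rho> r s) \<and> (\<forall>z\<in>zlattice n. \<rho> r s (T z) = ev (gt_fls r s z) \<and>
     \<rho> r s (DT z) = (if \<tau> z = z then 0 else ev (\<lambda>y. fls_shift 1 (gt_fls r s z y))))"
proof -
  have "\<exists>\<rho>. Vector_Spaces.linear sc sc \<rho> \<and> (\<forall>z\<in>zlattice n. \<rho> (T z) = ev (gt_fls r s z) \<and>
     \<rho> (DT z) = (if \<tau> z = z then 0 else ev (\<lambda>y. fls_shift 1 (gt_fls r s z y))))"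
  proof (rule linear_extension)
    fix z assume z: "z \<in> zlattice n"
    have lat: "supp (gt_fls r s z) \<subseteq> zlattice n" "supp (\<lambda>y. fls_shift 1 (gt_fls r s z y)) \<subseteq> zlattice n"
      using supp_gt_fls[OF rs] reach_zlattice[OF z rs(2,4)] by blast+
    have L: "gt_fls r s (\<tau> z) = (\<lambda>y. flip (gt_fls r s z (\<tau> y)))"
      using gt_fls_tau[OF rs, of z] by (metis tau_tau)
    show "ev (gt_fls r s (\<tau> z)) = ev (gt_fls r s z)"
      unfolding L by (rule ev_flip[OF lat(1)])
    have "fls_shift 1 (flip F) = - flip (fls_shift 1 F)" for F
      by (rule fls_eqI) (simp add: flip_nth power_int_add)
    hence "ev (\<lambda>y. fls_shift 1 (gt_fls r s (\<tau> z) y)) = - ev (\<lambda>y. fls_shift 1 (gt_fls r s z y))"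
      unfolding L using ev_flip[OF lat(2)] by (simp add: ev_uminus)
    thus "(if \<tau> (\<tau> z) = \<tau> z then 0 else ev (\<lambda>y. fls_shift 1 (gt_fls r s (\<tau> z) y))) =
        - (if \<tau> z = z then 0 else ev (\<lambda>y. fls_shift 1 (gt_fls r s z y)))"
      by (simp add: tau_inj)
  qed
  from someI_ex[OF this] show ?thesis unfolding \<rho>_def .
qed

lemma supp_act: "supp (act r s m) \<subseteq> (\<Union>z\<in>supp m. reach r s z)"
proof
  fix y assume "y \<in> supp (act r s m)"
  hence "(\<Sum>z\<in>supp m. m z * gt_fls r s z y) \<noteq> 0" by (simp add: supp_def[of "act r s m"] act_def)
  then obtain z where z: "z \<in> supp m" "m z * gt_fls r s z y \<noteq> 0"
    by (rule sum.not_neutral_contains_not_neutral)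
  hence "y \<in> reach r s z" using gt_fls_reach[OF rs, of y z] by (metis mult_zero_right)
  thus "y \<in> (\<Union>z\<in>supp m. reach r s z)" using z by blast
qed

text \<open>
  For \<open>\<tau> z \<noteq> z\<close> the series \<open>m z\<close> may have a simple pole and the coefficient of the operator is regular;
  for \<open>\<tau> z = z\<close> it is the other way round, and the term \<open>[t\<^sup>1](m z) [t\<^sup>-\<^sup>1](gt_fls r s z y)\<close> drops out as \<open>m z\<close>
  is even.
\<close>

lemma ev_term_mult_gt_fls:
  assumes m: "invariant m" and z: "z \<in> zlattice n"
  shows "p < -1 \<Longrightarrow> fls_nth (m z * gt_fls r s z y) p = 0"
    and "ev_term (m z * gt_fls r s z y) y = sc (fls_nth (m z) 0) (ev_term (gt_fls r s z y) y) +
      sc (fls_nth (m z) (-1)) (if \<tau> z = z then 0 else ev_term (fls_shift 1 (gt_fls r s z y)) y)"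
proof -
  have "(p < -1 \<longrightarrow> fls_nth (m z * gt_fls r s z y) p = 0) \<and>
    ev_term (m z * gt_fls r s z y) y = sc (fls_nth (m z) 0) (ev_term (gt_fls r s z y) y) +
      sc (fls_nth (m z) (-1)) (if \<tau> z = z then 0 else ev_term (fls_shift 1 (gt_fls r s z y)) y)"
  proof (cases "\<tau> z = z")
    case True
    have P: "p < -1 \<Longrightarrow> fls_nth (gt_fls r s z y * m z) p = 0"
        "fls_nth (gt_fls r s z y * m z) (-1) = fls_nth (gt_fls r s z y) (-1) * fls_nth (m z) 0"
        "fls_nth (gt_fls r s z y * m z) 0 = fls_nth (gt_fls r s z y) (-1) * fls_nth (m z) 1 + fls_nth (gt_fls r s z y) 0 * fls_nth (m z) 0"
      by (rule fls_nth_mult_simple_pole; use gt_fls_pole(1)[OF rs] invariant_fixed(3)[OF m True] in simp)+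
    show ?thesis using P True invariant_fixed(1,2)[OF m True]
      by (simp add: ev_term_def mult.commute[of "m z"] V.scale_right_distrib mult.commute[of "fls_nth (m z) 0"])
  next
    case False
    have m1: "fls_nth (m z) p = 0" if "p < -1" for p using m that by (simp add: invariant_def)
    have P: "p < -1 \<Longrightarrow> fls_nth (m z * gt_fls r s z y) p = 0"
        "fls_nth (m z * gt_fls r s z y) (-1) = fls_nth (m z) (-1) * fls_nth (gt_fls r s z y) 0"
        "fls_nth (m z * gt_fls r s z y) 0 = fls_nth (m z) (-1) * fls_nth (gt_fls r s z y) 1 + fls_nth (m z) 0 * fls_nth (gt_fls r s z y) 0"
      by (rule fls_nth_mult_simple_pole; use gt_fls_regular(1)[OF rs False] m1 in simp)+
    show ?thesis using P False gt_fls_regular(1)[OF rs False, of "-1"]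
      by (simp add: ev_term_def V.scale_right_distrib V.scale_left_distrib)
  qed
  thus "p < -1 \<Longrightarrow> fls_nth (m z * gt_fls r s z y) p = 0"
    and "ev_term (m z * gt_fls r s z y) y = sc (fls_nth (m z) 0) (ev_term (gt_fls r s z y) y) +
      sc (fls_nth (m z) (-1)) (if \<tau> z = z then 0 else ev_term (fls_shift 1 (gt_fls r s z y)) y)" by auto
qed

text \<open>
  No double poles arise, because either \<open>m z\<close> or the coefficient of the operator is regular.
\<close>

lemma invariant_act:
  assumes m: "invariant m"
  shows "invariant (act r s m)"
  unfolding invariant_def
proof (intro conjI allI impI)
  have fin: "finite (supp m)" and lat: "supp m \<subseteq> zlattice n" and tau: "\<And>z. m (\<tau> z) = flip (m z)"
    using m by (auto simp: invariant_def)
  show "finite (supp (act r s m))"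
    by (rule finite_subset[OF supp_act]) (use fin finite_reach in auto)
  show "supp (act r s m) \<subseteq> zlattice n"
    using supp_act[of m] lat reach_zlattice[OF _ rs(2,4)] by blast
  show "fls_nth (act r s m z) p = 0" if "p < -1" for z p
    unfolding act_def fls_nth_sum
    by (rule sum.neutral) (use ev_term_mult_gt_fls(1)[OF m _ that] lat in blast)
  show "act r s m (\<tau> y) = flip (act r s m y)" for y
  proof -
    have "supp m = \<tau> ` supp m"
    proof
      show "supp m \<subseteq> \<tau> ` supp m"
      proof
        fix z assume "z \<in> supp m"
        hence "\<tau> z \<in> supp m" by (simp add: supp_def tau)
        hence "\<tau> (\<tau> z) \<in> \<tau> ` supp m" by (rule imageI)
        thus "z \<in> \<tau> ` supp m" by simp
      qed
    qed (auto simp: supp_def tau)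
    hence "act r s m (\<tau> y) = (\<Sum>z\<in>\<tau> ` supp m. m z * gt_fls r s z (\<tau> y))"
      unfolding act_def by simp
    also have "\<dots> = (\<Sum>z\<in>supp m. m (\<tau> z) * gt_fls r s (\<tau> z) (\<tau> y))"
      by (subst sum.reindex) (auto simp: inj_on_def tau_inj)
    also have "\<dots> = flip (act r s m y)"
      by (simp add: act_def flip_sum flip_mult tau gt_fls_tau[OF rs])
    finally show ?thesis .
  qed
qed

text \<open>
  Both sides are sums over the terms of \<open>m\<close>, and \<open>ev_term_mult_gt_fls\<close> compares them term by term.
\<close>

lemma rho_ev:
  assumes m: "invariant m"
  shows "\<rho> r s (ev m) = ev (act r s m)"
proof -
  interpret R: Vector_Spaces.linear sc sc "\<rho> r s" using rho_spec by blast
  have fin: "finite (supp m)" and lat: "supp m \<subseteq> zlattice n" using m by (auto simp: invariant_def)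
  define S where "S = (\<Union>z\<in>supp m. reach r s z)"
  have S: "finite S" "supp (act r s m) \<subseteq> S" using fin finite_reach supp_act by (auto simp: S_def)
  have sub: "supp (gt_fls r s z) \<subseteq> S" "supp (\<lambda>y. fls_shift 1 (gt_fls r s z y)) \<subseteq> S" if "z \<in> supp m" for z
    using supp_gt_fls[OF rs, of z] that by (auto simp: S_def)
  have "ev (act r s m) = (\<Sum>y\<in>S. \<Sum>z\<in>supp m. ev_term (m z * gt_fls r s z y) y)"
    unfolding ev_superset[OF S] by (simp add: act_def ev_term_sum)
  also have "\<dots> = (\<Sum>z\<in>supp m. \<Sum>y\<in>S. ev_term (m z * gt_fls r s z y) y)" by (rule sum.swap)
  also have "\<dots> = (\<Sum>z\<in>supp m. \<rho> r s (ev_term (m z) z))"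
  proof (rule sum.cong, rule refl)
    fix z assume z: "z \<in> supp m"
    hence zl: "z \<in> zlattice n" using lat by blast
    have "(\<Sum>y\<in>S. ev_term (m z * gt_fls r s z y) y) =
        sc (fls_nth (m z) 0) (\<Sum>y\<in>S. ev_term (gt_fls r s z y) y) +
        sc (fls_nth (m z) (-1)) (\<Sum>y\<in>S. if \<tau> z = z then 0 else ev_term (fls_shift 1 (gt_fls r s z y)) y)"
      unfolding ev_term_mult_gt_fls(2)[OF m zl] sum.distrib V.scale_sum_right ..
    also have "(\<Sum>y\<in>S. ev_term (gt_fls r s z y) y) = \<rho> r s (T z)"
      using rho_spec zl ev_superset[OF S(1) sub(1)[OF z]] by simp
    also have "(\<Sum>y\<in>S. if \<tau> z = z then 0 else ev_term (fls_shift 1 (gt_fls r s z y)) y) = \<rho> r s (DT z)"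
      using rho_spec zl ev_superset[OF S(1) sub(2)[OF z]] by simp
    finally show "(\<Sum>y\<in>S. ev_term (m z * gt_fls r s z y) y) = \<rho> r s (ev_term (m z) z)"
      by (simp add: ev_term_def R.add R.scale)
  qed
  also have "\<dots> = \<rho> r s (ev m)" by (simp add: ev_def R.sum)
  finally show ?thesis ..
qed

end

text \<open>
  The symmetrization \<open>(T(v\<^sub>t + z) + T(v\<^sub>t + \<tau> z))/2\<close> evaluates to \<open>T z\<close>.
\<close>

lemma T_eq_ev:
  assumes z: "z \<in> zlattice n"
  shows "\<exists>m. invariant m \<and> ev m = T z"
proof -
  define F where "F = fls_const (1/2 :: complex)"
  define m where "m y = (if y = z then F else 0) + (if y = \<tau> z then F else 0)" for y
  have fin: "finite (supp (\<lambda>y. if y = u then F else 0))" for u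
    by (rule finite_subset[of _ "{u}"]) (auto simp: supp_def)
  have "ev m = ev_term F z + ev_term F (\<tau> z)"
    unfolding m_def[abs_def] ev_add[OF fin fin] ev_single ..
  also have "\<dots> = sc (1/2 + 1/2) (T z)"
    unfolding V.scale_left_distrib by (simp add: ev_term_def F_def T_tau[OF z])
  finally have "ev m = T z" by simp
  moreover have "invariant m"
    unfolding invariant_def
  proof (intro conjI allI impI)
    have s: "supp m \<subseteq> {z, \<tau> z}" by (auto simp: supp_def m_def)
    show "finite (supp m)" by (rule finite_subset[OF s]) simp
    show "supp m \<subseteq> zlattice n" using s z tau_zlattice[OF z] by blast
    show "fls_nth (m y) p = 0" if "p < -1" for y p using that by (simp add: m_def F_def)
    have t: "\<tau> y = z \<longleftrightarrow> y = \<tau> z" for y by (metis tau_tau)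
    show "m (\<tau> y) = flip (m y)" for y
      by (rule fls_eqI) (auto simp: m_def F_def t tau_inj flip_nth)
  qed
  ultimately show ?thesis by blast
qed

text \<open>
  The element \<open>(T(v\<^sub>t + z) - T(v\<^sub>t + \<tau> z))/(2t)\<close> is invariant and evaluates to \<open>DT z\<close>.
\<close>

lemma DT_eq_ev:
  assumes z: "z \<in> zlattice n"
  shows "\<exists>m. invariant m \<and> ev m = DT z"
proof -
  define F where "F = fls_shift 1 (fls_const (1/2 :: complex))"
  define m where "m y = (if y = z then F else 0) - (if y = \<tau> z then F else 0)" for y
  have fin: "finite (supp (\<lambda>y. if y = u then F else 0))" for u
    by (rule finite_subset[of _ "{u}"]) (auto simp: supp_def)
  have "ev m = ev_term F z - ev_term F (\<tau> z)"
    unfolding m_def[abs_def] ev_diff[OF fin fin] ev_single ..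
  also have "\<dots> = sc (1/2 + 1/2) (DT z)"
    unfolding V.scale_left_distrib by (simp add: ev_term_def F_def DT_tau[OF z])
  finally have "ev m = DT z" by simp
  moreover have "invariant m"
    unfolding invariant_def
  proof (intro conjI allI impI)
    have s: "supp m \<subseteq> {z, \<tau> z}" by (auto simp: supp_def m_def)
    show "finite (supp m)" by (rule finite_subset[OF s]) simp
    show "supp m \<subseteq> zlattice n" using s z tau_zlattice[OF z] by blast
    show "fls_nth (m y) p = 0" if "p < -1" for y p using that by (simp add: m_def F_def)
    have t: "\<tau> y = z \<longleftrightarrow> y = \<tau> z" for y by (metis tau_tau)
    have F: "fls_nth F p * (-1) powi p = - fls_nth F p" for p
      by (cases "p = -1") (auto simp: F_def)
    show "m (\<tau> y) = flip (m y)" for y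
      by (rule fls_eqI) (auto simp: m_def t tau_inj flip_nth F left_diff_distrib)
  qed
  ultimately show ?thesis by blast
qed

lemma act_act:
  assumes rs: "1 \<le> r" "r \<le> n" "1 \<le> s" "s \<le> n" and tu: "1 \<le> t" "t \<le> n" "1 \<le> u" "u \<le> n"
    and fin: "finite (supp m)"
  shows "act r s (act t u m) y = (\<Sum>z\<in>supp m. m z * (\<Sum>x\<in>reach t u z. gt_fls t u z x * gt_fls r s x y))"
proof -
  define S where "S = (\<Union>z\<in>supp m. reach t u z)"
  have S: "finite S" "supp (act t u m) \<subseteq> S" using fin finite_reach supp_act[OF tu] by (auto simp: S_def)
  have "act r s (act t u m) y = (\<Sum>x\<in>S. \<Sum>z\<in>supp m. m z * (gt_fls t u z x * gt_fls r s x y))"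
    unfolding act_superset[OF S] by (simp add: act_def sum_distrib_right mult.assoc)
  also have "\<dots> = (\<Sum>z\<in>supp m. \<Sum>x\<in>S. m z * (gt_fls t u z x * gt_fls r s x y))" by (rule sum.swap)
  also have "\<dots> = (\<Sum>z\<in>supp m. m z * (\<Sum>x\<in>reach t u z. gt_fls t u z x * gt_fls r s x y))"
  proof (rule sum.cong, rule refl)
    fix z assume z: "z \<in> supp m"
    have "(\<Sum>x\<in>S. gt_fls t u z x * gt_fls r s x y) = (\<Sum>x\<in>reach t u z. gt_fls t u z x * gt_fls r s x y)"
      by (rule sum.mono_neutral_right) (use S z gt_fls_reach[OF tu] in \<open>auto simp: S_def\<close>)
    thus "(\<Sum>x\<in>S. m z * (gt_fls t u z x * gt_fls r s x y)) = m z * (\<Sum>x\<in>reach t u z. gt_fls t u z x * gt_fls r s x y)"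
      by (simp add: sum_distrib_left[symmetric])
  qed
  finally show ?thesis .
qed

text \<open>
  Both sides are evaluations of invariant combinations by \<open>rho_ev\<close>, and these combinations agree by the
  relations of the generic modules.
\<close>

lemma rho_relations_ev:
  assumes rs: "1 \<le> r" "r \<le> n" "1 \<le> s" "s \<le> n" and tu: "1 \<le> t" "t \<le> n" "1 \<le> u" "u \<le> n"
    and m: "invariant m"
  shows "\<rho> r s (\<rho> t u (ev m)) - \<rho> t u (\<rho> r s (ev m)) =
    (if s = t then \<rho> r u (ev m) else 0) - (if u = r then \<rho> t s (ev m) else 0)"
proof -
  have fin: "finite (supp m)" using m by (simp add: invariant_def)
  have "act r s (act t u m) y - act t u (act r s m) y =
      (if s = t then act r u m y else 0) - (if u = r then act t s m y else 0)" for y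
  proof -
    have "act r s (act t u m) y - act t u (act r s m) y =
        (\<Sum>z\<in>supp m. m z * ((if s = t then gt_fls r u z y else 0) - (if u = r then gt_fls t s z y else 0)))"
      unfolding act_act[OF rs tu fin] act_act[OF tu rs fin] sum_subtractf[symmetric] right_diff_distrib[symmetric]
        gt_fls_relations[OF rs tu] ..
    thus ?thesis by (simp add: act_def right_diff_distrib sum_subtractf)
  qed
  hence "ev (\<lambda>y. act r s (act t u m) y - act t u (act r s m) y) =
      ev (\<lambda>y. (if s = t then act r u m y else 0) - (if u = r then act t s m y else 0))" by simp
  also have "ev (\<lambda>y. act r s (act t u m) y - act t u (act r s m) y) =
      \<rho> r s (\<rho> t u (ev m)) - \<rho> t u (\<rho> r s (ev m))"
    unfolding rho_ev[OF tu m] rho_ev[OF rs m] rho_ev[OF rs invariant_act[OF tu m]] rho_ev[OF tu invariant_act[OF rs m]]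
    using invariant_act[OF rs invariant_act[OF tu m]] invariant_act[OF tu invariant_act[OF rs m]]
    by (intro ev_diff) (simp_all add: invariant_def)
  also have "ev (\<lambda>y. (if s = t then act r u m y else 0) - (if u = r then act t s m y else 0)) =
      ev (\<lambda>y. if s = t then act r u m y else 0) - ev (\<lambda>y. if u = r then act t s m y else 0)"
  proof (rule ev_diff)
    show "finite (supp (\<lambda>y. if s = t then act r u m y else 0))"
      using invariant_act[OF rs(1,2) tu(3,4) m] by (cases "s = t") (simp_all add: invariant_def supp_def)
    show "finite (supp (\<lambda>y. if u = r then act t s m y else 0))"
      using invariant_act[OF tu(1,2) rs(3,4) m] by (cases "u = r") (simp_all add: invariant_def supp_def)
  qed
  also have "ev (\<lambda>y. if s = t then act r u m y else 0) = (if s = t then \<rho> r u (ev m) else 0)"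
    using rho_ev[OF rs(1,2) tu(3,4) m] by (cases "s = t") (simp_all add: ev_zero)
  also have "ev (\<lambda>y. if u = r then act t s m y else 0) = (if u = r then \<rho> t s (ev m) else 0)"
    using rho_ev[OF tu(1,2) rs(3,4) m] by (cases "u = r") (simp_all add: ev_zero)
  finally show ?thesis .
qed

lemma linear_rho:
  "1 \<le> r \<Longrightarrow> r \<le> n \<Longrightarrow> 1 \<le> s \<Longrightarrow> s \<le> n \<Longrightarrow> Vector_Spaces.linear sc sc (\<rho> r s)"
  using rho_spec by blast

lemma rho_relations:
  assumes rs: "1 \<le> r" "r \<le> n" "1 \<le> s" "s \<le> n" and tu: "1 \<le> t" "t \<le> n" "1 \<le> u" "u \<le> n"
  shows "\<rho> r s (\<rho> t u x) - \<rho> t u (\<rho> r s x) = (if s = t then \<rho> r u x else 0) - (if u = r then \<rho> t s x else 0)"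
proof (rule linear_eqI[where A = "\<lambda>x. \<rho> r s (\<rho> t u x) - \<rho> t u (\<rho> r s x)"
      and B = "\<lambda>x. (if s = t then \<rho> r u x else 0) - (if u = r then \<rho> t s x else 0)"])
  note lin = linear_rho[OF rs] linear_rho[OF tu] linear_rho[OF rs(1,2) tu(3,4)] linear_rho[OF tu(1,2) rs(3,4)]
  show "Vector_Spaces.linear sc sc (\<lambda>x. \<rho> r s (\<rho> t u x) - \<rho> t u (\<rho> r s x))"
    using lin by (simp add: Vector_Spaces.linear_iff V.scale_right_diff_distrib)
  show "Vector_Spaces.linear sc sc (\<lambda>x. (if s = t then \<rho> r u x else 0) - (if u = r then \<rho> t s x else 0))"
    using lin by (cases "s = t"; cases "u = r") (simp_all add: Vector_Spaces.linear_iff V.scale_right_diff_distrib)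
  fix z assume z: "z \<in> zlattice n"
  obtain m m' where m: "invariant m" "ev m = T z" and m': "invariant m'" "ev m' = DT z"
    using T_eq_ev[OF z] DT_eq_ev[OF z] by blast
  show "\<rho> r s (\<rho> t u (T z)) - \<rho> t u (\<rho> r s (T z)) =
      (if s = t then \<rho> r u (T z) else 0) - (if u = r then \<rho> t s (T z) else 0)"
    using rho_relations_ev[OF rs tu m(1)] unfolding m(2) .
  show "\<rho> r s (\<rho> t u (DT z)) - \<rho> t u (\<rho> r s (DT z)) =
      (if s = t then \<rho> r u (DT z) else 0) - (if u = r then \<rho> t s (DT z) else 0)"
    using rho_relations_ev[OF rs tu m'(1)] unfolding m'(2) .
qed

lemma delta_nonzero: "generic n v \<Longrightarrow> \<delta> v \<noteq> 0"
  using bounds ij kn by (force simp: generic_def)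

text \<open>
  The sum in \<open>D_comb\<close> runs over the tableaux with a nonzero coefficient, which include all those with
  a nonzero Laurent series. The function \<open>F\<close> covers both prescriptions: the identity when \<open>c\<close> contains
  the factor \<open>x - y = t\<close>, and the division by \<open>t\<close> otherwise.
\<close>

lemma D_comb_eq:
  assumes rs: "1 \<le> r" "r \<le> n" "1 \<le> s" "s \<le> n"
    and c: "\<And>y. (\<And>v. generic n v \<Longrightarrow> c y v = 0) \<Longrightarrow> gt_fls r s z y = 0"
    and D: "\<And>y. D_rat n k i j vbar (c y) = fls_nth (F (gt_fls r s z y)) 0"
    and val: "\<And>y. rat_value n vbar (c y) = fls_nth (F (gt_fls r s z y)) (-1)"
    and F: "F 0 = 0" and Z: "\<And>y v. y \<notin> reach r s z \<Longrightarrow> c y v = 0"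
  shows "D_comb n k i j vbar sc T DT c = ev (\<lambda>y. F (gt_fls r s z y))"
proof -
  let ?Z = "{y. \<exists>v. generic n v \<and> c y v \<noteq> 0}"
  have "?Z \<subseteq> reach r s z" using Z by blast
  hence fin: "finite ?Z" by (rule finite_subset) (rule finite_reach)
  have "supp (\<lambda>y. F (gt_fls r s z y)) \<subseteq> ?Z"
    unfolding supp_def using c F by fastforce
  from ev_superset[OF fin this] show ?thesis
    by (simp add: D_comb_def ev_term_def D val)
qed

lemma rho_T:
  assumes rs: "1 \<le> r" "r \<le> n" "1 \<le> s" "s \<le> n" and z: "z \<in> zlattice n"
  shows "\<rho> r s (T z) = D_comb n k i j vbar sc T DT (\<lambda>y v. \<delta> v * gt_coeff n a r s z y v)"
proof -
  have "D_comb n k i j vbar sc T DT (\<lambda>y v. \<delta> v * gt_coeff n a r s z y v) = ev (gt_fls r s z)"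
    by (rule D_comb_eq[OF rs, where F = "\<lambda>x. x"])
      (use gt_fls_pole[OF rs] gt_fls_eq_0[OF rs] delta_nonzero gt_coeff_reach in auto)
  thus ?thesis using rho_spec[OF rs] z by simp
qed

lemma rho_DT:
  assumes rs: "1 \<le> r" "r \<le> n" "1 \<le> s" "s \<le> n" and z: "z \<in> zlattice n" "\<tau> z \<noteq> z"
  shows "\<rho> r s (DT z) = D_comb n k i j vbar sc T DT (\<lambda>y v. gt_coeff n a r s z y v)"
proof -
  have "D_comb n k i j vbar sc T DT (\<lambda>y v. gt_coeff n a r s z y v) = ev (\<lambda>y. fls_shift 1 (gt_fls r s z y))"
    by (rule D_comb_eq[OF rs, where F = "fls_shift 1"])
      (use gt_fls_regular[OF rs z(2)] gt_fls_eq_0[OF rs] gt_coeff_reach in auto)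
  thus ?thesis using rho_spec[OF rs] z by simp
qed

lemma singular_gl_module:
  "\<exists>\<rho>. gl_module n sc \<rho> \<and>
    (\<forall>r\<in>{1..n}. \<forall>s\<in>{1..n}. \<forall>z\<in>zlattice n.
       \<rho> (elem_mat n r s) (T z) =
         D_comb n k i j vbar sc T DT (\<lambda>z' v. (v k i - v k j) * gt_coeff n a r s z z' v)) \<and>
    (\<forall>r\<in>{1..n}. \<forall>s\<in>{1..n}. \<forall>w\<in>zlattice n. tau k i j w \<noteq> w \<longrightarrow>
       \<rho> (elem_mat n r s) (DT w) =
         D_comb n k i j vbar sc T DT (\<lambda>z' v. gt_coeff n a r s w z' v))"
proof -
  let ?\<rho> = "\<lambda>A x. \<Sum>r<n. \<Sum>s<n. sc (A $$ (r, s)) (\<rho> (Suc r) (Suc s) x)"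
  have "gl_module n sc ?\<rho>"
    by (rule gl_moduleI[OF vector_space_sc]) (use linear_rho rho_relations in auto)
  moreover have eq: "?\<rho> (elem_mat n r s) x = \<rho> r s x" if rs: "r \<in> {1..n}" "s \<in> {1..n}" for r s x
  proof -
    have "?\<rho> (elem_mat n r s) x =
        (\<Sum>r'<n. \<Sum>s'<n. if s' = s - 1 then if r' = r - 1 then \<rho> r s x else 0 else 0)"
      by (intro sum.cong refl) (use rs in \<open>auto simp: elem_mat_def\<close>)
    also have "\<dots> = \<rho> r s x"
    proof -
      have "r - 1 < n" "s - 1 < n" using rs by auto
      thus ?thesis by simp
    qed
    finally show ?thesis .
  qed
  moreover have "?\<rho> (elem_mat n r s) (T z) =
      D_comb n k i j vbar sc T DT (\<lambda>z' v. (v k i - v k j) * gt_coeff n a r s z z' v)"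
    if "r \<in> {1..n}" "s \<in> {1..n}" "z \<in> zlattice n" for r s z
    unfolding eq[OF that(1,2)] by (rule rho_T) (use that in auto)
  moreover have "?\<rho> (elem_mat n r s) (DT w) =
      D_comb n k i j vbar sc T DT (\<lambda>z' v. gt_coeff n a r s w z' v)"
    if "r \<in> {1..n}" "s \<in> {1..n}" "w \<in> zlattice n" "\<tau> w \<noteq> w" for r s w
    unfolding eq[OF that(1,2)] by (rule rho_DT) (use that in auto)
  ultimately show ?thesis by blast
qed

end

theorem theorem4p9:
  fixes n k i j :: nat and a :: "nat \<Rightarrow> complex" and vbar :: cvec
    and sc :: "complex \<Rightarrow> 'v \<Rightarrow> 'v::ab_group_add" and T DT :: "zvec \<Rightarrow> 'v"
  assumes "1 \<le> i" and "i < j" and "j \<le> k" and "k \<le> n - 1"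
    and "one_singular n vbar"
    and "vbar k i = vbar k j"
    and "\<And>r s u. 1 \<le> s \<Longrightarrow> s < u \<Longrightarrow> u \<le> r \<Longrightarrow> r \<le> n - 1 \<Longrightarrow> (r, s, u) \<noteq> (k, i, j) \<Longrightarrow>
           vbar r s - vbar r u \<notin> \<int>"
    and "tableau_space n k i j sc T DT"
  shows "\<exists>\<rho>. gl_module n sc \<rho> \<and>
    (\<forall>r\<in>{1..n}. \<forall>s\<in>{1..n}. \<forall>z\<in>zlattice n.
       \<rho> (elem_mat n r s) (T z) =
         D_comb n k i j vbar sc T DT (\<lambda>z' v. (v k i - v k j) * gt_coeff n a r s z z' v)) \<and>
    (\<forall>r\<in>{1..n}. \<forall>s\<in>{1..n}. \<forall>w\<in>zlattice n. tau k i j w \<noteq> w \<longrightarrow>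
       \<rho> (elem_mat n r s) (DT w) =
         D_comb n k i j vbar sc T DT (\<lambda>z' v. gt_coeff n a r s w z' v))"
proof -
  interpret singular_module n k i j a vbar sc T DT
    by unfold_locales (use assms in auto)
  show ?thesis by (rule singular_gl_module)
qed

end
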